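(* Let $(M,\omega,g,J,\Omega_\gamma)$ be a toric almost Calabi--Yau manifold of real dimension $2m$ with moment map $\mu$, moment polytope $\Delta$ and real form $M^\sigma$. Let $0\le n\le m$, let $\zeta=\{\zeta_1,\dots,\zeta_n\}\subset\mathbb{Z}^m$ be linearly independent, and let $c=\{c_1,\dots,c_n\}\subset\mathbb{R}$. Put $V_\zeta:=\mathrm{Span}_{\mathbb{R}}\{\zeta_1,\dots,\zeta_n\}$, and assume that the affine plane $\bigcap_{i=1}^n\{y\mid\langle y,\zeta_i\rangle=c_i\}$ meets the interior of $\Delta$, and that every point $y\in\Delta$ with $\langle y,\zeta_i\rangle=c_i$ ($i=1,\dots,n$) is $\zeta$-regular. Assume that $$M^\sigma_{\zeta,c}:=\{p\in M^\sigma\mid\langle\mu(p),\zeta_i\rangle=c_i,\ i=1,\dots,n\}$$ is a real $(m-n)$-dimensional submanifold of $M^\sigma$ and that $T_\zeta:=V_\zeta/(V_\zeta\cap\mathbb{Z}^m)$ is isomorphic to a subtorus $T^n$ of $T^m$. Put $L_{\zeta,c}:=M^\sigma_{\zeta,c}\times T_\zeta$ and define $F_{\zeta,c}:L_{\zeta,c}\to M$ by $F_{\zeta,c}(p,[v]):=\exp(v)\cdot p$. Then $F_{\zeta,c}:L_{\zeta,c}\to M$ is a special Lagrangian submanifold if and only if $\langle\gamma,\zeta_i\rangle=0$ for all $i=1,\dots,n$.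
   Context: **Toric Kähler manifold.** $T^m\cong(S^1)^m$ is a real torus with Lie algebra $\mathfrak g\cong\mathbb{R}^m$; $\exp:\mathfrak g\to T^m$ has kernel the integral lattice $\mathbb{Z}_{\mathfrak g}\cong\mathbb{Z}^m$, i.e. $\exp(v)=(e^{2\pi i v_1},\dots,e^{2\pi i v_m})$. $(M,\omega,g,J)$ is a toric Kähler manifold of complex dimension $m$: $(M,J)$ is a smooth toric variety with fan $\Sigma$, the complexified torus $T^m_{\mathbb C}\cong(\mathbb{C}^\times)^m$ acts holomorphically with an open dense orbit, $T^m$ acts effectively preserving $\omega$, $\omega(\cdot,\cdot)=g(J\cdot,\cdot)$, and there is a moment map $\mu:M\to\mathfrak g^*$ with $d\langle\mu,v\rangle=-\omega(v_p,\cdot)$, where $v_p=\frac{d}{dt}|_{t=0}\exp(tv)\cdot p$. $\Delta:=\mu(M)$ is the moment polytope. The set of one-dimensional cones of $\Sigma$ is finite, with primitive generators $\lambda_1,\dots,\lambda_d\in\mathbb{Z}_{\mathfrak g}$; there are $\kappa_i\in\mathbb{R}$ with $\overline\Delta=\bigcap_{i=1}^d\{y\in\mathfrak g^*\mid\langle y,\lambda_i\rangle\ge\kappa_i\}$, and $\Delta$ is $\overline\Delta$ with some (possibly no) faces removed. **Real form.** $\sigma:M\to M$ is the anti-holomorphic involution determined by the fan: it satisfies $\sigma(u\cdot p)=\overline u\cdot\sigma(p)$ for $u\in T^m_{\mathbb C}$ and is complex conjugation on the open orbit $\cong(\mathbb{C}^\times)^m$. $M^\sigma$ is its fixed point set,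 a real $m$-dimensional submanifold. **Regular points.** For $y\in\Delta$ let $\mathfrak z_y:=\mathrm{Span}_{\mathbb R}\{\lambda_i\mid\langle y,\lambda_i\rangle=\kappa_i\}$. The point $y$ is $\zeta$-regular if $V_\zeta\cap\mathfrak z_y=\{0\}$. **Toric almost Calabi--Yau.** One assumes there is $\gamma=(\gamma_1,\dots,\gamma_m)\in\mathbb{Z}_{\mathfrak g}^*$ with $\langle\gamma,\lambda_i\rangle=1$ for all $i$, and $\Omega_\gamma$ is the nowhere vanishing holomorphic $(m,0)$-form on $M$ extending $e^{\gamma_1z^1+\dots+\gamma_mz^m}dz^1\wedge\dots\wedge dz^m$, where $z^j$ are the logarithmic coordinates ($e^{z^j}=w^j$) on the open orbit with coordinates $(w^1,\dots,w^m)\in(\mathbb{C}^\times)^m$. Ricci-flatness is not assumed. **Lagrangian angle, special Lagrangian.** For a Lagrangian immersion $F:L\to M$, locally $F^*\Omega_\gamma=h\,dx^1\wedge\dots\wedge dx^m$ with $h$ valued in $\mathbb{C}^*$; the Lagrangian angle is $\theta_F:=\arg h\bmod\pi$, a well-defined map $L\to\mathbb{R}/\pi\mathbb{Z}$. $F$ is a special Lagrangian submanifold (with phase $e^{i\theta_0}$) if $\theta_F$ lifts to a real-valued function that is a constant $\theta_0$. *)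

theory Defs
  imports
    "HOL-Analysis.Analysis"
    "HOL-Algebra.Coset"
    "HOL-Algebra.Product_Groups"
begin

section \<open>Smooth maps and manifolds\<close>

text \<open>
  Neither smooth functions nor manifolds with a term-level dimension are in the library.
  \<open>Ck_on k f S\<close> is meant for open \<open>S\<close>: all iterated directional derivatives of order up to
  \<open>k\<close> exist as Frechet derivatives and are continuous.
\<close>

primrec Ck_on ::
  "nat \<Rightarrow> ('e::euclidean_space \<Rightarrow> 'f::real_normed_vector) \<Rightarrow> 'e set \<Rightarrow> bool" where
  "Ck_on 0 f S \<longleftrightarrow> continuous_on S f"
| "Ck_on (Suc k) f S \<longleftrightarrow>
     (\<exists>f'. (\<forall>x\<in>S. (f has_derivative f' x) (at x)) \<and> (\<forall>v. Ck_on k (\<lambda>x. f' x v) S))"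

text \<open>Smoothness on an arbitrary subset of Euclidean space: local smooth extendability.\<close>

definition smooth_on ::
  "'e::euclidean_space set \<Rightarrow> ('e \<Rightarrow> 'f::real_normed_vector) \<Rightarrow> bool" where
  "smooth_on S f \<longleftrightarrow>
     (\<forall>x\<in>S. \<exists>U g. open U \<and> x \<in> U \<and> (\<forall>k. Ck_on k g U) \<and> (\<forall>y\<in>S \<inter> U. g y = f y))"

text \<open>
  A chart is a domain together with a coordinate map. The coordinates of a \<open>k\<close>-dimensional
  manifold take values in a \<open>k\<close>-dimensional linear subspace \<open>W\<close> of a Euclidean space, in which
  the image is relatively open; this permits dimensions that are terms. For nonempty domains
  \<open>W\<close> is \<open>model_space c\<close>, so that \<open>model_space c\<close> is the tangent space at any point of the
  chart domain, read in the coordinates of \<open>c\<close>.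
\<close>

type_synonym ('a, 'e) chart = "'a set \<times> ('a \<Rightarrow> 'e)"

definition is_chart :: "nat \<Rightarrow> 'a topology \<Rightarrow> ('a, 'e::euclidean_space) chart \<Rightarrow> bool" where
  "is_chart k X c \<longleftrightarrow>
     openin X (fst c) \<and>
     homeomorphic_map (subtopology X (fst c)) (top_of_set (snd c ` fst c)) (snd c) \<and>
     (\<exists>W. subspace W \<and> dim W = k \<and> openin (top_of_set W) (snd c ` fst c))"

definition model_space :: "('a, 'e::euclidean_space) chart \<Rightarrow> 'e set" where
  "model_space c = span (snd c ` fst c)"

definition local_rep ::
  "('a, 'e) chart \<Rightarrow> ('b, 'f) chart \<Rightarrow> ('a \<Rightarrow> 'b) \<Rightarrow> 'e \<Rightarrow> 'f" where
  "local_rep c c' F = snd c' \<circ> F \<circ> inv_into (fst c) (snd c)"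

definition local_dom ::
  "('a, 'e) chart \<Rightarrow> ('b, 'f) chart \<Rightarrow> ('a \<Rightarrow> 'b) \<Rightarrow> 'e set" where
  "local_dom c c' F = snd c ` {p \<in> fst c. F p \<in> fst c'}"

definition smoothly_compatible ::
  "('a, 'e::euclidean_space) chart \<Rightarrow> ('a, 'e) chart \<Rightarrow> bool" where
  "smoothly_compatible c c' \<longleftrightarrow>
     smooth_on (local_dom c c' id) (local_rep c c' id) \<and>
     smooth_on (local_dom c' c id) (local_rep c' c id)"

definition second_countable_top :: "'a topology \<Rightarrow> bool" where
  "second_countable_top X \<longleftrightarrow>
     (\<exists>B. countable B \<and> openin X = arbitrary union_of (\<lambda>U. U \<in> B))"

definition smooth_manifold ::
  "nat \<Rightarrow> 'a topology \<Rightarrow> ('a, 'e::euclidean_space) chart set \<Rightarrow> bool" where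
  "smooth_manifold k X A \<longleftrightarrow>
     Hausdorff_space X \<and> second_countable_top X \<and>
     (\<forall>c\<in>A. is_chart k X c) \<and> (\<Union>c\<in>A. fst c) = topspace X \<and>
     (\<forall>c\<in>A. \<forall>c'\<in>A. smoothly_compatible c c')"

text \<open>The maximal atlas.\<close>

definition smooth_charts ::
  "nat \<Rightarrow> 'a topology \<Rightarrow> ('a, 'e::euclidean_space) chart set \<Rightarrow> ('a, 'e) chart set" where
  "smooth_charts k X A = {c. is_chart k X c \<and> (\<forall>c'\<in>A. smoothly_compatible c c')}"

definition smooth_map ::
  "'a topology \<Rightarrow> ('a, 'e::euclidean_space) chart set \<Rightarrow>
   'b topology \<Rightarrow> ('b, 'f::euclidean_space) chart set \<Rightarrow> ('a \<Rightarrow> 'b) \<Rightarrow> bool" where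
  "smooth_map X A Y B F \<longleftrightarrow>
     continuous_map X Y F \<and>
     (\<forall>c\<in>A. \<forall>c'\<in>B. smooth_on (local_dom c c' F) (local_rep c c' F))"

text \<open>
  The differential of \<open>F\<close> at \<open>p\<close> in the coordinates \<open>c\<close> and \<open>c'\<close>. The derivative within the
  chart image is determined only on \<open>model_space c\<close>, so it may be applied only there.
\<close>

definition pushforward ::
  "('a, 'e::euclidean_space) chart \<Rightarrow> ('b, 'f::euclidean_space) chart \<Rightarrow>
   ('a \<Rightarrow> 'b) \<Rightarrow> 'a \<Rightarrow> 'e \<Rightarrow> 'f" where
  "pushforward c c' F p =
     frechet_derivative (local_rep c c' F) (at (snd c p) within (snd c ` fst c))"

text \<open>
  \<open>dF \<circ> J = J' \<circ> dF\<close> for structures \<open>J\<close>, \<open>J'\<close> that are constant in the given coordinates.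
\<close>

definition intertwines ::
  "('e \<Rightarrow> 'e) \<Rightarrow> ('a, 'e::euclidean_space) chart set \<Rightarrow>
   ('f \<Rightarrow> 'f) \<Rightarrow> ('b, 'f::euclidean_space) chart set \<Rightarrow> ('a \<Rightarrow> 'b) \<Rightarrow> bool" where
  "intertwines J A J' B F \<longleftrightarrow>
     (\<forall>c\<in>A. \<forall>c'\<in>B. \<forall>p\<in>fst c. F p \<in> fst c' \<longrightarrow>
        (\<forall>a\<in>model_space c. pushforward c c' F p (J a) = J' (pushforward c c' F p a)))"

definition product_charts ::
  "('a, 'e) chart set \<Rightarrow> ('b, 'f) chart set \<Rightarrow> ('a \<times> 'b, 'e \<times> 'f) chart set" where
  "product_charts A B = (\<lambda>(c, c'). (fst c \<times> fst c', map_prod (snd c) (snd c'))) ` (A \<times> B)"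

text \<open>
  Slice charts of an \<open>l\<close>-dimensional embedded submanifold \<open>S\<close> of the \<open>k\<close>-manifold \<open>(X, A)\<close>.
  Relative openness of the slice in \<open>W\<close> makes \<open>W\<close> a subspace of the model space of \<open>c\<close>.
\<close>

definition slice_charts ::
  "nat \<Rightarrow> 'a topology \<Rightarrow> ('a, 'e::euclidean_space) chart set \<Rightarrow> nat \<Rightarrow> 'a set
   \<Rightarrow> ('a, 'e) chart set" where
  "slice_charts k X A l S =
     {(fst c \<inter> S, snd c) | c. c \<in> smooth_charts k X A \<and>
        (\<exists>W. subspace W \<and> dim W = l \<and>
             snd c ` (fst c \<inter> S) = snd c ` fst c \<inter> W \<and>
             openin (top_of_set W) (snd c ` (fst c \<inter> S)))}"

definition embedded_submanifold ::
  "nat \<Rightarrow> 'a topology \<Rightarrow> ('a, 'e::euclidean_space) chart set \<Rightarrow> nat \<Rightarrow> 'a set \<Rightarrow> bool" where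
  "embedded_submanifold k X A l S \<longleftrightarrow>
     S \<subseteq> topspace X \<and> (\<Union>c\<in>slice_charts k X A l S. fst c) = S"

section \<open>Complex manifolds\<close>

definition Jstd :: "complex ^ 'm \<Rightarrow> complex ^ 'm" where
  "Jstd a = \<i> *s a"

text \<open>
  Holomorphic means smooth with complex linear differential. The complex structure \<open>J\<close> of a
  complex manifold is \<open>Jstd\<close> in every chart of its atlas.
\<close>

definition complex_manifold ::
  "'a topology \<Rightarrow> ('a, complex ^ 'm) chart set \<Rightarrow> bool" where
  "complex_manifold X A \<longleftrightarrow>
     smooth_manifold (2 * CARD('m)) X A \<and> intertwines Jstd A Jstd A id"

definition holomorphic_charts ::
  "'a topology \<Rightarrow> ('a, complex ^ 'm) chart set \<Rightarrow> ('a, complex ^ 'm) chart set" where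
  "holomorphic_charts X A =
     {c \<in> smooth_charts (2 * CARD('m)) X A.
        intertwines Jstd {c} Jstd A id \<and> intertwines Jstd A Jstd {c} id}"

text \<open>
  Tensor fields are given by their values on tangent vectors expressed in the coordinates of a
  chart; \<open>g c p a b\<close> is the value at \<open>p\<close> on the vectors with coordinates \<open>a\<close>, \<open>b\<close> in \<open>c\<close>.
\<close>

type_synonym ('a, 'm) tensor2 =
  "('a, complex ^ 'm) chart \<Rightarrow> 'a \<Rightarrow> complex ^ 'm \<Rightarrow> complex ^ 'm \<Rightarrow> real"

type_synonym ('a, 'm) mform =
  "('a, complex ^ 'm) chart \<Rightarrow> 'a \<Rightarrow> ('m \<Rightarrow> complex ^ 'm) \<Rightarrow> complex"

definition tensor_field ::
  "('a, complex ^ 'm) chart set \<Rightarrow> ('a, 'm::finite) tensor2 \<Rightarrow> bool" where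
  "tensor_field A t \<longleftrightarrow>
     (\<forall>c\<in>A. \<forall>p\<in>fst c. bilinear (t c p)) \<and>
     (\<forall>c\<in>A. \<forall>a b. smooth_on (snd c ` fst c) (\<lambda>x. t c (inv_into (fst c) (snd c) x) a b)) \<and>
     (\<forall>c\<in>A. \<forall>c'\<in>A. \<forall>p\<in>fst c \<inter> fst c'. \<forall>a b.
        t c p a b = t c' p (pushforward c c' id p a) (pushforward c c' id p b))"

text \<open>
  For the constant coordinate fields \<open>a\<close>, \<open>b\<close>, \<open>e\<close>, \<open>d\<omega>(a, b, e)\<close> is the cyclic sum of
  directional derivatives.
\<close>

definition closed_form ::
  "('a, complex ^ 'm) chart set \<Rightarrow> ('a, 'm::finite) tensor2 \<Rightarrow> bool" where
  "closed_form A \<omega> \<longleftrightarrow>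
     (\<forall>c\<in>A. \<forall>x\<in>snd c ` fst c. \<forall>a b e.
        (let w = (\<lambda>a b x. \<omega> c (inv_into (fst c) (snd c) x) a b) in
           frechet_derivative (w b e) (at x) a +
           frechet_derivative (w e a) (at x) b +
           frechet_derivative (w a b) (at x) e = 0))"

definition kaehler ::
  "'a topology \<Rightarrow> ('a, complex ^ 'm) chart set \<Rightarrow>
   ('a, 'm::finite) tensor2 \<Rightarrow> ('a, 'm) tensor2 \<Rightarrow> bool" where
  "kaehler X A \<omega> g \<longleftrightarrow>
     complex_manifold X A \<and> tensor_field A g \<and> tensor_field A \<omega> \<and>
     (\<forall>c\<in>A. \<forall>p\<in>fst c. \<forall>a b.
        g c p a b = g c p b a \<and> (a \<noteq> 0 \<longrightarrow> g c p a a > 0) \<and>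
        g c p (Jstd a) (Jstd b) = g c p a b \<and>
        \<omega> c p a b = g c p (Jstd a) b) \<and>
     closed_form A \<omega>"

text \<open>Holomorphic \<open>(m, 0)\<close>-forms: locally \<open>f dx\<^sup>1 \<and> \<dots> \<and> dx\<^sup>m\<close> with \<open>f\<close> holomorphic.\<close>

definition holomorphic_mform ::
  "'a topology \<Rightarrow> ('a, complex ^ 'm) chart set \<Rightarrow> ('a, 'm::finite) mform \<Rightarrow> bool" where
  "holomorphic_mform X A \<Omega> \<longleftrightarrow>
     (\<forall>c\<in>A. \<exists>f :: complex ^ 'm \<Rightarrow> complex.
        smooth_on (snd c ` fst c) f \<and>
        (\<forall>x\<in>snd c ` fst c. \<forall>a.
           frechet_derivative f (at x) (Jstd a) = \<i> * frechet_derivative f (at x) a) \<and>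
        (\<forall>p\<in>fst c. \<forall>a. \<Omega> c p a = f (snd c p) * det (\<chi> i j. a j $ i))) \<and>
     (\<forall>c\<in>A. \<forall>c'\<in>A. \<forall>p\<in>fst c \<inter> fst c'. \<forall>a.
        \<Omega> c p a = \<Omega> c' p (\<lambda>j. pushforward c c' id p (a j)))"

section \<open>Lattices and fans\<close>

text \<open>
  Both the Lie algebra of the torus and its dual are \<open>real ^ 'm\<close>, paired by the inner product;
  both integral lattices are \<open>int ^ 'm\<close>, embedded by \<open>rvec\<close>.
\<close>

definition rvec :: "int ^ 'm \<Rightarrow> real ^ 'm" where
  "rvec z = (\<chi> j. real_of_int (z $ j))"

definition lattice_basis :: "('m \<Rightarrow> int ^ 'm) \<Rightarrow> bool" where
  "lattice_basis e \<longleftrightarrow> (\<forall>z. \<exists>!k :: 'm \<Rightarrow> int. z = (\<Sum>i\<in>UNIV. k i *s e i))"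

definition primitive_vec :: "int ^ 'm \<Rightarrow> bool" where
  "primitive_vec z \<longleftrightarrow> z \<noteq> 0 \<and> (\<forall>k w. z = k *s w \<longrightarrow> \<bar>k\<bar> = 1)"

definition smooth_fan :: "(real ^ 'm) set set \<Rightarrow> bool" where
  "smooth_fan \<Sigma> \<longleftrightarrow>
     \<Sigma> \<noteq> {} \<and>
     (\<forall>\<tau>\<in>\<Sigma>. \<exists>e K. lattice_basis e \<and> \<tau> = convex_cone hull ((\<lambda>i. rvec (e i)) ` K)) \<and>
     (\<forall>\<tau>\<in>\<Sigma>. \<forall>F. F face_of \<tau> \<and> F \<noteq> {} \<longrightarrow> F \<in> \<Sigma>) \<and>
     (\<forall>\<tau>\<in>\<Sigma>. \<forall>\<tau>'\<in>\<Sigma>. (\<tau> \<inter> \<tau>') face_of \<tau> \<and> (\<tau> \<inter> \<tau>') face_of \<tau>')"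

definition ray_generators :: "(real ^ 'm) set set \<Rightarrow> (int ^ 'm) set" where
  "ray_generators \<Sigma> = {z. primitive_vec z \<and> convex_cone hull {rvec z} \<in> \<Sigma>}"

section \<open>Tori\<close>

definition complex_torus :: "(complex ^ 'm) set" where
  "complex_torus = {u. \<forall>j. u $ j \<noteq> 0}"

definition real_torus :: "(complex ^ 'm) set" where
  "real_torus = {u. \<forall>j. norm (u $ j) = 1}"

definition cnj_vec :: "complex ^ 'm \<Rightarrow> complex ^ 'm" where
  "cnj_vec u = (\<chi> j. cnj (u $ j))"

definition torus_exp :: "real ^ 'm \<Rightarrow> complex ^ 'm" where
  "torus_exp v = (\<chi> j. exp (2 * of_real pi * \<i> * of_real (v $ j)))"

text \<open>The isomorphism \<open>(\<complex>\<^sup>*)\<^sup>m \<rightarrow> T\<^sub>\<complex>\<close> given by the one-parameter subgroups of a lattice basis.\<close>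

definition basis_torus :: "('m \<Rightarrow> int ^ 'm) \<Rightarrow> complex ^ 'm \<Rightarrow> complex ^ 'm" where
  "basis_torus e s = (\<chi> j. \<Prod>i\<in>UNIV. s $ i powi (e i $ j))"

definition torus_group :: "(complex ^ 'm) monoid" where
  "torus_group = \<lparr>carrier = real_torus, mult = (*), one = 1\<rparr>"

definition circle_group :: "complex monoid" where
  "circle_group = \<lparr>carrier = sphere 0 1, mult = (*), one = 1\<rparr>"

definition topological_group_iso ::
  "('a, 'x) monoid_scheme \<Rightarrow> 'a topology \<Rightarrow> ('b, 'y) monoid_scheme \<Rightarrow> 'b topology \<Rightarrow> bool" where
  "topological_group_iso G X H Y \<longleftrightarrow> (\<exists>h. h \<in> iso G H \<and> homeomorphic_map X Y h)"

definition subtorus :: "nat \<Rightarrow> (complex ^ 'm) set \<Rightarrow> bool" where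
  "subtorus n H \<longleftrightarrow>
     subgroup H torus_group \<and>
     topological_group_iso (torus_group\<lparr>carrier := H\<rparr>) (top_of_set H)
       (product_group {1..n} (\<lambda>_. circle_group))
       (product_topology (\<lambda>_. top_of_set (sphere 0 1)) {1..n})"

text \<open>The quotient torus \<open>V / (V \<inter> \<int>\<^sup>m)\<close> of a linear subspace \<open>V\<close>, consisting of cosets.\<close>

definition vec_group :: "'v::real_vector set \<Rightarrow> 'v monoid" where
  "vec_group V = \<lparr>carrier = V, mult = (+), one = 0\<rparr>"

definition quotient_torus :: "(real ^ 'm) set \<Rightarrow> (real ^ 'm) set monoid" where
  "quotient_torus V = vec_group V Mod (V \<inter> range rvec)"

definition torus_proj :: "(real ^ 'm) set \<Rightarrow> real ^ 'm \<Rightarrow> (real ^ 'm) set" where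
  "torus_proj V v = (V \<inter> range rvec) #>\<^bsub>vec_group V\<^esub> v"

definition quotient_torus_top :: "(real ^ 'm) set \<Rightarrow> (real ^ 'm) set topology" where
  "quotient_torus_top V =
     topology (\<lambda>U. U \<subseteq> carrier (quotient_torus V) \<and>
                   openin (top_of_set V) {v \<in> V. torus_proj V v \<in> U})"

text \<open>Charts: local inverses of the projection \<open>V \<rightarrow> V / (V \<inter> \<int>\<^sup>m)\<close>.\<close>

definition quotient_torus_charts ::
  "(real ^ 'm) set \<Rightarrow> ((real ^ 'm) set, real ^ 'm) chart set" where
  "quotient_torus_charts V =
     {(torus_proj V ` U, inv_into U (torus_proj V)) | U.
        openin (top_of_set V) U \<and> inj_on (torus_proj V) U}"

section \<open>Toric Kaehler manifolds\<close>

definition holomorphic_torus_action ::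
  "'a topology \<Rightarrow> ('a, complex ^ 'm) chart set \<Rightarrow> (complex ^ 'm \<Rightarrow> 'a \<Rightarrow> 'a) \<Rightarrow> bool" where
  "holomorphic_torus_action X A act \<longleftrightarrow>
     (\<forall>u\<in>complex_torus. \<forall>p\<in>topspace X. act u p \<in> topspace X) \<and>
     (\<forall>p\<in>topspace X. act 1 p = p) \<and>
     (\<forall>u\<in>complex_torus. \<forall>v\<in>complex_torus. \<forall>p\<in>topspace X. act (u * v) p = act u (act v p)) \<and>
     (let T = top_of_set complex_torus; B = {(complex_torus, id)} in
        smooth_map (prod_topology T X) (product_charts B A) X A (case_prod act) \<and>
        intertwines (map_prod Jstd Jstd) (product_charts B A) Jstd A (case_prod act))"

text \<open>
  The smooth toric variety of a fan, glued from the equivariant affine charts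
  \<open>U\<^sub>\<tau> \<cong> \<complex>\<^sup>K \<times> (\<complex>\<^sup>*)\<^bsup>m-K\<^esup>\<close>: here \<open>\<tau>\<close> is generated by the members indexed by \<open>K\<close> of a lattice
  basis \<open>e\<close>, in terms of which the torus acts by coordinatewise multiplication. The point \<open>bp\<close>
  of the open orbit has all coordinates 1 and identifies that orbit with the complex torus.
\<close>

definition toric_variety ::
  "'a topology \<Rightarrow> ('a, complex ^ 'm) chart set \<Rightarrow> (complex ^ 'm \<Rightarrow> 'a \<Rightarrow> 'a) \<Rightarrow> 'a \<Rightarrow>
   (real ^ 'm) set set \<Rightarrow> bool" where
  "toric_variety X A act bp \<Sigma> \<longleftrightarrow>
     complex_manifold X A \<and> smooth_fan \<Sigma> \<and> holomorphic_torus_action X A act \<and>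
     bp \<in> topspace X \<and>
     openin X ((\<lambda>u. act u bp) ` complex_torus) \<and>
     X closure_of ((\<lambda>u. act u bp) ` complex_torus) = topspace X \<and>
     (\<exists>U. topspace X = (\<Union>\<tau>\<in>\<Sigma>. U \<tau>) \<and>
          (\<forall>\<tau>\<in>\<Sigma>. \<forall>\<tau>'\<in>\<Sigma>. U (\<tau> \<inter> \<tau>') = U \<tau> \<inter> U \<tau>') \<and>
          (\<forall>\<tau>\<in>\<Sigma>. \<forall>e K. lattice_basis e \<and> \<tau> = convex_cone hull ((\<lambda>i. rvec (e i)) ` K) \<longrightarrow>
             (\<exists>\<phi>. (U \<tau>, \<phi>) \<in> holomorphic_charts X A \<and>
                  \<phi> ` U \<tau> = {s. \<forall>i. i \<notin> K \<longrightarrow> s $ i \<noteq> 0} \<and>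
                  bp \<in> U \<tau> \<and> \<phi> bp = 1 \<and>
                  (\<forall>s\<in>complex_torus. \<forall>p\<in>U \<tau>.
                     act (basis_torus e s) p \<in> U \<tau> \<and>
                     \<phi> (act (basis_torus e s) p) = s * \<phi> p))))"

definition preserves_tensor ::
  "('a, complex ^ 'm) chart set \<Rightarrow> ('a, 'm::finite) tensor2 \<Rightarrow> ('a \<Rightarrow> 'a) \<Rightarrow> bool" where
  "preserves_tensor A t f \<longleftrightarrow>
     (\<forall>c\<in>A. \<forall>c'\<in>A. \<forall>p\<in>fst c. f p \<in> fst c' \<longrightarrow>
        (\<forall>a b. t c' (f p) (pushforward c c' f p a) (pushforward c c' f p b) = t c p a b))"

text \<open>Coordinates in \<open>c\<close> of the generator \<open>v\<^sub>p = d/dt (exp(tv) \<cdot> p)\<close> at \<open>t = 0\<close>.\<close>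

definition generator ::
  "(complex ^ 'm \<Rightarrow> 'a \<Rightarrow> 'a) \<Rightarrow> ('a, complex ^ 'm) chart \<Rightarrow> real ^ 'm \<Rightarrow> 'a \<Rightarrow> complex ^ 'm" where
  "generator act c v p = vector_derivative (\<lambda>t. snd c (act (torus_exp (t *\<^sub>R v)) p)) (at 0)"

definition moment_map ::
  "'a topology \<Rightarrow> ('a, complex ^ 'm) chart set \<Rightarrow> (complex ^ 'm \<Rightarrow> 'a \<Rightarrow> 'a) \<Rightarrow>
   ('a, 'm::finite) tensor2 \<Rightarrow> ('a \<Rightarrow> real ^ 'm) \<Rightarrow> bool" where
  "moment_map X A act \<omega> \<mu> \<longleftrightarrow>
     (\<forall>c\<in>A. \<forall>p\<in>fst c. \<forall>v.
        ((\<lambda>x. \<mu> (inv_into (fst c) (snd c) x) \<bullet> v) has_derivative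
         (\<lambda>b. - \<omega> c p (generator act c v p) b)) (at (snd c p)))"

definition toric_kaehler_manifold ::
  "'a topology \<Rightarrow> ('a, complex ^ 'm) chart set \<Rightarrow> (complex ^ 'm \<Rightarrow> 'a \<Rightarrow> 'a) \<Rightarrow> 'a \<Rightarrow>
   (real ^ 'm) set set \<Rightarrow> ('a, 'm::finite) tensor2 \<Rightarrow> ('a, 'm) tensor2 \<Rightarrow>
   ('a \<Rightarrow> real ^ 'm) \<Rightarrow> bool" where
  "toric_kaehler_manifold X A act bp \<Sigma> \<omega> g \<mu> \<longleftrightarrow>
     toric_variety X A act bp \<Sigma> \<and> kaehler X A \<omega> g \<and>
     (\<forall>u\<in>real_torus. preserves_tensor A \<omega> (act u)) \<and>
     (\<forall>u\<in>real_torus. (\<forall>p\<in>topspace X. act u p = p) \<longrightarrow> u = 1) \<and>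
     moment_map X A act \<omega> \<mu>"

text \<open>
  The rays of the fan are \<open>lam 1, \<dots>, lam d\<close>, and the moment polytope is a polyhedron with
  these normals from which some faces may have been removed.
\<close>

definition moment_polytope_data ::
  "(real ^ 'm) set set \<Rightarrow> (real ^ 'm) set \<Rightarrow> nat \<Rightarrow> (nat \<Rightarrow> int ^ 'm) \<Rightarrow> (nat \<Rightarrow> real) \<Rightarrow> bool"
  where
  "moment_polytope_data \<Sigma> \<Delta> d lam \<kappa> \<longleftrightarrow>
     bij_betw lam {1..d} (ray_generators \<Sigma>) \<and>
     closure \<Delta> = (\<Inter>i\<in>{1..d}. {y. y \<bullet> rvec (lam i) \<ge> \<kappa> i}) \<and>
     (\<exists>\<F>. (\<forall>F\<in>\<F>. F face_of closure \<Delta>) \<and> \<Delta> = closure \<Delta> - \<Union>\<F>)"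

definition toric_real_structure ::
  "'a topology \<Rightarrow> ('a, complex ^ 'm) chart set \<Rightarrow> (complex ^ 'm \<Rightarrow> 'a \<Rightarrow> 'a) \<Rightarrow> 'a \<Rightarrow>
   ('a \<Rightarrow> 'a) \<Rightarrow> bool" where
  "toric_real_structure X A act bp \<sigma> \<longleftrightarrow>
     smooth_map X A X A \<sigma> \<and> intertwines Jstd A (\<lambda>a. - Jstd a) A \<sigma> \<and>
     (\<forall>p\<in>topspace X. \<sigma> (\<sigma> p) = p) \<and>
     (\<forall>u\<in>complex_torus. \<forall>p\<in>topspace X. \<sigma> (act u p) = act (cnj_vec u) (\<sigma> p)) \<and>
     (\<forall>u\<in>complex_torus. \<sigma> (act u bp) = act (cnj_vec u) bp)"

definition fixed_set :: "'a topology \<Rightarrow> ('a \<Rightarrow> 'a) \<Rightarrow> 'a set" where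
  "fixed_set X \<sigma> = {p \<in> topspace X. \<sigma> p = p}"

text \<open>
  \<open>\<Omega>\<^sub>\<gamma>\<close> on the open orbit: its pullback along \<open>z \<mapsto> (e\<^bsup>z_1\<^esup>, \<dots>, e\<^bsup>z_m\<^esup>) \<cdot> bp\<close> is
  \<open>e\<^bsup>\<gamma>z\<^esup> dz\<^sup>1 \<and> \<dots> \<and> dz\<^sup>m\<close>.
\<close>

definition log_param :: "(complex ^ 'm \<Rightarrow> 'a \<Rightarrow> 'a) \<Rightarrow> 'a \<Rightarrow> complex ^ 'm \<Rightarrow> 'a" where
  "log_param act bp z = act (\<chi> j. exp (z $ j)) bp"

definition toric_volume_form ::
  "'a topology \<Rightarrow> ('a, complex ^ 'm) chart set \<Rightarrow> (complex ^ 'm \<Rightarrow> 'a \<Rightarrow> 'a) \<Rightarrow> 'a \<Rightarrow>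
   int ^ 'm \<Rightarrow> ('a, 'm::finite) mform \<Rightarrow> bool" where
  "toric_volume_form X A act bp \<gamma> \<Omega> \<longleftrightarrow>
     holomorphic_mform X A \<Omega> \<and>
     (\<forall>c\<in>A. \<forall>p\<in>fst c. \<exists>a. \<Omega> c p a \<noteq> 0) \<and>
     (\<forall>z. \<forall>c\<in>A. log_param act bp z \<in> fst c \<longrightarrow>
        (\<forall>a. \<Omega> c (log_param act bp z)
                (\<lambda>j. pushforward (UNIV, id) c (log_param act bp) z (a j)) =
             exp (\<Sum>j\<in>UNIV. of_int (\<gamma> $ j) * z $ j) * det (\<chi> i j. a j $ i)))"

section \<open>Special Lagrangian submanifolds\<close>

definition smooth_immersion ::
  "'b topology \<Rightarrow> ('b, 'f::euclidean_space) chart set \<Rightarrow>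
   'a topology \<Rightarrow> ('a, 'e::euclidean_space) chart set \<Rightarrow> ('b \<Rightarrow> 'a) \<Rightarrow> bool" where
  "smooth_immersion Y B X A F \<longleftrightarrow>
     smooth_map Y B X A F \<and>
     (\<forall>c\<in>B. \<forall>c'\<in>A. \<forall>p\<in>fst c. F p \<in> fst c' \<longrightarrow>
        inj_on (pushforward c c' F p) (model_space c))"

definition lagrangian_immersion ::
  "'b topology \<Rightarrow> ('b, 'f::euclidean_space) chart set \<Rightarrow>
   'a topology \<Rightarrow> ('a, complex ^ 'm) chart set \<Rightarrow> ('a, 'm::finite) tensor2 \<Rightarrow>
   ('b \<Rightarrow> 'a) \<Rightarrow> bool" where
  "lagrangian_immersion Y B X A \<omega> F \<longleftrightarrow>
     smooth_immersion Y B X A F \<and>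
     (\<forall>c\<in>B. \<forall>p\<in>fst c. dim (model_space c) = CARD('m)) \<and>
     (\<forall>c\<in>B. \<forall>c'\<in>A. \<forall>p\<in>fst c. F p \<in> fst c' \<longrightarrow>
        (\<forall>a\<in>model_space c. \<forall>b\<in>model_space c.
           \<omega> c' (F p) (pushforward c c' F p a) (pushforward c c' F p b) = 0))"

text \<open>Elements of \<open>\<real> / \<pi>\<int>\<close> are represented as cosets.\<close>

definition mod_pi :: "real \<Rightarrow> real set" where
  "mod_pi \<theta> = {\<theta> + of_int k * pi | k. True}"

text \<open>
  With respect to the linear coordinates \<open>x\<^sup>j\<close> dual to a basis \<open>e\<close> of the model space,
  \<open>F\<^sup>*\<Omega> = h dx\<^sup>1 \<and> \<dots> \<and> dx\<^sup>m\<close> with \<open>h = \<Omega>(dF e\<^sub>1, \<dots>, dF e\<^sub>m)\<close>. The class \<open>arg h mod \<pi>\<close> is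
  independent of all choices, over which the union is taken.
\<close>

definition lagrangian_angle ::
  "('b, 'f::euclidean_space) chart set \<Rightarrow> ('a, complex ^ 'm) chart set \<Rightarrow>
   ('a, 'm::finite) mform \<Rightarrow> ('b \<Rightarrow> 'a) \<Rightarrow> 'b \<Rightarrow> real set" where
  "lagrangian_angle B A \<Omega> F p =
     \<Union>{mod_pi (Arg (\<Omega> c' (F p) (\<lambda>j. pushforward c c' F p (e j)))) | c c' e.
        c \<in> B \<and> p \<in> fst c \<and> c' \<in> A \<and> F p \<in> fst c' \<and>
        inj e \<and> independent (range e) \<and> span (range e) = model_space c}"

definition special_lagrangian ::
  "'b topology \<Rightarrow> ('b, 'f::euclidean_space) chart set \<Rightarrow>
   'a topology \<Rightarrow> ('a, complex ^ 'm) chart set \<Rightarrow> ('a, 'm::finite) tensor2 \<Rightarrow>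
   ('a, 'm) mform \<Rightarrow> ('b \<Rightarrow> 'a) \<Rightarrow> bool" where
  "special_lagrangian Y B X A \<omega> \<Omega> F \<longleftrightarrow>
     lagrangian_immersion Y B X A \<omega> F \<and>
     (\<exists>\<theta>\<^sub>0. \<forall>p\<in>topspace Y. lagrangian_angle B A \<Omega> F p = mod_pi \<theta>\<^sub>0)"

section \<open>The construction\<close>

definition zeta_span :: "nat \<Rightarrow> (nat \<Rightarrow> int ^ 'm) \<Rightarrow> (real ^ 'm) set" where
  "zeta_span n \<zeta> = span ((\<lambda>i. rvec (\<zeta> i)) ` {1..n})"

definition zeta_regular ::
  "nat \<Rightarrow> (nat \<Rightarrow> int ^ 'm) \<Rightarrow> nat \<Rightarrow> (nat \<Rightarrow> int ^ 'm) \<Rightarrow> (nat \<Rightarrow> real) \<Rightarrow> real ^ 'm \<Rightarrow> bool" where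
  "zeta_regular n \<zeta> d lam \<kappa> y \<longleftrightarrow>
     zeta_span n \<zeta> \<inter> span {rvec (lam i) | i. i \<in> {1..d} \<and> y \<bullet> rvec (lam i) = \<kappa> i} = {0}"

definition real_level_set ::
  "'a topology \<Rightarrow> ('a \<Rightarrow> 'a) \<Rightarrow> ('a \<Rightarrow> real ^ 'm) \<Rightarrow> nat \<Rightarrow> (nat \<Rightarrow> int ^ 'm) \<Rightarrow> (nat \<Rightarrow> real)
   \<Rightarrow> 'a set" where
  "real_level_set X \<sigma> \<mu> n \<zeta> c = {p \<in> fixed_set X \<sigma>. \<forall>i\<in>{1..n}. \<mu> p \<bullet> rvec (\<zeta> i) = c i}"

text \<open>\<open>M\<^sup>\<sigma>\<close> as a manifold, with the submanifold charts induced from \<open>M\<close>.\<close>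

definition real_form_charts ::
  "'a topology \<Rightarrow> ('a, complex ^ 'm) chart set \<Rightarrow> ('a \<Rightarrow> 'a) \<Rightarrow> ('a, complex ^ 'm) chart set" where
  "real_form_charts X A \<sigma> = slice_charts (2 * CARD('m)) X A CARD('m) (fixed_set X \<sigma>)"

definition L_top ::
  "'a topology \<Rightarrow> 'a set \<Rightarrow> (real ^ 'm) set \<Rightarrow> ('a \<times> (real ^ 'm) set) topology" where
  "L_top X S V = prod_topology (subtopology X S) (quotient_torus_top V)"

definition L_charts ::
  "'a topology \<Rightarrow> ('a, complex ^ 'm) chart set \<Rightarrow> ('a \<Rightarrow> 'a) \<Rightarrow> nat \<Rightarrow> 'a set \<Rightarrow> (real ^ 'm) set
   \<Rightarrow> ('a \<times> (real ^ 'm) set, (complex ^ 'm) \<times> (real ^ 'm)) chart set" where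
  "L_charts X A \<sigma> n S V =
     product_charts
       (slice_charts CARD('m) (subtopology X (fixed_set X \<sigma>)) (real_form_charts X A \<sigma>)
          (CARD('m) - n) S)
       (quotient_torus_charts V)"

text \<open>\<open>(p, [v]) \<mapsto> exp(v) \<cdot> p\<close>; the value does not depend on the representative \<open>v\<close>.\<close>

definition F_map ::
  "(complex ^ 'm \<Rightarrow> 'a \<Rightarrow> 'a) \<Rightarrow> 'a \<times> (real ^ 'm) set \<Rightarrow> 'a" where
  "F_map act = (\<lambda>(p, C). act (torus_exp (SOME v. v \<in> C)) p)"

end

theory Submission
  imports Defs
begin

text \<open>
  Near a point of the level set, use a chart of the toric variety in which the complex torus acts by
  coordinatewise multiplication. The real form consists there of the real points. At \<open>(p, [v])\<close>, and up
  to multiplication by the unitary factor \<open>exp v\<close>, the tangent vectors of the immersion \<open>F\<close> are the sums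
  of a real vector, tangent to the level set at \<open>p\<close>, and of the velocity of a one-parameter subgroup with
  direction in \<open>V\<close>, which is \<open>\<i>\<close> times a real vector. Everything is computed with such sums
  (\<open>immersion_at\<close>), and \<open>F\<close> turns out to be a Lagrangian immersion with an explicit angle, for every \<open>\<gamma>\<close>.

  The form \<open>\<omega>\<close> vanishes on pairs of tangent vectors for three reasons. The orbits of the compact torus
  are isotropic, since moment map components along one-parameter orbits are periodic and have constant
  derivative (\<open>orbit_isotropic\<close>). On the open orbit the real directions at real points arise from the
  orbit directions by the complex structure, so they are isotropic as well, and by continuity this
  extends to all real points (\<open>real_isotropic\<close>). The mixed terms are derivatives, along the level set, of
  moment map components that are constant on it.

  The immersion property is the statement that no nonzero direction in \<open>V\<close> has a vanishing velocity. This
  velocity vanishes at \<open>p\<close> exactly if the direction is spanned by those members of the lattice basis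
  whose coordinates vanish at \<open>p\<close>. The corresponding moment map components attain their minima over the
  manifold at \<open>p\<close> (\<open>moment_min\<close>), and a linear function that is minimal at a point of a polyhedron is
  spanned by the active normals (\<open>minimiser_in_active_span\<close>). Regularity says that the span of the active
  normals meets \<open>V\<close> only in 0.

  For the angle, the coefficient of \<open>\<Omega>\<close> in the chart is on the open orbit a real multiple of a Laurent
  monomial. Hence it is real at all real points, and translation by \<open>exp v\<close> multiplies \<open>\<Omega>\<close> by
  \<open>exp (2 \<pi> \<i> \<langle>\<gamma>, v\<rangle>)\<close>. In a basis adapted to the two kinds of tangent vectors, \<open>n\<close> of the vectors are
  purely imaginary and the others are real, which contributes \<open>\<i> ^ n\<close> up to a real factor
  (\<open>det_adapted_phase\<close>). So the angle at \<open>(p, [v])\<close> is \<open>2 \<pi> \<langle>\<gamma>, v\<rangle> + n \<pi> / 2\<close> modulo \<open>\<pi>\<close>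
  (\<open>lagrangian_angle_F\<close>). Since \<open>V\<close> is a vector space, this is constant only if \<open>\<gamma>\<close> vanishes on \<open>V\<close>; here the
  level set must be nonempty, which holds because each orbit of the compact torus meets the real form
  and the moment map is constant on it (\<open>moment_value_real\<close>).
\<close>

section \<open>Calculus of smooth functions\<close>

lemma Ck_on_subset: "Ck_on k f S \<Longrightarrow> T \<subseteq> S \<Longrightarrow> Ck_on k f T"
proof (induction k arbitrary: f)
  case 0
  then show ?case by (auto intro: continuous_on_subset)
next
  case (Suc k)
  then obtain f' where "\<forall>x\<in>S. (f has_derivative f' x) (at x)" "\<forall>v. Ck_on k (\<lambda>x. f' x v) S" by auto
  with Suc.IH Suc.prems show ?case by (auto intro!: exI[of _ f'])
qed

lemma Ck_on_cong:
  assumes "open S" "\<And>x. x \<in> S \<Longrightarrow> f x = g x" "Ck_on k f S"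
  shows "Ck_on k g S"
proof (cases k)
  case 0
  with assms show ?thesis by (simp cong: continuous_on_cong)
next
  case (Suc j)
  with assms obtain f' where f': "\<forall>x\<in>S. (f has_derivative f' x) (at x)"
    "\<forall>v. Ck_on j (\<lambda>x. f' x v) S" by auto
  have "\<forall>x\<in>S. (g has_derivative f' x) (at x)"
    using f' assms has_derivative_transform_within_open[of f _ _ UNIV S g] by auto
  with f' Suc show ?thesis by auto
qed

lemma Ck_on_imp_continuous_on: "Ck_on k f S \<Longrightarrow> continuous_on S f"
  by (cases k) (auto intro!: continuous_at_imp_continuous_on dest: has_derivative_continuous)

lemma Ck_on_lower: "Ck_on (Suc k) f S \<Longrightarrow> Ck_on k f S"
proof (induction k arbitrary: f)
  case 0
  then show ?case using Ck_on_imp_continuous_on[of "Suc 0" f S] by simp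
next
  case (Suc k)
  then show ?case by (metis Ck_on.simps(2))
qed

lemma Ck_on_const: "Ck_on k (\<lambda>x. c) S"
  by (induction k arbitrary: c) (auto intro!: exI[of _ "\<lambda>x v. 0"])

lemma Ck_on_bounded_linear: "bounded_linear f \<Longrightarrow> Ck_on k f S"
  by (cases k) (auto intro!: exI[of _ "\<lambda>x. f"] Ck_on_const linear_continuous_on
      bounded_linear_imp_has_derivative)

lemma Ck_on_add: "Ck_on k f S \<Longrightarrow> Ck_on k g S \<Longrightarrow> Ck_on k (\<lambda>x. f x + g x) S"
proof (induction k arbitrary: f g)
  case 0
  then show ?case by (auto intro: continuous_on_add)
next
  case (Suc k)
  then obtain f' g' where
    "\<forall>x\<in>S. (f has_derivative f' x) (at x)" "\<forall>v. Ck_on k (\<lambda>x. f' x v) S"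
    "\<forall>x\<in>S. (g has_derivative g' x) (at x)" "\<forall>v. Ck_on k (\<lambda>x. g' x v) S" by auto
  with Suc.IH show ?case
    by (auto intro!: exI[of _ "\<lambda>x v. f' x v + g' x v"] has_derivative_add)
qed

lemma Ck_on_sum: "(\<And>i. i \<in> I \<Longrightarrow> Ck_on k (f i) S) \<Longrightarrow> Ck_on k (\<lambda>x. \<Sum>i\<in>I. f i x) S"
  by (induction I rule: infinite_finite_induct) (auto intro: Ck_on_const Ck_on_add)

lemma Ck_on_bilinear:
  assumes "bounded_bilinear B"
  shows "Ck_on k f S \<Longrightarrow> Ck_on k g S \<Longrightarrow> Ck_on k (\<lambda>x. B (f x) (g x)) S"
proof (induction k arbitrary: f g)
  case 0
  then show ?case by (auto intro: bounded_bilinear.continuous_on[OF assms])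
next
  case (Suc k)
  from Suc.prems obtain f' g' where d:
    "\<forall>x\<in>S. (f has_derivative f' x) (at x)" "\<forall>v. Ck_on k (\<lambda>x. f' x v) S"
    "\<forall>x\<in>S. (g has_derivative g' x) (at x)" "\<forall>v. Ck_on k (\<lambda>x. g' x v) S" by auto
  have "\<forall>x\<in>S. ((\<lambda>x. B (f x) (g x)) has_derivative (\<lambda>v. B (f x) (g' x v) + B (f' x v) (g x))) (at x)"
    using d bounded_bilinear.FDERIV[OF assms] by blast
  moreover have "\<forall>v. Ck_on k (\<lambda>x. B (f x) (g' x v) + B (f' x v) (g x)) S"
    using d Suc.prems[THEN Ck_on_lower] by (auto intro!: Ck_on_add Suc.IH)
  ultimately show ?case by (auto intro!: exI[of _ "\<lambda>x v. B (f x) (g' x v) + B (f' x v) (g x)"])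
qed

lemma Ck_on_linear_compose:
  assumes "bounded_linear L"
  shows "Ck_on k f S \<Longrightarrow> Ck_on k (\<lambda>x. L (f x)) S"
proof (induction k arbitrary: f)
  case 0
  then show ?case by (auto intro: bounded_linear.continuous_on[OF assms])
next
  case (Suc k)
  then obtain f' where "\<forall>x\<in>S. (f has_derivative f' x) (at x)" "\<forall>v. Ck_on k (\<lambda>x. f' x v) S" by auto
  with Suc.IH show ?case
    by (auto intro!: exI[of _ "\<lambda>x v. L (f' x v)"] bounded_linear.has_derivative[OF assms])
qed

text \<open>
  In the step of the induction the chain rule gives \<open>g' (f x) (f' x v)\<close>, where the varying argument
  of \<open>g'\<close> is expanded in the standard basis so that only derivatives in fixed directions occur.
\<close>

lemma Ck_on_compose:
  fixes f :: "'e::euclidean_space \<Rightarrow> 'f::euclidean_space"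
    and g :: "'f \<Rightarrow> 'g::real_normed_vector"
  shows "Ck_on k g T \<Longrightarrow> Ck_on k f S \<Longrightarrow> f ` S \<subseteq> T \<Longrightarrow> Ck_on k (\<lambda>x. g (f x)) S"
proof (induction k arbitrary: g f)
  case 0
  then show ?case by (auto intro: continuous_on_compose2)
next
  case (Suc k)
  from Suc.prems obtain f' g' where d:
    "\<forall>x\<in>S. (f has_derivative f' x) (at x)" "\<And>v. Ck_on k (\<lambda>x. f' x v) S"
    "\<forall>x\<in>T. (g has_derivative g' x) (at x)" "\<And>v. Ck_on k (\<lambda>x. g' x v) T" by auto
  let ?h = "\<lambda>x v. \<Sum>b\<in>Basis. (f' x v \<bullet> b) *\<^sub>R g' (f x) b"
  have "((\<lambda>x. g (f x)) has_derivative ?h x) (at x)" if "x \<in> S" for x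
  proof -
    have l: "linear (g' (f x))"
    proof (rule has_derivative_linear)
      show "(g has_derivative g' (f x)) (at (f x))" using d(3) that Suc.prems(3) by blast
    qed
    have "((\<lambda>x. g (f x)) has_derivative (\<lambda>v. g' (f x) (f' x v))) (at x)"
    proof (rule has_derivative_compose[of f])
      show "(f has_derivative f' x) (at x)" using d(1) that by blast
      show "(g has_derivative g' (f x)) (at (f x))" using d(3) that Suc.prems(3) by blast
    qed
    moreover have "(\<lambda>v. g' (f x) (f' x v)) = ?h x"
    proof
      fix v
      have "g' (f x) (f' x v) = g' (f x) (\<Sum>b\<in>Basis. (f' x v \<bullet> b) *\<^sub>R b)"
        by (simp add: euclidean_representation)
      then show "g' (f x) (f' x v) = ?h x v" by (simp only: linear_sum[OF l] linear_cmul[OF l])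
    qed
    ultimately show ?thesis by (simp only:)
  qed
  moreover have "Ck_on k (\<lambda>x. ?h x v) S" for v
  proof (intro Ck_on_sum Ck_on_bilinear[OF bounded_bilinear_scaleR])
    fix b :: 'f
    show "Ck_on k (\<lambda>x. f' x v \<bullet> b) S"
      by (intro Ck_on_linear_compose[OF bounded_linear_inner_left] d)
    show "Ck_on k (\<lambda>x. g' (f x) b) S"
    proof (rule Suc.IH[of "\<lambda>y. g' y b" f])
      show "Ck_on k (\<lambda>y. g' y b) T" by (rule d(4))
      show "Ck_on k f S" using Suc.prems(2) by (rule Ck_on_lower)
      show "f ` S \<subseteq> T" by (rule Suc.prems(3))
    qed
  qed
  ultimately show ?case by (auto intro!: exI[of _ ?h])
qed

lemma has_derivative_exp_linear:
  assumes "bounded_linear L"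
  shows "((\<lambda>x. exp (L x)) has_derivative (\<lambda>v. exp (L x) * L v :: complex)) (at x)"
proof -
  have "(exp has_derivative (\<lambda>v. exp (L x) * v)) (at (L x))"
    using DERIV_exp[of "L x"] by (simp add: has_field_derivative_def)
  from has_derivative_compose[OF bounded_linear_imp_has_derivative[OF assms] this]
  show ?thesis .
qed

lemma Ck_on_exp_linear:
  fixes L :: "'e::euclidean_space \<Rightarrow> complex"
  assumes L: "bounded_linear L"
  shows "Ck_on k (\<lambda>x. exp (L x)) S"
proof (induction k)
  case 0
  show ?case using linear_continuous_on[OF L] by (auto intro!: continuous_on_exp)
next
  case (Suc k)
  have "Ck_on k (\<lambda>x. exp (L x) * L v) S" for v
    by (intro Ck_on_bilinear[OF bounded_bilinear_mult] Suc Ck_on_const)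
  with has_derivative_exp_linear[OF L] show ?case
    by (auto intro!: exI[of _ "\<lambda>x v. exp (L x) * L v"])
qed

lemma bounded_linear_axis: "bounded_linear (axis i :: 'b::euclidean_space \<Rightarrow> 'b ^ 'n)"
proof -
  have "linear (axis i :: 'b \<Rightarrow> 'b ^ 'n)"
    by (intro linearI) (auto simp: vec_eq_iff axis_def)
  then show ?thesis by (simp add: linear_conv_bounded_linear)
qed

lemma Ck_on_vec:
  fixes f :: "'e::euclidean_space \<Rightarrow> 'b::euclidean_space ^ 'n"
  assumes "\<And>i. Ck_on k (\<lambda>x. f x $ i) S"
  shows "Ck_on k f S"
proof -
  have "f = (\<lambda>x. \<Sum>i\<in>UNIV. axis i (f x $ i))"
    by (auto simp: fun_eq_iff vec_eq_iff axis_def)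
  moreover have "Ck_on k \<dots> S"
    by (intro Ck_on_sum Ck_on_linear_compose[OF bounded_linear_axis] assms)
  ultimately show ?thesis by simp
qed

lemma has_derivative_vec:
  fixes f :: "'e::real_normed_vector \<Rightarrow> 'b::euclidean_space ^ 'n"
  assumes "\<And>j. ((\<lambda>x. f x $ j) has_derivative (\<lambda>w. f' w $ j)) F"
  shows "(f has_derivative f') F"
proof -
  have "((\<lambda>x. \<Sum>i\<in>UNIV. axis i (f x $ i)) has_derivative (\<lambda>w. \<Sum>i\<in>UNIV. axis i (f' w $ i))) F"
    by (intro has_derivative_sum bounded_linear.has_derivative[OF bounded_linear_axis] assms)
  moreover have "(\<Sum>i\<in>UNIV. axis i (v $ i)) = v" for v :: "'b ^ 'n"
    by (auto simp: vec_eq_iff axis_def)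
  ultimately show ?thesis by simp
qed

lemma Ck_on_local:
  assumes "\<And>x. x \<in> S \<Longrightarrow> \<exists>U. open U \<and> x \<in> U \<and> Ck_on k f U"
  shows "Ck_on k f S"
  using assms
proof (induction k arbitrary: f)
  case 0
  have "isCont f x" if "x \<in> S" for x
    using 0[OF that] by (auto simp: continuous_on_eq_continuous_at)
  then show ?case by (auto intro: continuous_at_imp_continuous_on)
next
  case (Suc k)
  let ?d = "\<lambda>x. frechet_derivative f (at x)"
  have loc: "\<exists>U. open U \<and> x \<in> U \<and> (\<forall>y\<in>U. (f has_derivative ?d y) (at y)) \<and>
      (\<forall>v. Ck_on k (\<lambda>y. ?d y v) U)" if x: "x \<in> S" for x
  proof -
    obtain U f' where U: "open U" "x \<in> U" "\<forall>y\<in>U. (f has_derivative f' y) (at y)"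
      "\<forall>v. Ck_on k (\<lambda>y. f' y v) U" using Suc.prems[OF x] by auto
    have eq: "?d y = f' y" if "y \<in> U" for y
      using U that frechet_derivative_at by metis
    then have "Ck_on k (\<lambda>y. ?d y v) U" for v
      using U by (simp add: Ck_on_cong[of U "\<lambda>y. f' y v" "\<lambda>y. ?d y v" k])
    moreover have "\<forall>y\<in>U. (f has_derivative ?d y) (at y)" using U eq by simp
    ultimately show ?thesis using U by blast
  qed
  have "Ck_on k (\<lambda>x. ?d x v) S" for v
  proof (rule Suc.IH)
    fix x assume "x \<in> S"
    from loc[OF this] show "\<exists>U. open U \<and> x \<in> U \<and> Ck_on k (\<lambda>x. ?d x v) U" by blast
  qed
  moreover have "\<forall>x\<in>S. (f has_derivative ?d x) (at x)" using loc by blast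
  ultimately show ?case by (auto intro!: exI[of _ ?d])
qed

lemma smooth_on_open_iff:
  assumes "open S"
  shows "smooth_on S f \<longleftrightarrow> (\<forall>k. Ck_on k f S)"
proof
  assume R: "\<forall>k. Ck_on k f S"
  show "smooth_on S f" unfolding smooth_on_def
    using R assms by (intro ballI exI[of _ S] exI[of _ f]) auto
next
  assume L: "smooth_on S f"
  show "\<forall>k. Ck_on k f S"
  proof (intro allI Ck_on_local)
    fix k x assume "x \<in> S"
    with L obtain U g where U: "open U" "x \<in> U" "\<forall>k. Ck_on k g U" "\<forall>y\<in>S \<inter> U. g y = f y"
      unfolding smooth_on_def by meson
    have "Ck_on k f (S \<inter> U)"
    proof (rule Ck_on_cong[of "S \<inter> U" g])
      show "open (S \<inter> U)" using U assms by blast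
      show "Ck_on k g (S \<inter> U)" using U(3) Ck_on_subset[of k g U "S \<inter> U"] by blast
    qed (use U in blast)
    with U assms \<open>x \<in> S\<close> show "\<exists>U. open U \<and> x \<in> U \<and> Ck_on k f U"
      by (intro exI[of _ "S \<inter> U"]) auto
  qed
qed

lemma smooth_has_derivative:
  assumes "\<forall>k. Ck_on k f S" "x \<in> S"
  shows "(f has_derivative frechet_derivative f (at x)) (at x)"
proof -
  obtain f' where "(f has_derivative f') (at x)"
    using spec[OF assms(1), of "Suc 0"] assms(2) by auto
  then show ?thesis using frechet_derivative_at[of f f' x] by simp
qed

lemma smooth_continuous_derivative:
  assumes "\<forall>k. Ck_on k f S"
  shows "continuous_on S (\<lambda>x. frechet_derivative f (at x) v)"
proof -
  obtain f' where f': "\<forall>x\<in>S. (f has_derivative f' x) (at x)" "\<forall>v. continuous_on S (\<lambda>x. f' x v)"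
    using spec[OF assms, of "Suc 0"] by auto
  have "f' x v = frechet_derivative f (at x) v" if "x \<in> S" for x
    using f'(1) that frechet_derivative_at by metis
  with f'(2) show ?thesis by (metis (no_types, lifting) continuous_on_cong)
qed

section \<open>Derivatives within relatively open subsets of a subspace\<close>

lemma relatively_open_line:
  fixes x :: "'e::real_normed_vector"
  assumes "subspace W" "openin (top_of_set W) S" "x \<in> S" "a \<in> W"
  shows "\<exists>e>0. \<forall>t. \<bar>t\<bar> < e \<longrightarrow> x + t *\<^sub>R a \<in> S"
proof -
  obtain T where T: "open T" "S = W \<inter> T" using assms(2) by (auto simp: openin_open)
  have "((\<lambda>t. x + t *\<^sub>R a) \<longlongrightarrow> x) (at 0)" by (auto intro!: tendsto_eq_intros)
  moreover have "x \<in> T" using assms T by auto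
  ultimately have "\<forall>\<^sub>F t in at 0. x + t *\<^sub>R a \<in> T" using T(1) topological_tendstoD by blast
  then obtain e where "e > 0" "\<forall>t. t \<noteq> 0 \<and> dist t 0 < e \<longrightarrow> x + t *\<^sub>R a \<in> T"
    by (auto simp: eventually_at)
  moreover have "x + t *\<^sub>R a \<in> W" for t
    using assms T by (auto intro: subspace_add subspace_scale)
  ultimately have "x + t *\<^sub>R a \<in> S" if "\<bar>t\<bar> < e" for t
    using T(2) \<open>x \<in> T\<close> assms(3) that by (cases "t = 0") (auto simp: dist_real_def)
  with \<open>e > 0\<close> show ?thesis by blast
qed

lemma has_derivative_within_line:
  assumes "(f has_derivative f') (at x within S)"
    and "e > 0" "\<And>t. \<bar>t\<bar> < e \<Longrightarrow> x + t *\<^sub>R a \<in> S"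
  shows "((\<lambda>t. f (x + t *\<^sub>R a)) has_vector_derivative f' a) (at 0)"
proof -
  let ?B = "ball (0::real) e"
  have "((\<lambda>t. x + t *\<^sub>R a) has_derivative (\<lambda>t. t *\<^sub>R a)) (at 0 within ?B)"
    by (auto intro!: derivative_eq_intros)
  moreover have "(f has_derivative f') (at (x + 0 *\<^sub>R a) within (\<lambda>t. x + t *\<^sub>R a) ` ?B)"
    using assms by (auto intro!: has_derivative_subset[OF assms(1)])
  ultimately have "((\<lambda>t. f (x + t *\<^sub>R a)) has_derivative (\<lambda>t. f' (t *\<^sub>R a))) (at 0 within ?B)"
    using diff_chain_within[of "\<lambda>t. x + t *\<^sub>R a" "\<lambda>t. t *\<^sub>R a" 0 ?B f f'] by (simp add: o_def)
  then have "((\<lambda>t. f (x + t *\<^sub>R a)) has_derivative (\<lambda>t. f' (t *\<^sub>R a))) (at 0)"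
    using assms(2) at_within_open[of 0 ?B] by simp
  then show ?thesis
    using has_derivative_linear[OF assms(1)]
    by (simp add: has_vector_derivative_def linear_cmul)
qed

text \<open>
  On the ambient subspace a derivative is determined by its restriction to lines, which stay in the
  relatively open set for a short time.
\<close>

lemma has_derivative_within_unique:
  assumes "subspace W" "openin (top_of_set W) S" "x \<in> S" "a \<in> W"
    and "(f has_derivative f') (at x within S)" "(f has_derivative f'') (at x within S)"
  shows "f' a = f'' a"
proof -
  obtain e where e: "e > 0" "\<And>t. \<bar>t\<bar> < e \<Longrightarrow> x + t *\<^sub>R a \<in> S"
    using relatively_open_line[OF assms(1-4)] by auto
  show ?thesis
    using has_derivative_within_line[OF assms(5) e] has_derivative_within_line[OF assms(6) e]
    by (rule vector_derivative_unique_at)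
qed

lemma frechet_derivative_within:
  assumes "subspace W" "openin (top_of_set W) S" "x \<in> S" "a \<in> W"
    and "(f has_derivative f') (at x within S)"
  shows "frechet_derivative f (at x within S) a = f' a"
proof -
  have "(f has_derivative frechet_derivative f (at x within S)) (at x within S)"
    using assms(5) by (auto simp: frechet_derivative_works[symmetric] differentiable_def)
  from has_derivative_within_unique[OF assms(1-4) this assms(5)] show ?thesis .
qed

lemma span_relatively_open:
  fixes x :: "'e::real_normed_vector"
  assumes "subspace W" "openin (top_of_set W) S" "x \<in> S"
  shows "span S = W"
proof
  show "span S \<subseteq> W" using assms(1,2) by (meson openin_imp_subset span_minimal)
  show "W \<subseteq> span S"
  proof
    fix a assume a: "a \<in> W"
    obtain e where e: "e > 0" "\<And>t. \<bar>t\<bar> < e \<Longrightarrow> x + t *\<^sub>R a \<in> S"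
      using relatively_open_line[OF assms a] by auto
    have "x + (e/2) *\<^sub>R a \<in> span S" "x \<in> span S" using e assms(3) by (auto intro: span_base)
    then have "(2/e) *\<^sub>R ((x + (e/2) *\<^sub>R a) - x) \<in> span S" by (intro span_scale span_diff)
    then show "a \<in> span S" using e by simp
  qed
qed

lemma has_derivative_transform_locally:
  assumes "(f has_derivative f') (at x)" "open U" "x \<in> U" "x \<in> S"
    and "\<And>y. y \<in> S \<inter> U \<Longrightarrow> g y = f y"
  shows "(g has_derivative f') (at x within S)"
proof -
  have "(f has_derivative f') (at x within S)" using assms(1) by (rule has_derivative_at_withinI)
  moreover have "\<forall>\<^sub>F y in at x within S. f y = g y"
    using assms by (auto simp: eventually_at_topological)
  ultimately show ?thesis using assms by (auto intro: has_derivative_transform_eventually)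
qed

lemma bounded_linear_mult_vec: "bounded_linear (\<lambda>a :: complex ^ 'n. t * a)"
proof -
  have "linear (\<lambda>a :: complex ^ 'n. t * a)"
    by (intro linearI) (auto simp: vec_eq_iff algebra_simps)
  then show ?thesis by (simp add: linear_conv_bounded_linear)
qed

section \<open>Lattice bases and coordinates on the torus\<close>

text \<open>The coefficients of the \<open>l\<close>th standard basis vector in the lattice basis.\<close>

definition lattice_inverse :: "('m \<Rightarrow> int ^ 'm) \<Rightarrow> 'm \<Rightarrow> 'm \<Rightarrow> int" where
  "lattice_inverse e l = (THE k. axis l 1 = (\<Sum>i\<in>UNIV. k i *s e i))"

definition lattice_coord :: "('m::finite \<Rightarrow> int ^ 'm) \<Rightarrow> 'b::comm_ring_1 ^ 'm \<Rightarrow> 'b ^ 'm" where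
  "lattice_coord e z = (\<chi> i. \<Sum>l\<in>UNIV. of_int (lattice_inverse e l i) * z $ l)"

definition lattice_comb :: "('m::finite \<Rightarrow> int ^ 'm) \<Rightarrow> 'b::comm_ring_1 ^ 'm \<Rightarrow> 'b ^ 'm" where
  "lattice_comb e t = (\<chi> l. \<Sum>i\<in>UNIV. of_int (e i $ l) * t $ i)"

lemma lattice_inverse_sum:
  assumes "lattice_basis e"
  shows "axis l 1 = (\<Sum>i\<in>UNIV. lattice_inverse e l i *s e i)"
proof -
  have "\<exists>!k. axis l 1 = (\<Sum>i\<in>UNIV. k i *s e i)"
    using assms unfolding lattice_basis_def by blast
  then show ?thesis unfolding lattice_inverse_def by (rule theI')
qed

lemma lattice_inverse_left:
  assumes "lattice_basis e"
  shows "(\<Sum>i\<in>UNIV. lattice_inverse e l i * e i $ j) = (if l = j then 1 else 0)"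
proof -
  have "(axis l 1 :: int ^ 'a) $ j = (\<Sum>i\<in>UNIV. lattice_inverse e l i * e i $ j)"
    by (subst lattice_inverse_sum[OF assms]) (simp add: sum_component)
  then show ?thesis by (auto simp: axis_def split: if_splits)
qed

lemma lattice_inverse_right:
  assumes "lattice_basis e"
  shows "(\<Sum>l\<in>UNIV. e k $ l * lattice_inverse e l i) = (if k = i then 1 else 0)"
proof -
  let ?c = "\<lambda>i. \<Sum>l\<in>UNIV. e k $ l * lattice_inverse e l i"
  have 1: "e k = (\<Sum>i\<in>UNIV. ?c i *s e i)"
  proof (subst vec_eq_iff, intro allI)
    fix j
    have "(\<Sum>i\<in>UNIV. ?c i *s e i) $ j = (\<Sum>i\<in>UNIV. \<Sum>l\<in>UNIV. e k $ l * (lattice_inverse e l i * e i $ j))"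
      by (simp add: sum_component sum_distrib_right mult.assoc)
    also have "\<dots> = (\<Sum>l\<in>UNIV. e k $ l * (\<Sum>i\<in>UNIV. lattice_inverse e l i * e i $ j))"
      by (subst sum.swap) (simp add: sum_distrib_left)
    also have "\<dots> = e k $ j" by (simp add: lattice_inverse_left[OF assms] if_distrib cong: if_cong)
    finally show "e k $ j = (\<Sum>i\<in>UNIV. ?c i *s e i) $ j" by simp
  qed
  have 2: "e k = (\<Sum>i\<in>UNIV. (if k = i then 1 else 0) *s e i)"
  proof -
    have "(\<Sum>i\<in>UNIV. (if k = i then 1 else 0) *s e i) = (\<Sum>i\<in>UNIV. if k = i then e i else 0)"
      by (intro sum.cong) auto
    then show ?thesis by simp
  qed
  have "\<exists>!f. e k = (\<Sum>i\<in>UNIV. f i *s e i)" using assms unfolding lattice_basis_def by (rule spec)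
  then obtain f0 where f0: "\<And>f. e k = (\<Sum>i\<in>UNIV. f i *s e i) \<Longrightarrow> f = f0" by (elim ex1E) blast
  have "?c = (\<lambda>i. if k = i then 1 else 0)" using f0[OF 1] f0[OF 2] by simp
  then show ?thesis by (rule fun_cong)
qed

lemma lattice_comb_coord:
  assumes "lattice_basis e"
  shows "lattice_comb e (lattice_coord e z) = z"
proof (subst vec_eq_iff, intro allI)
  fix j
  have "lattice_comb e (lattice_coord e z) $ j =
      (\<Sum>i\<in>UNIV. \<Sum>l\<in>UNIV. of_int (lattice_inverse e l i * e i $ j) * z $ l)"
    by (simp add: lattice_comb_def lattice_coord_def sum_distrib_left mult_ac)
  also have "\<dots> = (\<Sum>l\<in>UNIV. of_int (\<Sum>i\<in>UNIV. lattice_inverse e l i * e i $ j) * z $ l)"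
    by (subst sum.swap) (simp add: sum_distrib_right)
  also have "\<dots> = z $ j"
    by (simp add: lattice_inverse_left[OF assms] if_distrib if_distribR cong: if_cong)
  finally show "lattice_comb e (lattice_coord e z) $ j = z $ j" .
qed

lemma lattice_coord_comb:
  assumes "lattice_basis e"
  shows "lattice_coord e (lattice_comb e t) = t"
proof (subst vec_eq_iff, intro allI)
  fix i
  have "lattice_coord e (lattice_comb e t) $ i =
      (\<Sum>l\<in>UNIV. \<Sum>k\<in>UNIV. of_int (e k $ l * lattice_inverse e l i) * t $ k)"
    by (simp add: lattice_comb_def lattice_coord_def sum_distrib_left mult_ac)
  also have "\<dots> = (\<Sum>k\<in>UNIV. of_int (\<Sum>l\<in>UNIV. e k $ l * lattice_inverse e l i) * t $ k)"
    by (subst sum.swap) (simp add: sum_distrib_right)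
  also have "\<dots> = t $ i"
    by (simp add: lattice_inverse_right[OF assms] if_distrib if_distribR cong: if_cong)
  finally show "lattice_coord e (lattice_comb e t) $ i = t $ i" .
qed

lemma lattice_coord_add: "lattice_coord e (x + y) = lattice_coord e x + lattice_coord e y"
  by (simp add: lattice_coord_def vec_eq_iff ring_distribs sum.distrib)

lemma lattice_coord_scaleR: "lattice_coord e (r *\<^sub>R x :: real ^ 'm) = r *\<^sub>R lattice_coord e x"
  by (simp add: lattice_coord_def vec_eq_iff sum_distrib_left mult_ac)

lemma linear_lattice_coord: "linear (lattice_coord e :: real ^ 'm \<Rightarrow> real ^ 'm)"
  by (intro linearI lattice_coord_add lattice_coord_scaleR)

lemma lattice_comb_rvec: "lattice_comb e (t :: real ^ 'm) = (\<Sum>i\<in>UNIV. t $ i *\<^sub>R rvec (e i))"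
  by (simp add: lattice_comb_def rvec_def vec_eq_iff sum_component mult_ac)

lemma lattice_coord_rvec:
  assumes "lattice_basis e"
  shows "lattice_coord e (rvec (e i)) = (axis i 1 :: real ^ 'm)"
proof -
  have "rvec (e i) = lattice_comb e (axis i 1)"
    by (simp add: lattice_comb_def rvec_def vec_eq_iff axis_def if_distrib cong: if_cong)
  then show ?thesis by (simp add: lattice_coord_comb[OF assms])
qed

definition vexp :: "complex ^ 'm \<Rightarrow> complex ^ 'm" where
  "vexp z = (\<chi> j. exp (z $ j))"

definition cvec :: "real ^ 'm \<Rightarrow> complex ^ 'm" where
  "cvec v = (\<chi> j. of_real (v $ j))"

text \<open>The velocity at time 0 of the one-parameter subgroup \<open>t \<mapsto> torus_exp (t v)\<close>.\<close>

definition rot :: "real ^ 'm \<Rightarrow> complex ^ 'm" where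
  "rot v = (\<chi> j. 2 * of_real pi * \<i> * of_real (v $ j))"

lemma vexp_in_complex_torus: "vexp z \<in> complex_torus"
  by (simp add: vexp_def complex_torus_def)

lemma complex_torus_vexp:
  assumes "u \<in> complex_torus"
  obtains z where "u = vexp z"
proof
  show "u = vexp (\<chi> j. Ln (u $ j))"
    using assms by (simp add: vexp_def complex_torus_def vec_eq_iff)
qed

lemma torus_exp_vexp: "torus_exp v = vexp (rot v)"
  by (simp add: torus_exp_def vexp_def rot_def vec_eq_iff)

lemma basis_torus_vexp: "basis_torus e (vexp t) = vexp (lattice_comb e t)"
  by (simp add: basis_torus_def vexp_def lattice_comb_def vec_eq_iff exp_sum
      exp_power_int[symmetric])

lemma lattice_comb_rot: "lattice_comb e (rot v) = rot (lattice_comb e v)"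
  by (simp add: lattice_comb_def rot_def vec_eq_iff sum_distrib_left mult_ac)

lemma torus_exp_basis_torus:
  assumes "lattice_basis e"
  shows "torus_exp v = basis_torus e (torus_exp (lattice_coord e v))"
  by (simp add: torus_exp_vexp basis_torus_vexp lattice_comb_rot lattice_comb_coord[OF assms])

lemma basis_torus_surj:
  assumes "lattice_basis e" "u \<in> complex_torus"
  obtains s where "s \<in> complex_torus" "u = basis_torus e s"
proof -
  obtain z where "u = vexp z" using assms(2) by (rule complex_torus_vexp)
  then have "u = basis_torus e (vexp (lattice_coord e z))"
    by (simp add: basis_torus_vexp lattice_comb_coord[OF assms(1)])
  then show ?thesis using that vexp_in_complex_torus by blast
qed

lemma basis_torus_in_complex_torus: "s \<in> complex_torus \<Longrightarrow> basis_torus e s \<in> complex_torus"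
  by (simp add: basis_torus_def complex_torus_def)

lemma cnj_basis_torus: "cnj_vec (basis_torus e s) = basis_torus e (cnj_vec s)"
  by (simp add: basis_torus_def cnj_vec_def vec_eq_iff)

lemma torus_exp_in_real_torus: "torus_exp v \<in> real_torus"
  by (simp add: torus_exp_def real_torus_def norm_exp_eq_Re)

lemma real_torus_subset: "real_torus \<subseteq> complex_torus"
proof
  fix u :: "complex ^ 'a" assume u: "u \<in> real_torus"
  have "u $ j \<noteq> 0" for j
  proof
    assume "u $ j = 0"
    moreover have "norm (u $ j) = 1" using u by (simp add: real_torus_def)
    ultimately show False by simp
  qed
  then show "u \<in> complex_torus" by (simp add: complex_torus_def)
qed

lemma torus_exp_in_complex_torus: "torus_exp v \<in> complex_torus"
  using torus_exp_in_real_torus real_torus_subset by blast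

lemma torus_exp_add: "torus_exp (v + w) = torus_exp v * torus_exp w"
  by (simp add: torus_exp_def vec_eq_iff exp_add[symmetric] algebra_simps)

lemma torus_exp_0: "torus_exp 0 = 1"
  by (simp add: torus_exp_def vec_eq_iff)

lemma torus_exp_rvec: "torus_exp (rvec z) = 1"
proof -
  have "exp (2 * of_real pi * \<i> * of_int k) = (1 :: complex)" for k :: int
    using exp_integer_2pi[of "of_int k"] by (simp add: mult_ac)
  then show ?thesis by (simp add: torus_exp_def rvec_def vec_eq_iff)
qed

lemma real_torus_torus_exp:
  assumes "u \<in> real_torus"
  obtains v where "u = torus_exp v"
proof
  show "u = torus_exp (\<chi> j. Arg (u $ j) / (2 * pi))"
  proof (subst vec_eq_iff, intro allI)
    fix j
    have n: "norm (u $ j) = 1" using assms by (simp add: real_torus_def)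
    then have "u $ j = cis (Arg (u $ j))"
      using Arg_eq[of "u $ j"] by (force simp: cis_conv_exp)
    then show "u $ j = torus_exp (\<chi> j. Arg (u $ j) / (2 * pi)) $ j"
      by (simp add: torus_exp_def cis_conv_exp mult_ac)
  qed
qed

lemma rot_add: "rot (v + w) = rot v + rot w"
  by (simp add: rot_def vec_eq_iff algebra_simps)

lemma rot_scaleR: "rot (r *\<^sub>R v) = r *\<^sub>R rot v"
  unfolding rot_def vec_eq_iff vector_scaleR_component vec_lambda_beta
  by (simp add: scaleR_conv_of_real)

lemma linear_rot: "linear rot"
  by (intro linearI rot_add rot_scaleR)

lemma bounded_linear_torus_exponent:
  "bounded_linear (\<lambda>v :: real ^ 'n. 2 * of_real pi * \<i> * complex_of_real (v $ j))"
  by (intro bounded_linear_compose[OF bounded_linear_mult_right]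
      bounded_linear_compose[OF bounded_linear_of_real] bounded_linear_vec_nth)

lemma torus_exp_has_derivative:
  "(torus_exp has_derivative (\<lambda>w. torus_exp v * rot w)) (at v)"
proof -
  have "((\<lambda>v. torus_exp v $ j) has_derivative (\<lambda>w. (torus_exp v * rot w) $ j)) (at v)" for j
  proof -
    have "bounded_linear (\<lambda>v :: real ^ 'a. 2 * of_real pi * \<i> * complex_of_real (v $ j))"
      by (rule bounded_linear_torus_exponent)
    from has_derivative_exp_linear[OF this, of v] show ?thesis
      by (simp add: torus_exp_def rot_def)
  qed
  then show ?thesis by (rule has_derivative_vec)
qed

lemma Ck_on_torus_exp: "Ck_on k torus_exp S"
proof (rule Ck_on_vec)
  fix i
  show "Ck_on k (\<lambda>x. torus_exp x $ i) S"
    using Ck_on_exp_linear[OF bounded_linear_torus_exponent[of i]] by (simp add: torus_exp_def)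
qed

section \<open>Charts and coordinate changes\<close>

lemma is_chart_inj_on: "is_chart k X c \<Longrightarrow> inj_on (snd c) (fst c)"
  unfolding is_chart_def
  by (metis homeomorphic_imp_injective_map openin_subset topspace_subtopology_subset)

lemma is_chart_subset: "is_chart k X c \<Longrightarrow> fst c \<subseteq> topspace X"
  unfolding is_chart_def by (meson openin_subset)

abbreviation chart_pt :: "('a, 'e) chart \<Rightarrow> 'e \<Rightarrow> 'a" where
  "chart_pt c \<equiv> inv_into (fst c) (snd c)"

lemma chart_pt_snd: "is_chart k X c \<Longrightarrow> q \<in> fst c \<Longrightarrow> chart_pt c (snd c q) = q"
  by (simp add: is_chart_inj_on)

lemma chart_image_openin:
  assumes "is_chart k X c" "openin X V"
  shows "openin (top_of_set (snd c ` fst c)) (snd c ` (fst c \<inter> V))"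
proof -
  have "open_map (subtopology X (fst c)) (top_of_set (snd c ` fst c)) (snd c)"
    using assms(1) by (simp add: is_chart_def homeomorphic_imp_open_map)
  moreover have "openin (subtopology X (fst c)) (fst c \<inter> V)"
    using assms(2) by (simp add: openin_subtopology_Int2)
  ultimately show ?thesis by (simp add: open_map_def)
qed

lemma chart_pt_continuous:
  assumes "is_chart k X c"
  shows "continuous_map (top_of_set (snd c ` fst c)) X (chart_pt c)"
proof (subst continuous_map, intro conjI allI impI)
  show "chart_pt c ` topspace (top_of_set (snd c ` fst c)) \<subseteq> topspace X"
    using is_chart_subset[OF assms] by (auto simp: chart_pt_snd[OF assms])
next
  fix V assume "openin X V"
  moreover have "{x \<in> topspace (top_of_set (snd c ` fst c)). chart_pt c x \<in> V} =
      snd c ` (fst c \<inter> V)" by (auto simp: chart_pt_snd[OF assms])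
  ultimately show "openin (top_of_set (snd c ` fst c))
      {x \<in> topspace (top_of_set (snd c ` fst c)). chart_pt c x \<in> V}"
    using chart_image_openin[OF assms] by simp
qed

lemma chart_continuous:
  assumes "is_chart k X c"
  shows "continuous_map (subtopology X (fst c)) euclidean (snd c)"
  using assms unfolding is_chart_def
  by (metis homeomorphic_imp_continuous_map continuous_map_in_subtopology)

lemma dim_UNIV_complex_vec: "dim (UNIV :: (complex ^ 'm) set) = 2 * CARD('m)"
  by (simp add: dim_UNIV)

text \<open>The model subspace of a chart of full real dimension is the whole space.\<close>

lemma full_chart_open:
  fixes c :: "('a, complex ^ 'm) chart"
  assumes "is_chart (2 * CARD('m)) X c"
  shows "open (snd c ` fst c)"
proof -
  obtain W where W: "subspace W" "dim W = 2 * CARD('m)" "openin (top_of_set W) (snd c ` fst c)"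
    using assms unfolding is_chart_def by auto
  have "dim W = DIM(complex ^ 'm)" using W(2) dim_UNIV_complex_vec[where 'm='m] by (simp add: dim_UNIV)
  then have "W = UNIV" using W(1) by (metis dim_eq_full span_eq_iff)
  with W(3) show ?thesis by simp
qed

lemma full_chart_open_image:
  fixes c :: "('a, complex ^ 'm) chart"
  assumes "is_chart (2 * CARD('m)) X c" "openin X V"
  shows "open (snd c ` (fst c \<inter> V))"
  using chart_image_openin[OF assms] full_chart_open[OF assms(1)] openin_open_eq by blast

lemma model_space_full:
  fixes c :: "('a, complex ^ 'm) chart"
  assumes "is_chart (2 * CARD('m)) X c" "p \<in> fst c"
  shows "model_space c = UNIV"
  unfolding model_space_def
  using full_chart_open[OF assms(1)] assms(2) span_relatively_open[OF subspace_UNIV]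
  by (metis image_eqI subtopology_UNIV open_openin)

definition jac :: "('a, 'e::euclidean_space) chart \<Rightarrow> ('a, 'f::euclidean_space) chart \<Rightarrow> 'a \<Rightarrow> 'e \<Rightarrow> 'f"
  where "jac c c' q = frechet_derivative (\<lambda>x. snd c' (chart_pt c x)) (at (snd c q))"

lemma local_rep_id: "local_rep c c' id = (\<lambda>x. snd c' (chart_pt c x))"
  by (simp add: local_rep_def fun_eq_iff)

lemma local_dom_id: "local_dom c c' id = snd c ` (fst c \<inter> fst c')"
  by (auto simp: local_dom_def)

lemma transition_smooth:
  fixes c c' :: "('a, complex ^ 'm) chart"
  assumes "is_chart (2 * CARD('m)) X c" "openin X (fst c')" "smoothly_compatible c c'"
  shows "\<forall>k. Ck_on k (\<lambda>x. snd c' (chart_pt c x)) (snd c ` (fst c \<inter> fst c'))"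
proof -
  have "smooth_on (snd c ` (fst c \<inter> fst c')) (\<lambda>x. snd c' (chart_pt c x))"
    using assms(3) by (simp add: smoothly_compatible_def local_rep_id local_dom_id)
  then show ?thesis using smooth_on_open_iff[OF full_chart_open_image[OF assms(1,2)]] by blast
qed

lemma jac_has_derivative:
  fixes c c' :: "('a, complex ^ 'm) chart"
  assumes "is_chart (2 * CARD('m)) X c" "openin X (fst c')" "smoothly_compatible c c'"
    and "q \<in> fst c" "q \<in> fst c'"
  shows "((\<lambda>x. snd c' (chart_pt c x)) has_derivative jac c c' q) (at (snd c q))"
  unfolding jac_def using transition_smooth[OF assms(1-3)] assms(4,5)
  by (intro smooth_has_derivative[where S = "snd c ` (fst c \<inter> fst c')"]) auto

lemma pushforward_id:
  fixes c c' :: "('a, complex ^ 'm) chart"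
  assumes "is_chart (2 * CARD('m)) X c" "q \<in> fst c"
  shows "pushforward c c' id q = jac c c' q"
  unfolding pushforward_def jac_def local_rep_id
  using at_within_open[OF _ full_chart_open[OF assms(1)]] assms(2) by simp

lemma jac_chain:
  fixes c c' c'' :: "('a, complex ^ 'm) chart"
  assumes c: "is_chart (2 * CARD('m)) X c" "is_chart (2 * CARD('m)) X c'"
      "is_chart (2 * CARD('m)) X c''"
    and "smoothly_compatible c c'" "smoothly_compatible c' c''"
    and q: "q \<in> fst c" "q \<in> fst c'" "q \<in> fst c''"
  shows "jac c' c'' q (jac c c' q a) = jac c c'' q a"
proof -
  have o: "openin X (fst c)" "openin X (fst c')" "openin X (fst c'')" using c by (auto simp: is_chart_def)
  have 1: "((\<lambda>x. snd c' (chart_pt c x)) has_derivative jac c c' q) (at (snd c q))"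
    by (rule jac_has_derivative[OF c(1) o(2) assms(4) q(1,2)])
  have 2: "((\<lambda>x. snd c'' (chart_pt c' x)) has_derivative jac c' c'' q)
      (at (snd c' (chart_pt c (snd c q))))"
    using jac_has_derivative[OF c(2) o(3) assms(5) q(2,3)] q chart_pt_snd[OF c(1)] by simp
  have "((\<lambda>x. snd c'' (chart_pt c' (snd c' (chart_pt c x)))) has_derivative
      (\<lambda>a. jac c' c'' q (jac c c' q a))) (at (snd c q))"
    using has_derivative_compose[OF 1 2] .
  then have "((\<lambda>x. snd c'' (chart_pt c x)) has_derivative
      (\<lambda>a. jac c' c'' q (jac c c' q a))) (at (snd c q))"
    by (rule has_derivative_transform_within_open[of _ _ _ _ "snd c ` (fst c \<inter> fst c')"])
      (use q full_chart_open_image[OF c(1) o(2)] in \<open>auto simp: chart_pt_snd[OF c(1)] chart_pt_snd[OF c(2)]\<close>)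
  then show ?thesis unfolding jac_def[of c c''] by (metis frechet_derivative_at)
qed

lemma jac_self:
  fixes c :: "('a, complex ^ 'm) chart"
  assumes "is_chart (2 * CARD('m)) X c" "q \<in> fst c"
  shows "jac c c q a = a"
proof -
  have "((\<lambda>x. snd c (chart_pt c x)) has_derivative (\<lambda>a. a)) (at (snd c q))"
    by (rule has_derivative_transform_within_open[OF has_derivative_ident full_chart_open[OF assms(1)]])
      (use assms(2) in \<open>auto simp: chart_pt_snd[OF assms(1)]\<close>)
  then show ?thesis unfolding jac_def by (metis frechet_derivative_at)
qed

lemma smoothly_compatible_sym: "smoothly_compatible c c' \<Longrightarrow> smoothly_compatible c' c"
  by (simp add: smoothly_compatible_def)

lemma jac_inverse:
  fixes c c' :: "('a, complex ^ 'm) chart"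
  assumes "is_chart (2 * CARD('m)) X c" "is_chart (2 * CARD('m)) X c'"
    and "smoothly_compatible c c'" "q \<in> fst c" "q \<in> fst c'"
  shows "jac c' c q (jac c c' q a) = a"
  using jac_chain[OF assms(1,2,1,3) smoothly_compatible_sym[OF assms(3)] assms(4,5,4)]
    jac_self[OF assms(1,4)] by simp

lemma smooth_charts_chart: "c \<in> smooth_charts k X A \<Longrightarrow> is_chart k X c"
  by (simp add: smooth_charts_def)

section \<open>Toric Kaehler manifolds in equivariant charts\<close>

locale toric_kaehler =
  fixes X :: "'a topology" and A :: "('a, complex ^ 'm) chart set"
    and act :: "complex ^ 'm \<Rightarrow> 'a \<Rightarrow> 'a" and bp :: 'a and \<Sigma> :: "(real ^ 'm) set set"
    and \<omega> g :: "('a, 'm::finite) tensor2" and \<mu> :: "'a \<Rightarrow> real ^ 'm"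
  assumes toric_kaehler: "toric_kaehler_manifold X A act bp \<Sigma> \<omega> g \<mu>"
begin

lemma kaehler: "kaehler X A \<omega> g"
  using toric_kaehler by (simp add: toric_kaehler_manifold_def)

lemma smooth_manifold: "smooth_manifold (2 * CARD('m)) X A"
  using kaehler by (simp add: kaehler_def complex_manifold_def)

lemma A_chart: "c \<in> A \<Longrightarrow> is_chart (2 * CARD('m)) X c"
  using smooth_manifold by (simp add: smooth_manifold_def)

lemma A_open: "c \<in> A \<Longrightarrow> openin X (fst c)"
  using A_chart by (simp add: is_chart_def)

lemma A_compatible: "c \<in> A \<Longrightarrow> c' \<in> A \<Longrightarrow> smoothly_compatible c c'"
  using smooth_manifold by (simp add: smooth_manifold_def)

lemma A_cover: "q \<in> topspace X \<Longrightarrow> \<exists>c\<in>A. q \<in> fst c"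
  using smooth_manifold by (auto simp: smooth_manifold_def)

lemma Hausdorff: "Hausdorff_space X"
  using smooth_manifold by (simp add: smooth_manifold_def)

lemma action: "holomorphic_torus_action X A act"
  using toric_kaehler by (simp add: toric_kaehler_manifold_def toric_variety_def)

lemma act_continuous: "continuous_map (prod_topology (top_of_set complex_torus) X) X (case_prod act)"
  using action by (simp add: holomorphic_torus_action_def smooth_map_def Let_def)

lemma tensor_change:
  assumes "tensor_field A t" "c \<in> A" "c' \<in> A" "q \<in> fst c" "q \<in> fst c'"
  shows "t c q a b = t c' q (jac c c' q a) (jac c c' q b)"
proof -
  have "\<forall>c\<in>A. \<forall>c'\<in>A. \<forall>p\<in>fst c \<inter> fst c'. \<forall>a b.
        t c p a b = t c' p (pushforward c c' id p a) (pushforward c c' id p b)"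
    using assms(1) unfolding tensor_field_def by (elim conjE)
  from this[rule_format, OF assms(2,3) IntI[OF assms(4,5)]] show ?thesis
    by (simp only: pushforward_id[OF A_chart[OF assms(2)] assms(4)])
qed

lemma tensor_fields: "tensor_field A \<omega>" "tensor_field A g"
  using kaehler by (simp_all add: kaehler_def)

end

text \<open>
  An equivariant affine chart of the toric variety, belonging to a smooth cone that is generated
  by the members indexed by \<open>K\<close> of a lattice basis \<open>e\<close>.
\<close>

locale toric_chart = toric_kaehler +
  fixes e :: "'m \<Rightarrow> int ^ 'm" and K :: "'m set" and U :: "'a set" and \<phi> :: "'a \<Rightarrow> complex ^ 'm"
  assumes basis: "lattice_basis e"
    and chart: "(U, \<phi>) \<in> holomorphic_charts X A"
    and image: "\<phi> ` U = {s. \<forall>i. i \<notin> K \<longrightarrow> s $ i \<noteq> 0}"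
    and base: "bp \<in> U" "\<phi> bp = 1"
    and equivariant: "s \<in> complex_torus \<Longrightarrow> q \<in> U \<Longrightarrow>
      act (basis_torus e s) q \<in> U \<and> \<phi> (act (basis_torus e s) q) = s * \<phi> q"

lemma (in toric_kaehler) toric_chart_exists:
  assumes "p \<in> topspace X"
  shows "\<exists>e K U \<phi>. toric_chart X A act bp \<Sigma> \<omega> g \<mu> e K U \<phi> \<and> p \<in> U"
proof -
  have tv: "toric_variety X A act bp \<Sigma>" "smooth_fan \<Sigma>"
    using toric_kaehler by (auto simp: toric_kaehler_manifold_def toric_variety_def)
  obtain U where U: "topspace X = (\<Union>\<tau>\<in>\<Sigma>. U \<tau>)"
    "\<forall>\<tau>\<in>\<Sigma>. \<forall>e K. lattice_basis e \<and> \<tau> = convex_cone hull ((\<lambda>i. rvec (e i)) ` K) \<longrightarrow>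
             (\<exists>\<phi>. (U \<tau>, \<phi>) \<in> holomorphic_charts X A \<and>
                  \<phi> ` U \<tau> = {s. \<forall>i. i \<notin> K \<longrightarrow> s $ i \<noteq> 0} \<and>
                  bp \<in> U \<tau> \<and> \<phi> bp = 1 \<and>
                  (\<forall>s\<in>complex_torus. \<forall>p\<in>U \<tau>.
                     act (basis_torus e s) p \<in> U \<tau> \<and>
                     \<phi> (act (basis_torus e s) p) = s * \<phi> p))"
    using tv(1) unfolding toric_variety_def by (elim conjE exE) (rule that; assumption)
  obtain \<tau> where \<tau>: "\<tau> \<in> \<Sigma>" "p \<in> U \<tau>" using assms U(1) by auto
  obtain e K where eK: "lattice_basis e" "\<tau> = convex_cone hull ((\<lambda>i. rvec (e i)) ` K)"
  proof -
    have "\<exists>e K. lattice_basis e \<and> \<tau> = convex_cone hull ((\<lambda>i. rvec (e i)) ` K)"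
      using tv(2) \<tau>(1) unfolding smooth_fan_def by (elim conjE) (erule bspec)
    then show ?thesis using that by (elim exE conjE)
  qed
  obtain \<phi> where "(U \<tau>, \<phi>) \<in> holomorphic_charts X A"
    "\<phi> ` U \<tau> = {s. \<forall>i. i \<notin> K \<longrightarrow> s $ i \<noteq> 0}" "bp \<in> U \<tau>" "\<phi> bp = 1"
    "\<forall>s\<in>complex_torus. \<forall>p\<in>U \<tau>. act (basis_torus e s) p \<in> U \<tau> \<and> \<phi> (act (basis_torus e s) p) = s * \<phi> p"
    using U(2)[rule_format, OF \<tau>(1) conjI[OF eK]] by (elim exE conjE) (rule that; assumption)
  then have "toric_chart X A act bp \<Sigma> \<omega> g \<mu> e K (U \<tau>) \<phi>"
    using toric_kaehler eK unfolding toric_chart_def toric_chart_axioms_def toric_kaehler_def by blast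
  with \<tau> show ?thesis by blast
qed

context toric_chart
begin

abbreviation D :: "(complex ^ 'm) set" where "D \<equiv> \<phi> ` U"

abbreviation pt :: "complex ^ 'm \<Rightarrow> 'a" where "pt \<equiv> inv_into U \<phi>"

lemma D_iff: "s \<in> D \<longleftrightarrow> (\<forall>i. i \<notin> K \<longrightarrow> s $ i \<noteq> 0)"
  using image by auto

lemma complex_torus_subset_D: "complex_torus \<subseteq> D"
  by (auto simp: D_iff complex_torus_def)

lemma mult_in_D: "t \<in> complex_torus \<Longrightarrow> s \<in> D \<Longrightarrow> t * s \<in> D"
  by (auto simp: D_iff complex_torus_def)

lemma is_chart: "is_chart (2 * CARD('m)) X (U, \<phi>)"
  using chart by (simp add: holomorphic_charts_def smooth_charts_def)

lemma U_open: "openin X U"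
  using is_chart by (simp add: is_chart_def)

lemma compatible: "c \<in> A \<Longrightarrow> smoothly_compatible (U, \<phi>) c"
  using chart by (simp add: holomorphic_charts_def smooth_charts_def)

lemma U_subset: "U \<subseteq> topspace X"
  using U_open openin_subset by blast

lemma inj: "inj_on \<phi> U"
  using is_chart_inj_on[OF is_chart] by simp

lemma pt_in: "s \<in> D \<Longrightarrow> pt s \<in> U"
  by (rule inv_into_into)

lemma phi_pt: "s \<in> D \<Longrightarrow> \<phi> (pt s) = s"
  by (rule f_inv_into_f)

lemma pt_phi: "q \<in> U \<Longrightarrow> pt (\<phi> q) = q"
  using inj by simp

lemma open_D: "open D"
  using full_chart_open[OF is_chart] by simp

lemma open_chart_overlap: "openin X V \<Longrightarrow> open (\<phi> ` (U \<inter> V))"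
  using full_chart_open_image[OF is_chart] by simp

lemma overlap_mem: "s \<in> D \<Longrightarrow> pt s \<in> V \<Longrightarrow> s \<in> \<phi> ` (U \<inter> V)"
  using image_eqI[of s \<phi> "pt s" "U \<inter> V"] by (simp add: pt_in phi_pt)

lemma pt_continuous: "continuous_map (top_of_set D) X pt"
  using chart_pt_continuous[OF is_chart] by simp

lemma act_pt:
  assumes "t \<in> complex_torus" "s \<in> D"
  shows "act (basis_torus e t) (pt s) = pt (t * s)"
  using equivariant[OF assms(1) pt_in[OF assms(2)]] by (metis phi_pt[OF assms(2)] pt_phi)

lemma act_torus_exp_pt:
  "s \<in> D \<Longrightarrow> act (torus_exp v) (pt s) = pt (torus_exp (lattice_coord e v) * s)"
  by (simp add: torus_exp_basis_torus[OF basis, of v] act_pt torus_exp_in_complex_torus)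

abbreviation dtrans :: "('a, complex ^ 'm) chart \<Rightarrow> complex ^ 'm \<Rightarrow> complex ^ 'm \<Rightarrow> complex ^ 'm" where
  "dtrans c s \<equiv> jac (U, \<phi>) c (pt s)"

lemma trans_smooth:
  "c \<in> A \<Longrightarrow> \<forall>k. Ck_on k (\<lambda>x. snd c (pt x)) (\<phi> ` (U \<inter> fst c))"
  using transition_smooth[OF is_chart A_open compatible] by simp

lemma dtrans_has_derivative:
  assumes "c \<in> A" "s \<in> D" "pt s \<in> fst c"
  shows "((\<lambda>x. snd c (pt x)) has_derivative dtrans c s) (at s)"
  using jac_has_derivative[OF is_chart A_open compatible, OF assms(1,1), of "pt s"] assms(2,3)
  by (simp add: pt_in phi_pt)

lemma dtrans_linear: "c \<in> A \<Longrightarrow> s \<in> D \<Longrightarrow> pt s \<in> fst c \<Longrightarrow> linear (dtrans c s)"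
  using dtrans_has_derivative has_derivative_linear by blast

lemma dtrans_inverse:
  "c \<in> A \<Longrightarrow> s \<in> D \<Longrightarrow> pt s \<in> fst c \<Longrightarrow> jac c (U, \<phi>) (pt s) (dtrans c s a) = a"
  using jac_inverse[OF is_chart A_chart compatible] pt_in by simp

lemma dtrans_eq_0_iff: "c \<in> A \<Longrightarrow> s \<in> D \<Longrightarrow> pt s \<in> fst c \<Longrightarrow> dtrans c s a = 0 \<longleftrightarrow> a = 0"
  by (metis dtrans_inverse dtrans_linear linear_0)

lemma dtrans_Jstd:
  assumes "c \<in> A" "s \<in> D" "pt s \<in> fst c"
  shows "dtrans c s (Jstd a) = Jstd (dtrans c s a)"
proof -
  have "pushforward (U, \<phi>) c id (pt s) (Jstd a) = Jstd (pushforward (U, \<phi>) c id (pt s) a)"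
    using chart assms pt_in model_space_full[OF is_chart, of "pt s"]
    unfolding holomorphic_charts_def intertwines_def by auto
  then show ?thesis using pushforward_id[OF is_chart, of "pt s"] pt_in assms by simp
qed

lemma dtrans_continuous: "c \<in> A \<Longrightarrow> continuous_on (\<phi> ` (U \<inter> fst c)) (\<lambda>s. dtrans c s a)"
proof -
  assume c: "c \<in> A"
  have "dtrans c s a = frechet_derivative (\<lambda>x. snd c (pt x)) (at s) a" if "s \<in> \<phi> ` (U \<inter> fst c)" for s
    using that by (auto simp: jac_def pt_phi)
  with smooth_continuous_derivative[OF trans_smooth[OF c]] show ?thesis
    by (simp cong: continuous_on_cong)
qed

text \<open>
  The coordinate expression of a tensor field in the toric chart. It has to be transported from a
  chart of the atlas, to which the toric chart need not belong.
\<close>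

definition tensor_loc :: "('a, 'm) tensor2 \<Rightarrow> complex ^ 'm \<Rightarrow> complex ^ 'm \<Rightarrow> complex ^ 'm \<Rightarrow> real" where
  "tensor_loc t s a b = (let c = (SOME c. c \<in> A \<and> pt s \<in> fst c) in
     t c (pt s) (dtrans c s a) (dtrans c s b))"

lemma tensor_loc_eq:
  assumes t: "tensor_field A t" and c: "c \<in> A" and s: "s \<in> D" "pt s \<in> fst c"
  shows "tensor_loc t s a b = t c (pt s) (dtrans c s a) (dtrans c s b)"
proof -
  define c' where "c' = (SOME c. c \<in> A \<and> pt s \<in> fst c)"
  have c': "c' \<in> A" "pt s \<in> fst c'"
    using someI[of "\<lambda>c. c \<in> A \<and> pt s \<in> fst c" c] c s unfolding c'_def by auto
  have chain: "jac c' c (pt s) (dtrans c' s x) = dtrans c s x" for x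
    using jac_chain[OF is_chart A_chart A_chart compatible A_compatible] c c' s pt_in by simp
  have "tensor_loc t s a b = t c' (pt s) (dtrans c' s a) (dtrans c' s b)"
    by (simp add: tensor_loc_def c'_def Let_def)
  also have "\<dots> = t c (pt s) (jac c' c (pt s) (dtrans c' s a)) (jac c' c (pt s) (dtrans c' s b))"
    by (rule tensor_change[OF t c'(1) c c'(2) s(2)])
  finally show ?thesis by (simp add: chain)
qed

lemma atlas_chart_at:
  assumes "s \<in> D" obtains c where "c \<in> A" "pt s \<in> fst c"
  using A_cover[of "pt s"] pt_in[OF assms] U_subset by blast

abbreviation \<omega>l :: "complex ^ 'm \<Rightarrow> complex ^ 'm \<Rightarrow> complex ^ 'm \<Rightarrow> real" where
  "\<omega>l \<equiv> tensor_loc \<omega>"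

lemma bilinear_omega:
  assumes "s \<in> D" shows "bilinear (\<omega>l s)"
proof -
  obtain c where c: "c \<in> A" "pt s \<in> fst c" using assms by (rule atlas_chart_at)
  have b: "bilinear (\<omega> c (pt s))" using tensor_fields(1) c by (simp add: tensor_field_def)
  have l: "linear (dtrans c s)" using dtrans_linear c assms by simp
  show ?thesis
    using b l unfolding bilinear_def tensor_loc_eq[OF tensor_fields(1) c(1) assms c(2)]
    by (auto intro: linear_compose[unfolded o_def])
qed

lemma Jstd_Jstd: "Jstd (Jstd a) = - a"
  by (simp add: Jstd_def vec_eq_iff)

lemma kaehler_pointwise:
  assumes "c \<in> A" "q \<in> fst c"
  shows "g c q a b = g c q b a" "a \<noteq> 0 \<Longrightarrow> g c q a a > 0" "g c q (Jstd a) (Jstd b) = g c q a b"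
    "\<omega> c q a b = g c q (Jstd a) b" "bilinear (g c q)"
  using kaehler tensor_fields(2) assms unfolding kaehler_def tensor_field_def by blast+

lemma omega_Jstd:
  assumes "s \<in> D" shows "\<omega>l s (Jstd a) (Jstd b) = \<omega>l s a b"
proof -
  obtain c where c: "c \<in> A" "pt s \<in> fst c" using assms by (rule atlas_chart_at)
  show ?thesis
    by (simp add: tensor_loc_eq[OF tensor_fields(1) c(1) assms c(2)] dtrans_Jstd[OF c(1) assms c(2)]
        kaehler_pointwise[OF c])
qed

lemma omega_antisym:
  assumes "s \<in> D" shows "\<omega>l s a b = - \<omega>l s b a"
proof -
  obtain c where c: "c \<in> A" "pt s \<in> fst c" using assms by (rule atlas_chart_at)
  have anti: "g c (pt s) (Jstd x) y = - g c (pt s) (Jstd y) x" for x y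
  proof -
    have "g c (pt s) (Jstd x) y = g c (pt s) (Jstd (Jstd x)) (Jstd y)"
      by (simp only: kaehler_pointwise(3)[OF c])
    also have "\<dots> = - g c (pt s) x (Jstd y)"
      by (simp add: Jstd_Jstd bilinear_lneg[OF kaehler_pointwise(5)[OF c]])
    finally show ?thesis using kaehler_pointwise(1)[OF c] by simp
  qed
  show ?thesis
    unfolding tensor_loc_eq[OF tensor_fields(1) c(1) assms c(2)] kaehler_pointwise(4)[OF c]
    by (rule anti)
qed

lemma omega_pos:
  assumes "s \<in> D" "a \<noteq> 0" shows "\<omega>l s a (Jstd a) > 0"
proof -
  obtain c where c: "c \<in> A" "pt s \<in> fst c" using assms(1) by (rule atlas_chart_at)
  have "dtrans c s a \<noteq> 0" using dtrans_eq_0_iff c assms by simp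
  then show ?thesis
    by (simp add: tensor_loc_eq[OF tensor_fields(1) c(1) assms(1) c(2)]
        dtrans_Jstd[OF c(1) assms(1) c(2)] kaehler_pointwise[OF c])
qed

lemma omega_continuous: "continuous_on D (\<lambda>s. \<omega>l s a b)"
proof (rule continuous_at_imp_continuous_on, rule ballI)
  fix s assume s: "s \<in> D"
  obtain c where c: "c \<in> A" "pt s \<in> fst c" using s by (rule atlas_chart_at)
  let ?O = "\<phi> ` (U \<inter> fst c)"
  have O: "open ?O" "s \<in> ?O" "?O \<subseteq> D"
    using open_chart_overlap[OF A_open[OF c(1)]] overlap_mem[OF s c(2)] by auto
  have eq: "\<omega>l x a b = (\<Sum>i\<in>Basis. \<Sum>j\<in>Basis. (dtrans c x a \<bullet> i) * (dtrans c x b \<bullet> j) *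
      \<omega> c (chart_pt c (snd c (pt x))) i j)" if "x \<in> ?O" for x
  proof -
    have x: "x \<in> D" "pt x \<in> fst c" using that by (auto simp: pt_phi)
    have b: "bilinear (\<omega> c (pt x))" using tensor_fields(1) c(1) x(2) by (simp add: tensor_field_def)
    have expand: "\<omega> c (pt x) y z = (\<Sum>i\<in>Basis. \<Sum>j\<in>Basis. (y \<bullet> i) * (z \<bullet> j) * \<omega> c (pt x) i j)" for y z
    proof -
      have "\<omega> c (pt x) y z = \<omega> c (pt x) (\<Sum>i\<in>Basis. (y \<bullet> i) *\<^sub>R i) (\<Sum>j\<in>Basis. (z \<bullet> j) *\<^sub>R j)"
        by (simp add: euclidean_representation)
      also have "\<dots> = (\<Sum>(i,j)\<in>Basis\<times>Basis. \<omega> c (pt x) ((y \<bullet> i) *\<^sub>R i) ((z \<bullet> j) *\<^sub>R j))"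
        by (rule bilinear_sum[OF b])
      finally show ?thesis
        by (simp add: sum.cartesian_product[symmetric] bilinear_lmul[OF b] bilinear_rmul[OF b] mult_ac)
    qed
    show ?thesis
      unfolding tensor_loc_eq[OF tensor_fields(1) c(1) x] chart_pt_snd[OF A_chart[OF c(1)] x(2)]
      by (rule expand)
  qed
  have "continuous_on ?O (\<lambda>x. \<omega> c (chart_pt c (snd c (pt x))) i j)" for i j
  proof (rule continuous_on_compose2[where t = "snd c ` fst c" and g = "\<lambda>x. \<omega> c (chart_pt c x) i j"])
    have "smooth_on (snd c ` fst c) (\<lambda>x. \<omega> c (chart_pt c x) i j)"
      using tensor_fields(1) c(1) by (simp add: tensor_field_def)
    then show "continuous_on (snd c ` fst c) (\<lambda>x. \<omega> c (chart_pt c x) i j)"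
      using smooth_on_open_iff[OF full_chart_open[OF A_chart[OF c(1)]]] Ck_on.simps(1) by blast
    show "continuous_on ?O (\<lambda>x. snd c (pt x))"
      using spec[OF trans_smooth[OF c(1)], of 0] by simp
    show "(\<lambda>x. snd c (pt x)) ` ?O \<subseteq> snd c ` fst c" by (auto simp: pt_phi)
  qed
  then have "continuous_on ?O (\<lambda>x. \<Sum>i\<in>Basis. \<Sum>j\<in>Basis. (dtrans c x a \<bullet> i) * (dtrans c x b \<bullet> j) *
      \<omega> c (chart_pt c (snd c (pt x))) i j)"
    by (intro continuous_intros dtrans_continuous c)
  then have "continuous_on ?O (\<lambda>x. \<omega>l x a b)"
    using eq by (simp cong: continuous_on_cong)
  then show "isCont (\<lambda>x. \<omega>l x a b) s" using continuous_on_eq_continuous_at[OF O(1)] O(2) by blast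
qed

text \<open>
  In the toric chart the compact torus acts by multiplication with unit complex numbers, which is
  its own derivative.
\<close>

lemma omega_torus_invariant:
  assumes s: "s \<in> D"
  shows "\<omega>l (torus_exp w * s) (torus_exp w * a) (torus_exp w * b) = \<omega>l s a b"
proof -
  let ?t = "torus_exp w" and ?u = "torus_exp (lattice_comb e w)" and ?q = "pt s"
  have u: "?u \<in> real_torus" by (rule torus_exp_in_real_torus)
  have ts: "?t * s \<in> D" using s by (intro mult_in_D torus_exp_in_complex_torus)
  have act: "act ?u (pt x) = pt (?t * x)" if "x \<in> D" for x
    using act_torus_exp_pt[OF that, of "lattice_comb e w"] by (simp add: lattice_coord_comb[OF basis])
  obtain c where c: "c \<in> A" "?q \<in> fst c" using s by (rule atlas_chart_at)
  obtain c' where c': "c' \<in> A" "pt (?t * s) \<in> fst c'" using ts by (rule atlas_chart_at)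
  have pf: "pushforward c c' (act ?u) ?q (dtrans c s x) = dtrans c' (?t * s) (?t * x)" for x
  proof -
    have q: "?q \<in> U" using s pt_in by simp
    have 1: "((\<lambda>x. \<phi> (chart_pt c x)) has_derivative jac c (U, \<phi>) ?q) (at (snd c ?q))"
      using jac_has_derivative[of X c "(U, \<phi>)" ?q] A_chart c U_open compatible q
      by (simp add: smoothly_compatible_sym)
    have 2: "((\<lambda>x. ?t * x) has_derivative (\<lambda>x. ?t * x)) (at (\<phi> (chart_pt c (snd c ?q))))"
      by (rule bounded_linear_imp_has_derivative[OF bounded_linear_mult_vec])
    have 3: "((\<lambda>x. snd c' (pt x)) has_derivative dtrans c' (?t * s))
        (at (?t * \<phi> (chart_pt c (snd c ?q))))"
      using dtrans_has_derivative[OF c'(1) ts c'(2)] chart_pt_snd[OF A_chart] c s phi_pt by simp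
    have "((\<lambda>x. snd c' (pt (?t * \<phi> (chart_pt c x)))) has_derivative
        (\<lambda>x. dtrans c' (?t * s) (?t * jac c (U, \<phi>) ?q x))) (at (snd c ?q))"
      using has_derivative_compose[OF has_derivative_compose[OF 1 2] 3] .
    then have "(local_rep c c' (act ?u) has_derivative
        (\<lambda>x. dtrans c' (?t * s) (?t * jac c (U, \<phi>) ?q x))) (at (snd c ?q))"
    proof (rule has_derivative_transform_within_open)
      show "open (snd c ` (fst c \<inter> U))" using full_chart_open_image A_chart c U_open by blast
      show "snd c ?q \<in> snd c ` (fst c \<inter> U)" using c q by blast
      fix x assume "x \<in> snd c ` (fst c \<inter> U)"
      then obtain p where p: "p \<in> fst c" "p \<in> U" "x = snd c p" by blast
      have "act ?u (pt (\<phi> p)) = pt (?t * \<phi> p)" using p by (intro act) auto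
      then show "snd c' (pt (?t * \<phi> (chart_pt c x))) = local_rep c c' (act ?u) x"
        using p chart_pt_snd[OF A_chart] c by (simp add: local_rep_def pt_phi)
    qed
    moreover have "at (snd c ?q) within snd c ` fst c = at (snd c ?q)"
      using full_chart_open[OF A_chart] c by (intro at_within_open) auto
    ultimately have "pushforward c c' (act ?u) ?q =
        (\<lambda>x. dtrans c' (?t * s) (?t * jac c (U, \<phi>) ?q x))"
      unfolding pushforward_def using frechet_derivative_at by fastforce
    then show ?thesis using dtrans_inverse c s by simp
  qed
  have "preserves_tensor A \<omega> (act ?u)"
    using toric_kaehler u by (simp add: toric_kaehler_manifold_def)
  then have "\<omega> c' (act ?u ?q) (pushforward c c' (act ?u) ?q (dtrans c s a))
      (pushforward c c' (act ?u) ?q (dtrans c s b)) = \<omega> c ?q (dtrans c s a) (dtrans c s b)"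
    unfolding preserves_tensor_def using c c' act[OF s]
    by (metis (no_types, lifting))
  then show ?thesis
    using tensor_loc_eq[OF tensor_fields(1)] c c' s ts by (simp add: pf act[OF s])
qed

lemma torus_path:
  "((\<lambda>t. torus_exp (t *\<^sub>R w) * s) has_vector_derivative rot w * (torus_exp (t *\<^sub>R w) * s)) (at t within T)"
proof -
  have 1: "((\<lambda>t::real. t *\<^sub>R w) has_derivative (\<lambda>h. h *\<^sub>R w)) (at t within T)"
    by (auto intro!: derivative_eq_intros)
  have "((\<lambda>t. s * torus_exp (t *\<^sub>R w)) has_derivative
     (\<lambda>h. s * (torus_exp (t *\<^sub>R w) * rot (h *\<^sub>R w)))) (at t within T)"
    using has_derivative_compose[OF has_derivative_compose[OF 1 torus_exp_has_derivative]
        bounded_linear_imp_has_derivative[OF bounded_linear_mult_vec[of s]]] .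
  moreover have "s * (torus_exp (t *\<^sub>R w) * rot (h *\<^sub>R w)) =
      h *\<^sub>R (rot w * (torus_exp (t *\<^sub>R w) * s))" for h
    unfolding rot_def vec_eq_iff vector_scaleR_component vector_mult_component vec_lambda_beta
    by (simp add: scaleR_conv_of_real)
  ultimately show ?thesis
    by (simp add: has_vector_derivative_def mult.commute)
qed

lemma generator_toric:
  assumes "c \<in> A" "s \<in> D" "pt s \<in> fst c"
  shows "generator act c v (pt s) = dtrans c s (rot (lattice_coord e v) * s)"
proof -
  let ?w = "lattice_coord e v"
  have path: "((\<lambda>t. torus_exp (t *\<^sub>R ?w) * s) has_vector_derivative rot ?w * s) (at 0)"
    using torus_path[of ?w s 0 UNIV] by (simp add: torus_exp_0)
  have d: "((\<lambda>x. snd c (pt x)) has_derivative dtrans c s) (at (torus_exp (0 *\<^sub>R ?w) * s))"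
    using dtrans_has_derivative[OF assms] by (simp add: torus_exp_0)
  have "((\<lambda>t. snd c (pt (torus_exp (t *\<^sub>R ?w) * s))) has_vector_derivative
      dtrans c s (rot ?w * s)) (at 0)"
    using has_derivative_compose[OF path[unfolded has_vector_derivative_def] d]
    by (simp add: has_vector_derivative_def linear_cmul[OF dtrans_linear[OF assms]])
  then show ?thesis
    unfolding generator_def using act_torus_exp_pt[OF assms(2)]
    by (simp add: lattice_coord_scaleR vector_derivative_at)
qed

lemma moment_has_derivative:
  assumes s: "s \<in> D"
  shows "((\<lambda>x. \<mu> (pt x) \<bullet> v) has_derivative (\<lambda>b. - \<omega>l s (rot (lattice_coord e v) * s) b)) (at s)"
proof -
  obtain c where c: "c \<in> A" "pt s \<in> fst c" using s by (rule atlas_chart_at)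
  have "moment_map X A act \<omega> \<mu>" using toric_kaehler by (simp add: toric_kaehler_manifold_def)
  then have 1: "((\<lambda>x. \<mu> (chart_pt c x) \<bullet> v) has_derivative
      (\<lambda>b. - \<omega> c (pt s) (generator act c v (pt s)) b)) (at (snd c (pt s)))"
    using c unfolding moment_map_def by blast
  have "((\<lambda>x. \<mu> (chart_pt c (snd c (pt x))) \<bullet> v) has_derivative
      (\<lambda>b. - \<omega>l s (rot (lattice_coord e v) * s) b)) (at s)"
    using has_derivative_compose[OF dtrans_has_derivative[OF c(1) s c(2)] 1]
    by (simp add: generator_toric[OF c(1) s c(2)] tensor_loc_eq[OF tensor_fields(1) c(1) s c(2)])
  then show ?thesis
  proof (rule has_derivative_transform_within_open)
    show "open (\<phi> ` (U \<inter> fst c))" using open_chart_overlap A_open c by blast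
    show "s \<in> \<phi> ` (U \<inter> fst c)" using overlap_mem[OF s c(2)] .
  qed (use chart_pt_snd[OF A_chart[OF c(1)]] in \<open>auto simp: pt_phi\<close>)
qed

lemma moment_along_path:
  assumes "(\<gamma> has_vector_derivative \<gamma>') (at t within T)" "\<gamma> t \<in> D"
  shows "((\<lambda>t. \<mu> (pt (\<gamma> t)) \<bullet> v) has_real_derivative
      - \<omega>l (\<gamma> t) (rot (lattice_coord e v) * \<gamma> t) \<gamma>') (at t within T)"
proof -
  let ?C = "- \<omega>l (\<gamma> t) (rot (lattice_coord e v) * \<gamma> t) \<gamma>'"
  have "((\<lambda>t. \<mu> (pt (\<gamma> t)) \<bullet> v) has_derivative
      (\<lambda>h. - \<omega>l (\<gamma> t) (rot (lattice_coord e v) * \<gamma> t) (h *\<^sub>R \<gamma>'))) (at t within T)"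
    using has_derivative_compose[OF assms(1)[unfolded has_vector_derivative_def]
      moment_has_derivative[OF assms(2), of v]] .
  moreover have "(\<lambda>h. - \<omega>l (\<gamma> t) (rot (lattice_coord e v) * \<gamma> t) (h *\<^sub>R \<gamma>')) = (*) ?C"
    by (simp add: fun_eq_iff bilinear_rmul[OF bilinear_omega[OF assms(2)]])
  ultimately show ?thesis by (simp add: has_field_derivative_def)
qed

end

section \<open>Isotropic directions of a torus-invariant Kaehler form\<close>

context toric_chart
begin

lemma torus_exp_mult_in_D: "s \<in> D \<Longrightarrow> torus_exp w * s \<in> D"
  by (intro mult_in_D torus_exp_in_complex_torus)

text \<open>
  Along a periodic one-parameter orbit every component of the moment map has constant derivative,
  because the form and both generators are invariant; by periodicity this constant vanishes.
\<close>

lemma orbit_isotropic_axis: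
  assumes s: "s \<in> D"
  shows "\<omega>l s (rot v * s) (rot (axis j 1) * s) = 0"
proof -
  let ?w = "axis j 1 :: real ^ 'm" and ?v = "lattice_comb e v"
  define C where "C = - \<omega>l s (rot v * s) (rot ?w * s)"
  define h where "h t = \<mu> (pt (torus_exp (t *\<^sub>R ?w) * s)) \<bullet> ?v - C * t" for t
  have "DERIV h t :> 0" for t
  proof -
    let ?E = "torus_exp (t *\<^sub>R ?w)"
    have "- \<omega>l (?E * s) (rot (lattice_coord e ?v) * (?E * s)) (rot ?w * (?E * s)) = C"
      using omega_torus_invariant[OF s, of "t *\<^sub>R ?w" "rot v * s" "rot ?w * s"]
      by (simp add: C_def lattice_coord_comb[OF basis] mult.left_commute)
    moreover have "DERIV (\<lambda>t. \<mu> (pt (torus_exp (t *\<^sub>R ?w) * s)) \<bullet> ?v) t :>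
        - \<omega>l (?E * s) (rot (lattice_coord e ?v) * (?E * s)) (rot ?w * (?E * s))"
      by (rule moment_along_path[OF torus_path torus_exp_mult_in_D[OF s]])
    ultimately have d: "DERIV (\<lambda>t. \<mu> (pt (torus_exp (t *\<^sub>R ?w) * s)) \<bullet> ?v) t :> C" by simp
    have "DERIV h t :> C - C" unfolding h_def
      by (rule DERIV_diff[OF d DERIV_cmult_Id])
    then show ?thesis by simp
  qed
  then have "h 1 = h 0" using DERIV_isconst_all by blast
  moreover have "torus_exp ?w = 1"
  proof -
    have "?w = rvec (axis j 1)" by (simp add: rvec_def vec_eq_iff axis_def)
    then show ?thesis using torus_exp_rvec by metis
  qed
  ultimately have "C = 0" by (simp add: h_def torus_exp_0)
  then show ?thesis by (simp add: C_def)
qed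

lemma orbit_isotropic:
  assumes s: "s \<in> D"
  shows "\<omega>l s (rot v * s) (rot w * s) = 0"
proof -
  let ?L = "\<lambda>w. \<omega>l s (rot v * s) (rot w * s)"
  have lin: "linear ?L"
    by (intro linearI) (simp_all add: rot_add rot_scaleR distrib_right
        bilinear_radd[OF bilinear_omega[OF s]] bilinear_rmul[OF bilinear_omega[OF s]])
  have "w = (\<Sum>i\<in>UNIV. (w $ i) *\<^sub>R axis i 1)"
    by (subst basis_expansion[symmetric]) (simp add: scalar_mult_eq_scaleR)
  then have "?L w = ?L (\<Sum>i\<in>UNIV. (w $ i) *\<^sub>R axis i 1)" by simp
  also have "\<dots> = (\<Sum>i\<in>UNIV. (w $ i) *\<^sub>R ?L (axis i 1))"
    by (simp only: linear_sum[OF lin] linear_cmul[OF lin])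
  also have "\<dots> = 0" by (simp add: orbit_isotropic_axis[OF s])
  finally show ?thesis .
qed

lemma moment_torus_invariant:
  assumes s: "s \<in> D"
  shows "\<mu> (pt (torus_exp w * s)) = \<mu> (pt s)"
proof -
  have "\<mu> (pt (torus_exp w * s)) \<bullet> v = \<mu> (pt s) \<bullet> v" for v
  proof -
    let ?h = "\<lambda>t. \<mu> (pt (torus_exp (t *\<^sub>R w) * s)) \<bullet> v"
    have "DERIV ?h t :> 0" for t
    proof -
      have "DERIV ?h t :> - \<omega>l (torus_exp (t *\<^sub>R w) * s)
          (rot (lattice_coord e v) * (torus_exp (t *\<^sub>R w) * s)) (rot w * (torus_exp (t *\<^sub>R w) * s))"
        by (rule moment_along_path[OF torus_path torus_exp_mult_in_D[OF s]])
      then show ?thesis by (simp add: orbit_isotropic[OF torus_exp_mult_in_D[OF s]])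
    qed
    then have "?h 1 = ?h 0" using DERIV_isconst_all by blast
    then show ?thesis by (simp add: torus_exp_0)
  qed
  then show ?thesis using vector_eq_rdot by blast
qed

text \<open>
  A path to \<open>s\<close> that runs in the open orbit for small nonzero times, and through real points if \<open>s\<close>
  is real.
\<close>

definition shift :: "complex ^ 'm \<Rightarrow> real \<Rightarrow> complex ^ 'm" where
  "shift s t = (\<chi> i. s $ i + of_real t)"

lemma shift_tendsto: "(shift s \<longlongrightarrow> s) (at 0)"
proof (rule vec_tendstoI)
  fix i
  have "((\<lambda>t. s $ i + of_real t) \<longlongrightarrow> s $ i + of_real 0) (at 0)" by (intro tendsto_intros)
  then show "((\<lambda>t. shift s t $ i) \<longlongrightarrow> s $ i) (at 0)" by (simp add: shift_def)
qed

lemma shift_in_torus: "\<forall>\<^sub>F t in at 0. shift s t \<in> complex_torus"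
proof -
  have "\<forall>\<^sub>F t in at (0::real). s $ i + of_real t \<noteq> 0" for i
  proof (cases "s $ i = 0")
    case True
    then show ?thesis by (auto simp: eventually_at intro!: exI[of _ 1])
  next
    case False
    have "((\<lambda>t. s $ i + of_real t) \<longlongrightarrow> s $ i + of_real 0) (at (0::real))" by (intro tendsto_intros)
    then show ?thesis using False by (intro tendsto_imp_eventually_ne) auto
  qed
  then have "\<forall>\<^sub>F t in at (0::real). \<forall>i\<in>UNIV. s $ i + of_real t \<noteq> 0"
    by (intro eventually_ball_finite) auto
  then show ?thesis by (simp add: shift_def complex_torus_def)
qed

lemma cvec_shift: "shift (cvec x) t = cvec (\<chi> i. x $ i + t)"
  by (simp add: shift_def cvec_def vec_eq_iff)

lemma continuous_shift:
  assumes "continuous_on D h" "s \<in> D"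
  shows "((\<lambda>t. h (shift s t)) \<longlongrightarrow> h s) (at 0)"
proof -
  have "isCont h s" using assms open_D continuous_on_eq_continuous_at by blast
  then show ?thesis by (rule isCont_tendsto_compose[OF _ shift_tendsto])
qed

lemma torus_dense:
  fixes h :: "complex ^ 'm \<Rightarrow> 'b::real_normed_vector"
  assumes "continuous_on D h" "\<And>s. s \<in> complex_torus \<Longrightarrow> h s = 0" "s \<in> D"
  shows "h s = 0"
proof -
  have "\<forall>\<^sub>F t in at 0. h (shift s t) = 0"
    using shift_in_torus by eventually_elim (rule assms(2))
  then have "((\<lambda>t. h (shift s t)) \<longlongrightarrow> 0) (at 0)" by (rule tendsto_eventually)
  then show ?thesis using continuous_shift[OF assms(1,3)] tendsto_unique[OF at_neq_bot] by metis
qed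

lemma real_points_dense:
  fixes h :: "complex ^ 'm \<Rightarrow> 'b::real_normed_vector"
  assumes "continuous_on D h" "\<And>x. (\<forall>i. x $ i \<noteq> 0) \<Longrightarrow> h (cvec x) = 0" "cvec x \<in> D"
  shows "h (cvec x) = 0"
proof -
  have "\<forall>\<^sub>F t in at 0. h (shift (cvec x) t) = 0"
    using shift_in_torus
  proof eventually_elim
    fix t assume "shift (cvec x) t \<in> complex_torus"
    then have "\<forall>i. (\<chi> i. x $ i + t) $ i \<noteq> 0"
      by (simp add: shift_def complex_torus_def cvec_def flip: of_real_add)
    then show "h (shift (cvec x) t) = 0" using assms(2) cvec_shift by metis
  qed
  then have "((\<lambda>t. h (shift (cvec x) t)) \<longlongrightarrow> 0) (at 0)" by (rule tendsto_eventually)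
  then show ?thesis using continuous_shift[OF assms(1,3)] tendsto_unique[OF at_neq_bot] by metis
qed

text \<open>
  At a real point of the open orbit the real directions are the images under the complex structure
  of the generators of the torus action, and the form is invariant under the complex structure. The
  other real points are limits of such points.
\<close>

lemma real_isotropic:
  assumes "cvec x \<in> D"
  shows "\<omega>l (cvec x) (cvec a) (cvec b) = 0"
proof (rule real_points_dense[OF omega_continuous _ assms])
  fix x :: "real ^ 'm"
  assume x: "\<forall>i. x $ i \<noteq> 0"
  then have D: "cvec x \<in> D" using complex_torus_subset_D by (auto simp: complex_torus_def cvec_def)
  have J: "rot (\<chi> i. a $ i / (2 * pi * x $ i)) * cvec x = Jstd (cvec a)" for a
    using x by (simp add: rot_def cvec_def Jstd_def vec_eq_iff)
  show "\<omega>l (cvec x) (cvec a) (cvec b) = 0"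
    using orbit_isotropic[OF D] omega_Jstd[OF D] J by metis
qed

section \<open>Minima of the moment map components\<close>

lemma axis_zero: "axis i 0 = (0 :: complex ^ 'm)"
  by (simp add: axis_def vec_eq_iff)

lemma rot_axis_mult: "rot (axis i 1) * s = axis i (2 * of_real pi * \<i> * s $ i)"
  by (auto simp: rot_def vec_eq_iff axis_def)

lemma moment_component_along_path:
  assumes "(\<gamma> has_vector_derivative \<gamma>') (at t)" "\<gamma> t \<in> D"
  shows "DERIV (\<lambda>t. \<mu> (pt (\<gamma> t)) \<bullet> rvec (e i)) t :>
      - \<omega>l (\<gamma> t) (axis i (2 * of_real pi * \<i> * \<gamma> t $ i)) \<gamma>'"
  using moment_along_path[OF assms, of "rvec (e i)"]
  by (simp add: lattice_coord_rvec[OF basis] rot_axis_mult)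

text \<open>
  The generator belonging to \<open>e i\<close> vanishes together with the \<open>i\<close>th coordinate, and the set where
  this happens is path connected.
\<close>

lemma moment_const_on_divisor:
  assumes s: "s \<in> D" "s $ i = 0" and z: "z \<in> D" "z $ i = 0"
  shows "\<mu> (pt s) \<bullet> rvec (e i) = \<mu> (pt z) \<bullet> rvec (e i)"
proof -
  \<comment> \<open>affine in the coordinates that may vanish, exponential in the others, hence inside \<open>D\<close>\<close>
  define \<eta> where "\<eta> t = (\<chi> j. if j \<in> K then z $ j + of_real t * (s $ j - z $ j)
      else exp (Ln (z $ j) + of_real t * (Ln (s $ j) - Ln (z $ j))))" for t :: real
  define \<eta>' where "\<eta>' t = (\<chi> j. if j \<in> K then s $ j - z $ j
      else exp (Ln (z $ j) + of_real t * (Ln (s $ j) - Ln (z $ j))) * (Ln (s $ j) - Ln (z $ j)))"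
    for t :: real
  have i: "i \<in> K" using s D_iff by blast
  have \<eta>_in: "\<eta> t \<in> D" for t by (simp add: D_iff \<eta>_def)
  have \<eta>_i: "\<eta> t $ i = 0" for t using i s z by (simp add: \<eta>_def)
  have "(\<eta> has_vector_derivative \<eta>' t) (at t)" for t
    unfolding has_vector_derivative_def
  proof (rule has_derivative_vec)
    fix j
    have "((\<lambda>t. \<eta> t $ j) has_vector_derivative \<eta>' t $ j) (at t)"
    proof (cases "j \<in> K")
      case True
      then show ?thesis by (auto simp: \<eta>_def \<eta>'_def intro!: derivative_eq_intros)
    next
      case False
      have "((\<lambda>t. exp (Ln (z $ j) + of_real t * (Ln (s $ j) - Ln (z $ j)))) has_vector_derivative
          (Ln (s $ j) - Ln (z $ j)) * exp (Ln (z $ j) + of_real t * (Ln (s $ j) - Ln (z $ j)))) (at t)"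
      proof (rule field_vector_diff_chain_at[of _ _ _ exp, unfolded o_def])
        show "((\<lambda>t. Ln (z $ j) + of_real t * (Ln (s $ j) - Ln (z $ j))) has_vector_derivative
            Ln (s $ j) - Ln (z $ j)) (at t)" by (auto intro!: derivative_eq_intros)
      qed (rule DERIV_exp)
      with False show ?thesis by (simp add: \<eta>_def \<eta>'_def mult.commute)
    qed
    then show "((\<lambda>t. \<eta> t $ j) has_derivative (\<lambda>w. (w *\<^sub>R \<eta>' t) $ j)) (at t)"
      by (simp add: has_vector_derivative_def)
  qed
  then have "DERIV (\<lambda>t. \<mu> (pt (\<eta> t)) \<bullet> rvec (e i)) t :> 0" for t
    using moment_component_along_path[of \<eta> "\<eta>' t" t i] \<eta>_in \<eta>_i
      bilinear_lzero[OF bilinear_omega[OF \<eta>_in]] by (simp add: axis_zero)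
  then have "\<mu> (pt (\<eta> 1)) \<bullet> rvec (e i) = \<mu> (pt (\<eta> 0)) \<bullet> rvec (e i)"
    using DERIV_isconst_all[of "\<lambda>t. \<mu> (pt (\<eta> t)) \<bullet> rvec (e i)"] by blast
  moreover have "\<eta> 1 = s" "\<eta> 0 = z" using s z by (auto simp: \<eta>_def vec_eq_iff D_iff)
  ultimately show ?thesis by simp
qed

text \<open>
  Shrinking the \<open>i\<close>th coordinate radially to 0 decreases the component: its derivative along this
  path is a nonnegative multiple of a squared length.
\<close>

lemma moment_min_on_divisor:
  assumes s: "s \<in> D" "s $ i = 0" and s': "s' \<in> D"
  shows "\<mu> (pt s) \<bullet> rvec (e i) \<le> \<mu> (pt s') \<bullet> rvec (e i)"
proof -
  define \<eta> where "\<eta> r = s' + (r - 1) *\<^sub>R axis i (s' $ i)" for r :: real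
  have i: "i \<in> K" using s D_iff by blast
  have \<eta>_in: "\<eta> r \<in> D" for r using s' i by (auto simp: D_iff \<eta>_def axis_def)
  have \<eta>_i: "\<eta> r $ i = r *\<^sub>R (s' $ i)" for r
    by (simp add: \<eta>_def algebra_simps)
  have "(\<eta> has_vector_derivative axis i (s' $ i)) (at r)" for r
    unfolding \<eta>_def by (auto intro!: derivative_eq_intros)
  note d = moment_component_along_path[OF this \<eta>_in]
  let ?b = "axis i (s' $ i)"
  have nonneg: "- \<omega>l (\<eta> r) (axis i (2 * of_real pi * \<i> * \<eta> r $ i)) ?b \<ge> 0" if "r \<ge> 0" for r
  proof -
    have "axis i (2 * of_real pi * \<i> * \<eta> r $ i) = (2 * pi * r) *\<^sub>R Jstd ?b"
      unfolding vec_eq_iff vector_scaleR_component Jstd_def axis_def vector_smult_component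
        vec_lambda_beta \<eta>_i by (auto simp: scaleR_conv_of_real)
    then have "- \<omega>l (\<eta> r) (axis i (2 * of_real pi * \<i> * \<eta> r $ i)) ?b =
        (2 * pi * r) * \<omega>l (\<eta> r) ?b (Jstd ?b)"
      using omega_antisym[OF \<eta>_in, of r ?b "Jstd ?b"]
      by (simp add: bilinear_lmul[OF bilinear_omega[OF \<eta>_in]])
    moreover have "\<omega>l (\<eta> r) ?b (Jstd ?b) \<ge> 0"
      using omega_pos[OF \<eta>_in, of ?b r] bilinear_lzero[OF bilinear_omega[OF \<eta>_in]]
      by (cases "?b = 0") (simp_all add: axis_zero less_imp_le)
    ultimately show ?thesis using that by simp
  qed
  have "\<mu> (pt (\<eta> 0)) \<bullet> rvec (e i) \<le> \<mu> (pt (\<eta> 1)) \<bullet> rvec (e i)"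
  proof (rule DERIV_nonneg_imp_nondecreasing[of 0 1])
    fix r :: real assume "0 \<le> r"
    then show "\<exists>y. DERIV (\<lambda>r. \<mu> (pt (\<eta> r)) \<bullet> rvec (e i)) r :> y \<and> y \<ge> 0" using d nonneg by blast
  qed simp
  moreover have "\<eta> 1 = s'" by (simp add: \<eta>_def)
  moreover have "\<mu> (pt s) \<bullet> rvec (e i) = \<mu> (pt (\<eta> 0)) \<bullet> rvec (e i)"
    by (rule moment_const_on_divisor[OF s \<eta>_in]) (simp add: \<eta>_i)
  ultimately show ?thesis by simp
qed

end

lemma (in toric_kaehler) moment_continuous: "continuous_map X euclideanreal (\<lambda>q. \<mu> q \<bullet> v)"
proof (rule pasting_lemma[where I = A and T = fst and f = "\<lambda>c q. \<mu> q \<bullet> v"])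
  fix c assume c: "c \<in> A"
  then show "openin X (fst c)" by (rule A_open)
  let ?h = "\<lambda>x. \<mu> (chart_pt c x) \<bullet> v"
  have mm: "moment_map X A act \<omega> \<mu>" using toric_kaehler by (simp add: toric_kaehler_manifold_def)
  have "continuous_on (snd c ` fst c) ?h"
  proof (rule continuous_at_imp_continuous_on, rule ballI)
    fix x assume "x \<in> snd c ` fst c"
    then obtain q where "q \<in> fst c" "x = snd c q" by blast
    with mm c show "isCont ?h x" unfolding moment_map_def by (blast intro: has_derivative_continuous)
  qed
  then have 1: "continuous_map (top_of_set (snd c ` fst c)) euclideanreal ?h" by simp
  have 2: "continuous_map (subtopology X (fst c)) (top_of_set (snd c ` fst c)) (snd c)"
    using chart_continuous[OF A_chart[OF c]] openin_subset[OF A_open[OF c]]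
    by (auto simp: continuous_map_in_subtopology)
  show "continuous_map (subtopology X (fst c)) euclideanreal (\<lambda>q. \<mu> q \<bullet> v)"
    using continuous_map_compose[OF 2 1]
    by (rule continuous_map_eq) (auto simp: chart_pt_snd[OF A_chart[OF c]])
next
  fix q assume "q \<in> topspace X"
  then show "\<exists>c. c \<in> A \<and> q \<in> fst c \<and> \<mu> q \<bullet> v = \<mu> q \<bullet> v" using A_cover by blast
qed auto

context toric_chart
begin

lemma pt_1: "pt 1 = bp"
  using pt_phi[OF base(1)] base(2) by simp

lemma pt_torus: "s \<in> complex_torus \<Longrightarrow> pt s = act (basis_torus e s) bp"
  using act_pt[of s 1] imageI[OF base(1), of \<phi>] by (simp add: pt_1 base(2))

text \<open>
  The open orbit is contained in the chart and dense in the manifold, so a minimum over the chart is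
  a minimum over the manifold.
\<close>

lemma moment_min:
  assumes s: "s \<in> D" "s $ i = 0" and q: "q \<in> topspace X"
  shows "\<mu> (pt s) \<bullet> rvec (e i) \<le> \<mu> q \<bullet> rvec (e i)"
proof -
  let ?C = "{q \<in> topspace X. \<mu> q \<bullet> rvec (e i) \<in> {\<mu> (pt s) \<bullet> rvec (e i)..}}"
  have "closedin X ?C"
    by (rule closedin_continuous_map_preimage[OF moment_continuous]) simp
  moreover have "(\<lambda>u. act u bp) ` complex_torus \<subseteq> ?C"
  proof (rule image_subsetI)
    fix u :: "complex ^ 'm" assume "u \<in> complex_torus"
    then obtain t where t: "t \<in> complex_torus" "u = basis_torus e t"
      by (rule basis_torus_surj[OF basis])
    then have u: "act u bp = pt t" using pt_torus by simp
    have tD: "t \<in> D" using t complex_torus_subset_D by blast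
    have "act u bp \<in> topspace X" using u pt_in[OF tD] U_subset by auto
    then show "act u bp \<in> ?C" using moment_min_on_divisor[OF s tD] u by simp
  qed
  ultimately have "X closure_of ((\<lambda>u. act u bp) ` complex_torus) \<subseteq> ?C"
    by (rule closure_of_minimal[rotated])
  moreover have "X closure_of ((\<lambda>u. act u bp) ` complex_torus) = topspace X"
    using toric_kaehler by (simp add: toric_kaehler_manifold_def toric_variety_def)
  ultimately show ?thesis using q by auto
qed

end

section \<open>The holomorphic volume form in an equivariant chart\<close>

lemma det_real_entries:
  fixes M :: "real ^ 'n ^ 'n"
  shows "det (\<chi> i j. complex_of_real (M $ i $ j)) = of_real (det M)"
  by (simp add: det_def)

lemma complex_linear_expand:
  fixes f :: "complex ^ 'n \<Rightarrow> complex ^ 'm"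
  assumes "linear f" "\<And>a. f (Jstd a) = Jstd (f a)"
  shows "f = (\<lambda>a. matrix f *v a)"
proof -
  have "f (z *s a) = z *s f a" for z a
  proof -
    have sp: "z *s b = Re z *\<^sub>R b + Im z *\<^sub>R Jstd b" for b :: "complex ^ 'k"
      unfolding vec_eq_iff Jstd_def vector_add_component vector_scaleR_component vector_smult_component
      by (simp add: complex_eq_iff)
    show ?thesis by (simp add: sp linear_add[OF assms(1)] linear_cmul[OF assms(1)] assms(2))
  qed
  then have "Vector_Spaces.linear (*s) (*s) f"
    using linear_add[OF assms(1)] by unfold_locales (auto simp: vec.scale_right_distrib algebra_simps)
  then show ?thesis by (simp add: matrix_works fun_eq_iff)
qed

lemma det_complex_linear:
  fixes f :: "complex ^ 'n \<Rightarrow> complex ^ 'n" and a :: "'n \<Rightarrow> complex ^ 'n"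
  assumes "linear f" "\<And>a. f (Jstd a) = Jstd (f a)"
  shows "det (\<chi> i j. f (a j) $ i) = det (\<chi> i j. f (axis j 1) $ i) * det (\<chi> i j. a j $ i)"
proof -
  have "(\<chi> i j. f (a j) $ i) = matrix f ** (\<chi> i j. a j $ i)"
    by (subst complex_linear_expand[OF assms])
      (simp add: vec_eq_iff matrix_matrix_mult_def matrix_vector_mult_def)
  then show ?thesis by (simp add: det_mul) (simp add: matrix_def)
qed

lemma det_scale_rows:
  fixes t :: "complex ^ 'n"
  shows "det (\<chi> i j. (t * a j) $ i) = (\<Prod>i\<in>UNIV. t $ i) * det (\<chi> i j. a j $ i)"
proof -
  have "(\<chi> i j. (t * a j) $ i) = (\<chi> i. t $ i *s (\<chi> j. a j $ i))" by (simp add: vec_eq_iff)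
  then show ?thesis by (simp add: det_rows_mul)
qed

lemma continuous_on_det:
  fixes M :: "'a::topological_space \<Rightarrow> complex ^ 'n ^ 'n"
  assumes "\<And>i j. continuous_on S (\<lambda>x. M x $ i $ j)"
  shows "continuous_on S (\<lambda>x. det (M x))"
  unfolding det_def by (intro continuous_intros assms)

lemma prod_powi_exp:
  fixes s :: "complex ^ 'n" and k :: "'n \<Rightarrow> int"
  shows "exp (\<Sum>i\<in>UNIV. of_int (k i) * t $ i) = (\<Prod>i\<in>UNIV. vexp t $ i powi k i)"
  by (simp add: vexp_def exp_sum exp_power_int[symmetric])

locale toric_volume_chart = toric_chart X A act bp \<Sigma> \<omega> g \<mu> e K U \<phi>
  for X :: "'a topology" and A :: "('a, complex ^ 'm) chart set" and act bp \<Sigma>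
    and \<omega> g :: "('a, 'm::finite) tensor2" and \<mu> e K U \<phi> +
  fixes \<gamma> :: "int ^ 'm" and \<Omega> :: "('a, 'm) mform"
  assumes volume_form: "toric_volume_form X A act bp \<gamma> \<Omega>"
begin

text \<open>The exponents of the monomial that represents \<open>exp (\<gamma> z)\<close> in the coordinates of the chart.\<close>

definition weight :: "'m \<Rightarrow> int" where
  "weight i = (\<Sum>j\<in>UNIV. \<gamma> $ j * e i $ j)"

text \<open>The density of \<open>\<Omega>\<close> with respect to the standard volume form of the toric chart.\<close>

definition vol_coeff :: "complex ^ 'm \<Rightarrow> complex" where
  "vol_coeff s = (let c = (SOME c. c \<in> A \<and> pt s \<in> fst c) in \<Omega> c (pt s) (\<lambda>j. dtrans c s (axis j 1)))"

lemma holomorphic_volume: "holomorphic_mform X A \<Omega>"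
  using volume_form by (simp add: toric_volume_form_def)

lemma volume_local:
  assumes "c \<in> A"
  obtains f where "continuous_on (snd c ` fst c) f"
    "\<And>p a. p \<in> fst c \<Longrightarrow> \<Omega> c p a = f (snd c p) * det (\<chi> i j. a j $ i)"
proof -
  have "\<exists>f :: complex ^ 'm \<Rightarrow> complex. smooth_on (snd c ` fst c) f \<and>
        (\<forall>p\<in>fst c. \<forall>a. \<Omega> c p a = f (snd c p) * det (\<chi> i j. a j $ i))"
    using holomorphic_volume assms unfolding holomorphic_mform_def by meson
  then obtain f :: "complex ^ 'm \<Rightarrow> complex" where f: "smooth_on (snd c ` fst c) f"
    "\<forall>p\<in>fst c. \<forall>a. \<Omega> c p a = f (snd c p) * det (\<chi> i j. a j $ i)" by blast
  have "continuous_on (snd c ` fst c) f"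
    using f(1) smooth_on_open_iff[OF full_chart_open[OF A_chart[OF assms]]] Ck_on.simps(1) by blast
  with f(2) that show ?thesis by blast
qed

lemma volume_change:
  assumes "c \<in> A" "c' \<in> A" "q \<in> fst c" "q \<in> fst c'"
  shows "\<Omega> c q a = \<Omega> c' q (\<lambda>j. jac c c' q (a j))"
proof -
  have "\<forall>c\<in>A. \<forall>c'\<in>A. \<forall>p\<in>fst c \<inter> fst c'. \<forall>a.
        \<Omega> c p a = \<Omega> c' p (\<lambda>j. pushforward c c' id p (a j))"
    using holomorphic_volume unfolding holomorphic_mform_def by (elim conjE)
  from this[rule_format, OF assms(1,2) IntI[OF assms(3,4)]] show ?thesis
    by (simp only: pushforward_id[OF A_chart[OF assms(1)] assms(3)])
qed

lemma vol_coeff_axis: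
  assumes c: "c \<in> A" and s: "s \<in> D" "pt s \<in> fst c"
  shows "vol_coeff s = \<Omega> c (pt s) (\<lambda>j. dtrans c s (axis j 1))"
proof -
  define c' where "c' = (SOME c. c \<in> A \<and> pt s \<in> fst c)"
  have c': "c' \<in> A" "pt s \<in> fst c'"
    using someI[of "\<lambda>c. c \<in> A \<and> pt s \<in> fst c" c] c s unfolding c'_def by auto
  have chain: "jac c' c (pt s) (dtrans c' s x) = dtrans c s x" for x
    using jac_chain[OF is_chart A_chart A_chart compatible A_compatible] c c' s pt_in by simp
  have "vol_coeff s = \<Omega> c' (pt s) (\<lambda>j. dtrans c' s (axis j 1))"
    by (simp add: vol_coeff_def c'_def Let_def)
  also have "\<dots> = \<Omega> c (pt s) (\<lambda>j. jac c' c (pt s) (dtrans c' s (axis j 1)))"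
    by (rule volume_change[OF c'(1) c c'(2) s(2)])
  finally show ?thesis by (simp add: chain)
qed

lemma volume_density:
  assumes c: "c \<in> A" and s: "s \<in> D" "pt s \<in> fst c"
  shows "\<Omega> c (pt s) (\<lambda>j. dtrans c s (a j)) = vol_coeff s * det (\<chi> i j. a j $ i)"
proof -
  obtain f where f: "\<And>p a. p \<in> fst c \<Longrightarrow> \<Omega> c p a = f (snd c p) * det (\<chi> i j. a j $ i)"
    using volume_local[OF c] by metis
  show ?thesis unfolding vol_coeff_axis[OF assms] f[OF s(2)]
    by (subst det_complex_linear[OF dtrans_linear[OF assms] dtrans_Jstd[OF assms]]) (simp add: mult.assoc)
qed

lemma vol_coeff_nonzero:
  assumes s: "s \<in> D"
  shows "vol_coeff s \<noteq> 0"
proof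
  assume 0: "vol_coeff s = 0"
  obtain c where c: "c \<in> A" "pt s \<in> fst c" using s by (rule atlas_chart_at)
  have "\<exists>a. \<Omega> c (pt s) a \<noteq> 0" using volume_form c unfolding toric_volume_form_def by blast
  then obtain a where a: "\<Omega> c (pt s) a \<noteq> 0" by blast
  have "dtrans c s (jac c (U, \<phi>) (pt s) b) = b" for b
    using jac_inverse[OF A_chart is_chart smoothly_compatible_sym[OF compatible]] c pt_in[OF s] by simp
  then have "\<Omega> c (pt s) a = vol_coeff s * det (\<chi> i j. jac c (U, \<phi>) (pt s) (a j) $ i)"
    using volume_density[OF c(1) s c(2), of "\<lambda>j. jac c (U, \<phi>) (pt s) (a j)"] by simp
  with a 0 show False by simp
qed

lemma vol_coeff_continuous: "continuous_on D vol_coeff"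
proof (rule continuous_at_imp_continuous_on, rule ballI)
  fix s assume s: "s \<in> D"
  obtain c where c: "c \<in> A" "pt s \<in> fst c" using s by (rule atlas_chart_at)
  let ?O = "\<phi> ` (U \<inter> fst c)"
  have O: "open ?O" "s \<in> ?O" "?O \<subseteq> D"
    using open_chart_overlap[OF A_open[OF c(1)]] overlap_mem[OF s c(2)] by auto
  obtain f where f: "continuous_on (snd c ` fst c) f"
    "\<And>p a. p \<in> fst c \<Longrightarrow> \<Omega> c p a = f (snd c p) * det (\<chi> i j. a j $ i)"
    using volume_local[OF c(1)] by metis
  have "continuous_on ?O (\<lambda>x. f (snd c (pt x)))"
  proof (rule continuous_on_compose2[OF f(1)])
    show "continuous_on ?O (\<lambda>x. snd c (pt x))" using spec[OF trans_smooth[OF c(1)], of 0] by simp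
    show "(\<lambda>x. snd c (pt x)) ` ?O \<subseteq> snd c ` fst c" by (auto simp: pt_phi)
  qed
  moreover have "continuous_on ?O (\<lambda>x. det (\<chi> i j. dtrans c x (axis j 1) $ i))"
    by (rule continuous_on_det) (simp add: continuous_on_component dtrans_continuous[OF c(1)])
  ultimately have "continuous_on ?O (\<lambda>x. f (snd c (pt x)) * det (\<chi> i j. dtrans c x (axis j 1) $ i))"
    by (intro continuous_on_mult)
  moreover have "vol_coeff x = f (snd c (pt x)) * det (\<chi> i j. dtrans c x (axis j 1) $ i)"
    if "x \<in> ?O" for x
  proof -
    have x: "x \<in> D" "pt x \<in> fst c" using that by (auto simp: pt_phi)
    show ?thesis using vol_coeff_axis[OF c(1) x] f(2)[OF x(2)] by simp
  qed
  ultimately have "continuous_on ?O vol_coeff" by (simp cong: continuous_on_cong)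
  then show "isCont vol_coeff s" using continuous_on_eq_continuous_at[OF O(1)] O(2) by blast
qed

lemma vexp_has_derivative: "(vexp has_derivative (\<lambda>a. vexp z * a)) (at z)"
proof (rule has_derivative_vec)
  fix j
  show "((\<lambda>x. vexp x $ j) has_derivative (\<lambda>a. (vexp z * a) $ j)) (at z)"
    using has_derivative_exp_linear[OF bounded_linear_vec_nth[of j], of z] by (simp add: vexp_def)
qed

lemma bounded_linear_lattice_coord: "bounded_linear (lattice_coord e :: complex ^ 'm \<Rightarrow> complex ^ 'm)"
proof -
  have "linear (lattice_coord e :: complex ^ 'm \<Rightarrow> complex ^ 'm)"
  proof (intro linearI lattice_coord_add)
    fix r :: real and x :: "complex ^ 'm"
    show "lattice_coord e (r *\<^sub>R x) = r *\<^sub>R lattice_coord e x"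
      unfolding vec_eq_iff lattice_coord_def vector_scaleR_component vec_lambda_beta
      by (simp add: scaleR_sum_right)
  qed
  then show ?thesis by (simp add: linear_conv_bounded_linear)
qed

lemma log_param_pt: "log_param act bp z = pt (vexp (lattice_coord e z))"
proof -
  have "vexp z = basis_torus e (vexp (lattice_coord e z))"
    by (simp add: basis_torus_vexp lattice_comb_coord[OF basis])
  then show ?thesis using pt_torus[OF vexp_in_complex_torus] by (simp add: log_param_def vexp_def)
qed

text \<open>
  On the open orbit, \<open>dz\<^sup>j\<close> is the combination of the \<open>ds\<^sub>i / s\<^sub>i\<close> with the coefficients of the
  lattice basis, and \<open>exp (\<gamma> z)\<close> is the monomial whose exponents are the weights.
\<close>

lemma vol_coeff_torus:
  assumes s: "s \<in> complex_torus"
  shows "vol_coeff s = of_int (det (\<chi> i j. e j $ i)) * (\<Prod>i\<in>UNIV. s $ i powi weight i) / (\<Prod>i\<in>UNIV. s $ i)"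
proof -
  obtain t where t: "s = vexp t" using s by (rule complex_torus_vexp)
  let ?z = "lattice_comb e t"
  have coord: "lattice_coord e ?z = t" by (rule lattice_coord_comb[OF basis])
  have L: "log_param act bp ?z = pt s" by (simp add: log_param_pt coord t)
  have sD: "s \<in> D" using s complex_torus_subset_D by blast
  obtain c where c: "c \<in> A" "pt s \<in> fst c" using sD by (rule atlas_chart_at)
  have pf: "pushforward (UNIV, id) c (log_param act bp) ?z a = dtrans c s (s * lattice_coord e a)" for a
  proof -
    have d: "((\<lambda>x. snd c (pt x)) has_derivative dtrans c s) (at (vexp (lattice_coord e ?z)))"
      using dtrans_has_derivative[OF c(1) sD c(2)] by (simp add: coord t)
    have "((\<lambda>z. vexp (lattice_coord e z)) has_derivative
        (\<lambda>a. vexp (lattice_coord e ?z) * lattice_coord e a)) (at ?z)"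
      by (rule has_derivative_compose[OF bounded_linear_imp_has_derivative
            [OF bounded_linear_lattice_coord] vexp_has_derivative])
    from has_derivative_compose[OF this d]
    have "((\<lambda>z. snd c (log_param act bp z)) has_derivative
        (\<lambda>a. dtrans c s (s * lattice_coord e a))) (at ?z)"
      by (simp add: log_param_pt coord t)
    then show ?thesis
      by (simp add: pushforward_def local_rep_def o_def inv_id frechet_derivative_at[symmetric])
  qed
  let ?a = "\<lambda>j. lattice_comb e (axis j (1 / s $ j)) :: complex ^ 'm"
  have nz: "s $ j \<noteq> 0" for j using s by (simp add: complex_torus_def)
  have a: "s * lattice_coord e (?a j) = axis j 1" for j
    using nz by (auto simp: lattice_coord_comb[OF basis] vec_eq_iff axis_def)
  have "vol_coeff s = \<Omega> c (pt s) (\<lambda>j. pushforward (UNIV, id) c (log_param act bp) ?z (?a j))"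
    by (simp add: vol_coeff_axis[OF c(1) sD c(2)] pf a)
  also have "\<dots> = exp (\<Sum>j\<in>UNIV. of_int (\<gamma> $ j) * ?z $ j) * det (\<chi> i j. ?a j $ i)"
  proof -
    have vf: "\<forall>z. \<forall>c\<in>A. log_param act bp z \<in> fst c \<longrightarrow>
        (\<forall>a. \<Omega> c (log_param act bp z) (\<lambda>j. pushforward (UNIV, id) c (log_param act bp) z (a j)) =
             exp (\<Sum>j\<in>UNIV. of_int (\<gamma> $ j) * z $ j) * det (\<chi> i j. a j $ i))"
      using volume_form unfolding toric_volume_form_def by (elim conjE)
    then have "\<Omega> c (log_param act bp ?z) (\<lambda>j. pushforward (UNIV, id) c (log_param act bp) ?z (?a j)) =
        exp (\<Sum>j\<in>UNIV. of_int (\<gamma> $ j) * ?z $ j) * det (\<chi> i j. ?a j $ i)"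
      using vf[rule_format, where z = ?z and a = ?a, OF c(1)] c(2) by (simp only: L simp_thms)
    then show ?thesis by (simp only: L)
  qed
  also have "(\<Sum>j\<in>UNIV. of_int (\<gamma> $ j) * ?z $ j) = (\<Sum>i\<in>UNIV. of_int (weight i) * t $ i)"
  proof -
    have "(\<Sum>j\<in>UNIV. of_int (\<gamma> $ j) * ?z $ j) =
        (\<Sum>j\<in>UNIV. \<Sum>i\<in>UNIV. of_int (\<gamma> $ j * e i $ j) * t $ i)"
      by (simp add: lattice_comb_def sum_distrib_left mult.assoc)
    also have "\<dots> = (\<Sum>i\<in>UNIV. of_int (weight i) * t $ i)"
      by (subst sum.swap) (simp add: weight_def sum_distrib_right)
    finally show ?thesis .
  qed
  also have "exp \<dots> = (\<Prod>i\<in>UNIV. s $ i powi weight i)" by (simp add: prod_powi_exp t)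
  also have "det (\<chi> i j. ?a j $ i) = of_int (det (\<chi> i j. e j $ i)) / (\<Prod>i\<in>UNIV. s $ i)"
  proof -
    have comp: "?a j $ i = of_int (e j $ i) * (1 / s $ j)" for i j
      by (simp add: lattice_comb_def axis_def if_distrib cong: if_cong)
    have "det (\<chi> i j. ?a j $ i) = det (transpose (\<chi> i j. ?a j $ i))" by (simp add: det_transpose)
    also have "transpose (\<chi> i j. ?a j $ i) = (\<chi> j. (1 / s $ j) *s (\<chi> i. of_int (e j $ i)))"
      by (simp add: transpose_def vec_eq_iff comp)
    also have "det \<dots> = (\<Prod>j\<in>UNIV. 1 / s $ j) * det (\<chi> j i. of_int (e j $ i))"
      by (simp add: det_rows_mul)
    also have "det (\<chi> j i. of_int (e j $ i)) = (det (transpose (\<chi> j i. of_int (e j $ i))) :: complex)"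
      by (simp add: det_transpose)
    also have "transpose (\<chi> j i. of_int (e j $ i)) = ((\<chi> i j. of_int (e j $ i)) :: complex ^ 'm ^ 'm)"
      by (simp add: transpose_def)
    also have "det ((\<chi> i j. of_int (e j $ i)) :: complex ^ 'm ^ 'm) = of_int (det (\<chi> i j. e j $ i))"
      by (simp add: det_def)
    finally show ?thesis by (simp add: prod_dividef divide_simps)
  qed
  finally show ?thesis by simp
qed

text \<open>On the open orbit the coefficient is an integer times a Laurent monomial, hence real at real
  points; at the other real points continuity applies.\<close>

lemma vol_coeff_real:
  assumes "cvec x \<in> D"
  shows "Im (vol_coeff (cvec x)) = 0"
proof (rule real_points_dense[OF _ _ assms])
  show "continuous_on D (\<lambda>s. Im (vol_coeff s))"
    by (intro continuous_intros vol_coeff_continuous)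
  fix x :: "real ^ 'm"
  assume x: "\<forall>i. x $ i \<noteq> 0"
  then have "cvec x \<in> complex_torus" by (simp add: complex_torus_def cvec_def)
  then have "vol_coeff (cvec x) = of_real (of_int (det (\<chi> i j. e j $ i)) *
      (\<Prod>i\<in>UNIV. x $ i powi weight i) / (\<Prod>i\<in>UNIV. x $ i))"
    by (simp add: vol_coeff_torus cvec_def)
  then show "Im (vol_coeff (cvec x)) = 0" by (simp only: Im_complex_of_real)
qed

text \<open>
  The factor \<open>\<Prod> torus_exp w $ i\<close> is the determinant of the multiplication by \<open>torus_exp w\<close>, so this
  is the equivariance of \<open>\<Omega>\<close> under the compact torus. On the open orbit it is seen from the monomial.
\<close>

lemma vol_coeff_equivariant:
  assumes "s \<in> D"
  shows "vol_coeff (torus_exp w * s) * (\<Prod>i\<in>UNIV. torus_exp w $ i) =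
    exp (2 * of_real pi * \<i> * of_real (rvec \<gamma> \<bullet> lattice_comb e w)) * vol_coeff s"
proof -
  let ?E = "torus_exp w" and ?x = "exp (2 * of_real pi * \<i> * of_real (rvec \<gamma> \<bullet> lattice_comb e w))"
  define h where "h s = vol_coeff (?E * s) * (\<Prod>i\<in>UNIV. ?E $ i) - ?x * vol_coeff s" for s
  have E: "?E $ i \<noteq> 0" for i using torus_exp_in_complex_torus[of w] by (simp add: complex_torus_def)
  have "h s = 0"
  proof (rule torus_dense[OF _ _ assms])
    have "continuous_on D (\<lambda>s. vol_coeff (?E * s))"
    proof (rule continuous_on_compose2[OF vol_coeff_continuous])
      show "continuous_on D (\<lambda>s. ?E * s)"
        by (rule linear_continuous_on[OF bounded_linear_mult_vec])
    qed (use torus_exp_mult_in_D in blast)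
    then show "continuous_on D h" unfolding h_def
      by (intro continuous_intros vol_coeff_continuous)
  next
    fix s :: "complex ^ 'm" assume s: "s \<in> complex_torus"
    then have Es: "?E * s \<in> complex_torus" using E by (simp add: complex_torus_def)
    have nz: "s $ i \<noteq> 0" for i using s by (simp add: complex_torus_def)
    have x: "?x = (\<Prod>i\<in>UNIV. ?E $ i powi weight i)"
    proof -
      have "rvec \<gamma> \<bullet> lattice_comb e w = (\<Sum>j\<in>UNIV. \<Sum>i\<in>UNIV. of_int (\<gamma> $ j * e i $ j) * w $ i)"
        by (simp add: inner_vec_def rvec_def lattice_comb_def sum_distrib_left mult.assoc)
      also have "\<dots> = (\<Sum>i\<in>UNIV. of_int (weight i) * w $ i)"
        by (subst sum.swap) (simp add: weight_def sum_distrib_right)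
      finally have "2 * of_real pi * \<i> * complex_of_real (rvec \<gamma> \<bullet> lattice_comb e w) =
          (\<Sum>i\<in>UNIV. of_int (weight i) * rot w $ i)"
        by (simp add: rot_def sum_distrib_left mult_ac)
      then show ?thesis by (simp add: prod_powi_exp torus_exp_vexp)
    qed
    show "h s = 0" using E nz unfolding h_def x vol_coeff_torus[OF s] vol_coeff_torus[OF Es]
      by (simp add: prod.distrib power_int_mult_distrib)
  qed
  then show ?thesis by (simp add: h_def)
qed

end

section \<open>The real structure in an equivariant chart\<close>

context toric_chart
begin

lemma cnj_in_D: "s \<in> D \<Longrightarrow> cnj_vec s \<in> D"
  by (simp add: D_iff cnj_vec_def)

lemma limitin_pt:
  assumes "(f \<longlongrightarrow> s) F" "s \<in> D" "\<forall>\<^sub>F t in F. f t \<in> D"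
  shows "limitin X (\<lambda>t. pt (f t)) (pt s) F"
proof -
  have "limitin (top_of_set D) f s F"
    using assms by (simp add: limitin_subtopology limitin_canonical_iff)
  from continuous_map_limit[OF pt_continuous this] show ?thesis by (simp add: o_def)
qed

text \<open>On the open orbit this holds by definition of the real structure; the rest is continuity.\<close>

lemma real_structure_pt:
  assumes \<sigma>: "toric_real_structure X A act bp \<sigma>" and s: "s \<in> D"
  shows "\<sigma> (pt s) = pt (cnj_vec s)"
proof -
  have torus: "\<sigma> (pt t) = pt (cnj_vec t)" if t: "t \<in> complex_torus" for t
  proof -
    have "\<sigma> (act (basis_torus e t) bp) = act (cnj_vec (basis_torus e t)) bp"
      using \<sigma> basis_torus_in_complex_torus[OF t] by (simp add: toric_real_structure_def)
    moreover have "cnj_vec t \<in> complex_torus" using t by (simp add: complex_torus_def cnj_vec_def)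
    ultimately show ?thesis by (simp add: pt_torus t cnj_basis_torus)
  qed
  have ev: "\<forall>\<^sub>F t in at 0. shift s t \<in> D"
    using shift_in_torus by eventually_elim (use complex_torus_subset_D in blast)
  have cont: "continuous_map X X \<sigma>" using \<sigma> by (simp add: toric_real_structure_def smooth_map_def)
  have 1: "limitin X (\<lambda>t. \<sigma> (pt (shift s t))) (\<sigma> (pt s)) (at 0)"
    using continuous_map_limit[OF cont limitin_pt[OF shift_tendsto s ev]] by (simp add: o_def)
  have "((\<lambda>t. cnj_vec (shift s t)) \<longlongrightarrow> cnj_vec s) (at 0)"
  proof (rule vec_tendstoI)
    fix i
    have "((\<lambda>t. cnj (shift s t $ i)) \<longlongrightarrow> cnj (s $ i)) (at 0)"
      by (intro tendsto_cnj tendsto_vec_nth shift_tendsto)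
    then show "((\<lambda>t. cnj_vec (shift s t) $ i) \<longlongrightarrow> cnj_vec s $ i) (at 0)" by (simp add: cnj_vec_def)
  qed
  moreover have "\<forall>\<^sub>F t in at 0. cnj_vec (shift s t) \<in> D"
    using ev by eventually_elim (rule cnj_in_D)
  ultimately have "limitin X (\<lambda>t. pt (cnj_vec (shift s t))) (pt (cnj_vec s)) (at 0)"
    by (intro limitin_pt cnj_in_D s)
  moreover have "\<forall>\<^sub>F t in at 0. pt (cnj_vec (shift s t)) = \<sigma> (pt (shift s t))"
    using shift_in_torus[of s] by eventually_elim (simp add: torus)
  ultimately have 2: "limitin X (\<lambda>t. \<sigma> (pt (shift s t))) (pt (cnj_vec s)) (at 0)"
    by (rule limitin_transform_eventually[rotated])
  show ?thesis by (rule limitin_Hausdorff_unique[OF 1 2 _ Hausdorff]) simp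
qed

lemma fixed_set_iff:
  assumes "toric_real_structure X A act bp \<sigma>" "q \<in> U"
  shows "q \<in> fixed_set X \<sigma> \<longleftrightarrow> (\<exists>x. \<phi> q = cvec x)"
proof
  assume "q \<in> fixed_set X \<sigma>"
  then have "pt (\<phi> q) = pt (cnj_vec (\<phi> q))"
    using real_structure_pt[OF assms(1), of "\<phi> q"] assms(2) by (simp add: fixed_set_def pt_phi)
  then have "\<phi> (pt (\<phi> q)) = \<phi> (pt (cnj_vec (\<phi> q)))" by (rule arg_cong)
  moreover have D: "\<phi> q \<in> D" using assms(2) by blast
  ultimately have "\<phi> q = cnj_vec (\<phi> q)" by (simp only: phi_pt[OF D] phi_pt[OF cnj_in_D[OF D]])
  then have "\<forall>i. cnj (\<phi> q $ i) = \<phi> q $ i" by (metis cnj_vec_def vec_lambda_beta)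
  then have "\<forall>i. Im (\<phi> q $ i) = 0" by (simp add: Reals_cnj_iff[symmetric] complex_is_Real_iff)
  then have "\<phi> q = cvec (\<chi> i. Re (\<phi> q $ i))" by (simp add: cvec_def vec_eq_iff complex_eq_iff)
  then show "\<exists>x. \<phi> q = cvec x" by blast
next
  assume "\<exists>x. \<phi> q = cvec x"
  then have "cnj_vec (\<phi> q) = \<phi> q" by (auto simp: cvec_def cnj_vec_def vec_eq_iff)
  then have "\<sigma> q = q" using real_structure_pt[OF assms(1), of "\<phi> q"] assms(2) by (simp add: pt_phi)
  then show "q \<in> fixed_set X \<sigma>" using assms(2) U_subset by (auto simp: fixed_set_def)
qed

end

text \<open>
  The compact torus turns every coordinate of a point into its absolute value. Hence its orbits
  meet the real form, on which the moment map therefore takes all its values.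
\<close>

lemma (in toric_kaehler) moment_value_real:
  assumes "toric_real_structure X A act bp \<sigma>" "q \<in> topspace X"
  shows "\<exists>p\<in>fixed_set X \<sigma>. \<mu> p = \<mu> q"
proof -
  obtain e K U \<phi> where tc: "toric_chart X A act bp \<Sigma> \<omega> g \<mu> e K U \<phi>" and q: "q \<in> U"
    using toric_chart_exists[OF assms(2)] by blast
  interpret toric_chart X A act bp \<Sigma> \<omega> g \<mu> e K U \<phi> by (rule tc)
  let ?s = "\<phi> q"
  define u :: "complex ^ 'm" where "u = (\<chi> i. cis (- Arg (?s $ i)))"
  have "u \<in> real_torus" by (simp add: real_torus_def u_def)
  then obtain w where w: "u = torus_exp w" by (rule real_torus_torus_exp)
  have "u * ?s = cvec (\<chi> i. norm (?s $ i))"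
  proof (subst vec_eq_iff, intro allI)
    fix i
    have "?s $ i = of_real (norm (?s $ i)) * cis (Arg (?s $ i))"
      using rcis_cmod_Arg[of "?s $ i"] by (simp add: rcis_def)
    then have "cis (- Arg (?s $ i)) * ?s $ i =
        of_real (norm (?s $ i)) * (cis (- Arg (?s $ i)) * cis (Arg (?s $ i)))" by (metis mult.left_commute)
    then show "(u * ?s) $ i = cvec (\<chi> i. norm (?s $ i)) $ i"
      by (simp add: u_def cvec_def cis_mult)
  qed
  moreover have sD: "?s \<in> D" using q by blast
  ultimately have "pt (u * ?s) \<in> fixed_set X \<sigma>"
    using fixed_set_iff[OF assms(1), of "pt (u * ?s)"] torus_exp_mult_in_D[OF sD, of w] pt_in phi_pt w
    by auto
  moreover have "\<mu> (pt (u * ?s)) = \<mu> q" using moment_torus_invariant[OF sD] w q by (simp add: pt_phi)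
  ultimately show ?thesis by blast
qed

section \<open>The quotient torus of a subspace\<close>

lemma torus_proj_eq: "torus_proj V v = (\<lambda>h. h + v) ` (V \<inter> range rvec)"
  by (auto simp: torus_proj_def vec_group_def r_coset_def)

lemma rvec_0: "rvec 0 = 0"
  by (simp add: rvec_def vec_eq_iff)

lemma torus_proj_self: "subspace V \<Longrightarrow> v \<in> torus_proj V v"
  using rvec_0 subspace_0[of V] by (force simp: torus_proj_eq)

lemma torus_proj_eqD:
  assumes "subspace V" "torus_proj V v = torus_proj V w"
  shows "v - w \<in> range rvec"
proof -
  have "v \<in> torus_proj V w" using torus_proj_self[OF assms(1), of v] assms(2) by simp
  then show ?thesis by (auto simp: torus_proj_eq)
qed

lemma torus_exp_coset: "w \<in> torus_proj V v \<Longrightarrow> torus_exp w = torus_exp v"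
  by (auto simp: torus_proj_eq torus_exp_add torus_exp_rvec)

lemma torus_exp_some: "subspace V \<Longrightarrow> torus_exp (SOME w. w \<in> torus_proj V v) = torus_exp v"
  using torus_exp_coset[OF someI[of "\<lambda>w. w \<in> torus_proj V v" v]] torus_proj_self by blast

lemma carrier_quotient_torus: "carrier (quotient_torus V) = torus_proj V ` V"
  by (auto simp: quotient_torus_def FactGroup_def RCOSETS_def torus_proj_def vec_group_def)

lemma openin_quotient_torus:
  "openin (quotient_torus_top V) W \<longleftrightarrow>
     W \<subseteq> torus_proj V ` V \<and> openin (top_of_set V) {v \<in> V. torus_proj V v \<in> W}"
proof -
  let ?P = "\<lambda>U. U \<subseteq> torus_proj V ` V \<and> openin (top_of_set V) {v \<in> V. torus_proj V v \<in> U}"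
  have "istopology ?P"
    unfolding istopology_def
  proof (intro conjI allI impI)
    fix S T assume "?P S" "?P T"
    then show "S \<inter> T \<subseteq> torus_proj V ` V" by blast
    have eq: "{v \<in> V. torus_proj V v \<in> S \<inter> T} = {v \<in> V. torus_proj V v \<in> S} \<inter> {v \<in> V. torus_proj V v \<in> T}"
      by blast
    show "openin (top_of_set V) {v \<in> V. torus_proj V v \<in> S \<inter> T}"
      unfolding eq using \<open>?P S\<close> \<open>?P T\<close> by (intro openin_Int) blast+
  next
    fix \<K> assume K: "\<forall>S\<in>\<K>. ?P S"
    then show "\<Union>\<K> \<subseteq> torus_proj V ` V" by blast
    have "{v \<in> V. torus_proj V v \<in> \<Union>\<K>} = (\<Union>S\<in>\<K>. {v \<in> V. torus_proj V v \<in> S})" by blast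
    with K show "openin (top_of_set V) {v \<in> V. torus_proj V v \<in> \<Union>\<K>}" by auto
  qed
  then show ?thesis
    by (simp add: quotient_torus_top_def carrier_quotient_torus topology_inverse')
qed

lemma topspace_quotient_torus: "topspace (quotient_torus_top V) = torus_proj V ` V"
proof
  show "topspace (quotient_torus_top V) \<subseteq> torus_proj V ` V"
    using openin_quotient_torus[of V "topspace (quotient_torus_top V)"] by simp
  have "{v \<in> V. torus_proj V v \<in> torus_proj V ` V} = V" by blast
  then have "openin (quotient_torus_top V) (torus_proj V ` V)"
    by (simp add: openin_quotient_torus)
  then show "torus_proj V ` V \<subseteq> topspace (quotient_torus_top V)" by (rule openin_subset)
qed

lemma continuous_map_quotient_torus:
  assumes "continuous_map (top_of_set V) Y (\<lambda>v. f (torus_proj V v))"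
  shows "continuous_map (quotient_torus_top V) Y f"
  unfolding continuous_map
proof (intro conjI allI impI)
  show "f ` topspace (quotient_torus_top V) \<subseteq> topspace Y"
    using assms by (auto simp: continuous_map topspace_quotient_torus)
  fix W assume "openin Y W"
  then have "openin (top_of_set V) {v \<in> V. f (torus_proj V v) \<in> W}"
    using assms by (simp add: continuous_map)
  moreover have "{v \<in> V. torus_proj V v \<in> {x \<in> torus_proj V ` V. f x \<in> W}} =
      {v \<in> V. f (torus_proj V v) \<in> W}" by blast
  ultimately show "openin (quotient_torus_top V) {x \<in> topspace (quotient_torus_top V). f x \<in> W}"
    by (simp add: openin_quotient_torus topspace_quotient_torus)
qed

text \<open>Different lattice points have distance at least 1, so balls of radius \<open>1/2\<close> project injectively.\<close>

lemma quotient_chart_cover: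
  assumes "subspace V" "v \<in> V"
  shows "\<exists>c\<in>quotient_torus_charts V. torus_proj V v \<in> fst c"
proof -
  let ?U = "V \<inter> ball v (1/2)"
  have "inj_on (torus_proj V) ?U"
  proof (rule inj_onI)
    fix x y assume x: "x \<in> ?U" and y: "y \<in> ?U" and eq: "torus_proj V x = torus_proj V y"
    obtain z where z: "x - y = rvec z" using torus_proj_eqD[OF assms(1) eq] by blast
    have "norm (x - y) < 1"
      using x y dist_triangle_half_r[of v x 1 y] by (simp add: dist_norm)
    then have "\<bar>(x - y) $ j\<bar> < 1" for j
      using component_le_norm_cart[of "x - y" j] by linarith
    then have lt: "real_of_int \<bar>z $ j\<bar> < real_of_int 1" for j unfolding z by (simp add: rvec_def)
    have "z $ j = 0" for j using lt[of j] unfolding of_int_less_iff by simp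
    then have "x - y = 0" by (simp add: z rvec_def vec_eq_iff)
    then show "x = y" by simp
  qed
  moreover have "openin (top_of_set V) ?U" by (simp add: openin_open_Int)
  ultimately have "(torus_proj V ` ?U, inv_into ?U (torus_proj V)) \<in> quotient_torus_charts V"
    unfolding quotient_torus_charts_def by blast
  moreover have "torus_proj V v \<in> torus_proj V ` ?U" using assms(2) by simp
  ultimately show ?thesis by (intro bexI[of _ "(torus_proj V ` ?U, inv_into ?U (torus_proj V))"]) simp_all
qed

section \<open>Determinants of adapted systems of vectors\<close>

lemma det_scale_columns:
  fixes d :: "'n::finite \<Rightarrow> complex" and N :: "complex ^ 'n ^ 'n"
  shows "det (\<chi> i k. d k * N $ i $ k) = (\<Prod>k\<in>UNIV. d k) * det N"
proof -
  have "det (\<chi> i k. d k * N $ i $ k) = det (transpose (\<chi> i k. d k * N $ i $ k))"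
    by (simp add: det_transpose)
  also have "transpose (\<chi> i k. d k * N $ i $ k) = (\<chi> k. d k *s transpose N $ k)"
    by (simp add: transpose_def vec_eq_iff)
  also have "det \<dots> = (\<Prod>k\<in>UNIV. d k) * det (\<chi> k. transpose N $ k)" by (simp add: det_rows_mul)
  also have "(\<chi> k. transpose N $ k) = transpose N" by (simp add: vec_eq_iff)
  finally show ?thesis by (simp add: det_transpose)
qed

text \<open>
  A change of basis multiplies the determinant by a real number, so the phase may be computed in a
  basis of \<open>W \<times> V\<close> that consists of a basis of each factor.
\<close>

lemma det_adapted_phase:
  fixes L :: "'e::euclidean_space \<times> 'f::euclidean_space \<Rightarrow> complex ^ 'm"
  assumes L: "linear L" and W: "subspace W" and V: "subspace V"
    and dims: "dim W + dim V = CARD('m)"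
    and re: "\<And>a. a \<in> W \<Longrightarrow> \<exists>x. L (a, 0) = cvec x"
    and im: "\<And>w. w \<in> V \<Longrightarrow> \<exists>x. L (0, w) = \<i> *s cvec x"
    and b: "\<And>j. b j \<in> W \<times> V"
  shows "\<exists>r::real. det (\<chi> i j. L (b j) $ i) = \<i> ^ dim V * of_real r"
proof -
  obtain B1 where B1: "B1 \<subseteq> W" "independent B1" "W \<subseteq> span B1" "card B1 = dim W"
    using basis_exists by blast
  obtain B2 where B2: "B2 \<subseteq> V" "independent B2" "V \<subseteq> span B2" "card B2 = dim V"
    using basis_exists by blast
  have fin: "finite B1" "finite B2" using B1(2) B2(2) by (auto intro: independent_imp_finite)
  let ?C1 = "(\<lambda>a. (a, 0 :: 'f)) ` B1" and ?C2 = "(\<lambda>w. (0 :: 'e, w)) ` B2"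
  have "0 \<notin> B2" using B2(2) dependent_zero by blast
  then have disj: "?C1 \<inter> ?C2 = {}" by auto
  have c1: "card ?C1 = dim W" and c2: "card ?C2 = dim V"
    using B1(4) B2(4) by (simp_all add: card_image inj_on_def)
  have "card (?C1 \<union> ?C2) = CARD('m)"
    using fin disj c1 c2 dims by (simp add: card_Un_disjoint)
  then obtain \<beta> :: "'m \<Rightarrow> 'e \<times> 'f" where \<beta>: "bij_betw \<beta> UNIV (?C1 \<union> ?C2)"
    using finite_same_card_bij[of "UNIV :: 'm set" "?C1 \<union> ?C2"] fin by auto
  have "\<exists>u. b j = (\<Sum>k\<in>UNIV. u k *\<^sub>R \<beta> k)" for j
  proof -
    obtain a w where aw: "b j = (a, w)" "a \<in> W" "w \<in> V" using b[of j] by auto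
    have l: "linear (\<lambda>a. (a, 0 :: 'f))" "linear (\<lambda>w. (0 :: 'e, w))" by (auto intro!: linearI)
    have "(a, 0) \<in> span ?C1" using aw(2) B1(3) unfolding linear_span_image[OF l(1)] by blast
    moreover have "(0, w) \<in> span ?C2" using aw(3) B2(3) unfolding linear_span_image[OF l(2)] by blast
    ultimately have "(a, 0) + (0, w) \<in> span (?C1 \<union> ?C2)"
      by (meson span_add span_mono subsetD Un_upper1 Un_upper2)
    then have "b j \<in> span (?C1 \<union> ?C2)" by (simp add: aw)
    then obtain u where "b j = (\<Sum>v\<in>?C1 \<union> ?C2. u v *\<^sub>R v)"
      using fin by (auto simp: span_finite)
    also have "\<dots> = (\<Sum>k\<in>UNIV. u (\<beta> k) *\<^sub>R \<beta> k)"
      by (rule sum.reindex_bij_betw[OF \<beta>, symmetric])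
    finally show ?thesis by (intro exI[of _ "\<lambda>k. u (\<beta> k)"])
  qed
  then obtain u where u: "\<And>j. b j = (\<Sum>k\<in>UNIV. u j k *\<^sub>R \<beta> k)" by metis
  define S where "S = {k. \<beta> k \<in> ?C2}"
  have cS: "card S = dim V"
  proof -
    have "\<beta> ` S = ?C2 \<inter> range \<beta>" unfolding S_def vimage_def[symmetric] by (rule image_vimage_eq)
    then have "\<beta> ` S = ?C2" using \<beta> unfolding bij_betw_def by blast
    moreover have "inj_on \<beta> S" using \<beta> unfolding bij_betw_def by (auto intro: inj_on_subset)
    ultimately show ?thesis using c2 card_image by metis
  qed
  let ?d = "\<lambda>k. if k \<in> S then \<i> else 1 :: complex"
  have "\<exists>x. L (\<beta> k) = ?d k *s cvec x" for k
  proof (cases "k \<in> S")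
    case True
    then obtain w where "w \<in> B2" "\<beta> k = (0, w)" unfolding S_def by auto
    with im[of w] B2(1) True show ?thesis by auto
  next
    case False
    then have "\<beta> k \<in> ?C1" using \<beta> unfolding S_def bij_betw_def by auto
    then obtain a where "a \<in> B1" "\<beta> k = (a, 0)" by auto
    with re[of a] B1(1) False show ?thesis by auto
  qed
  then obtain x where x: "\<And>k. L (\<beta> k) = ?d k *s cvec (x k)" by metis
  let ?R = "(\<chi> k j. u j k) :: real ^ 'm ^ 'm" and ?N = "(\<chi> i k. x k $ i) :: real ^ 'm ^ 'm"
  let ?cR = "(\<chi> k j. complex_of_real (?R $ k $ j)) :: complex ^ 'm ^ 'm"
  let ?cN = "(\<chi> i k. complex_of_real (?N $ i $ k)) :: complex ^ 'm ^ 'm"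
  have "(\<chi> i j. L (b j) $ i) = (\<chi> i k. ?d k * ?cN $ i $ k) ** ?cR"
  proof -
    have "L (b j) $ i = (\<Sum>k\<in>UNIV. of_real (u j k) * (L (\<beta> k) $ i))" for i j
      unfolding u[of j] linear_sum[OF L] linear_cmul[OF L] sum_component vector_scaleR_component
      by (simp add: scaleR_conv_of_real)
    then show ?thesis
      by (simp add: vec_eq_iff matrix_matrix_mult_def x cvec_def mult_ac)
  qed
  then have "det (\<chi> i j. L (b j) $ i) = (\<Prod>k\<in>UNIV. ?d k) * det ?cN * det ?cR"
    by (simp only: det_mul det_scale_columns)
  also have "(\<Prod>k\<in>UNIV. ?d k) = \<i> ^ dim V"
    by (simp add: prod.If_cases cS)
  also have "det ?cN = of_real (det ?N)" by (rule det_real_entries)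
  also have "det ?cR = of_real (det ?R)" by (rule det_real_entries)
  finally show ?thesis by (intro exI[of _ "det ?N * det ?R"]) simp
qed

text \<open>A complex linear relation splits into two real combinations that differ by the complex
  structure.\<close>

lemma det_eq_0_combination:
  fixes v :: "'m::finite \<Rightarrow> complex ^ 'm"
  assumes "det (\<chi> i j. v j $ i) = 0"
  shows "\<exists>x y. (\<exists>j. x j \<noteq> 0 \<or> y j \<noteq> 0) \<and>
    (\<Sum>j\<in>UNIV. (x j :: real) *\<^sub>R v j) = - Jstd (\<Sum>j\<in>UNIV. (y j :: real) *\<^sub>R v j)"
proof -
  let ?M = "(\<chi> i j. v j $ i)"
  have "\<not> invertible ?M" using assms by (simp add: invertible_det_nz)
  then obtain z where z: "?M *v z = 0" "z \<noteq> 0"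
    using matrix_left_invertible_ker[of ?M] invertible_left_inverse[of ?M] by blast
  have "(\<Sum>j\<in>UNIV. Re (z $ j) *\<^sub>R v j) = - Jstd (\<Sum>j\<in>UNIV. Im (z $ j) *\<^sub>R v j)"
  proof (subst vec_eq_iff, intro allI)
    fix i
    have "(\<Sum>j\<in>UNIV. z $ j * v j $ i) = 0"
      using z(1) by (simp add: vec_eq_iff matrix_vector_mult_def mult.commute)
    moreover have "(\<Sum>j\<in>UNIV. z $ j * v j $ i) =
        (\<Sum>j\<in>UNIV. Re (z $ j) *\<^sub>R v j $ i) + \<i> * (\<Sum>j\<in>UNIV. Im (z $ j) *\<^sub>R v j $ i)"
      unfolding sum_distrib_left sum.distrib[symmetric]
      by (intro sum.cong refl) (simp add: complex_eq_iff)
    ultimately show "(\<Sum>j\<in>UNIV. Re (z $ j) *\<^sub>R v j) $ i = (- Jstd (\<Sum>j\<in>UNIV. Im (z $ j) *\<^sub>R v j)) $ i"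
      by (simp add: Jstd_def sum_component eq_neg_iff_add_eq_0)
  qed
  moreover have "\<exists>j. Re (z $ j) \<noteq> 0 \<or> Im (z $ j) \<noteq> 0"
    using z(2) by (auto simp: vec_eq_iff complex_eq_iff)
  ultimately show ?thesis
    by (intro exI[of _ "\<lambda>j. Re (z $ j)"] exI[of _ "\<lambda>j. Im (z $ j)"] conjI)
qed

lemma mod_pi_eq_iff: "mod_pi \<theta> = mod_pi \<theta>' \<longleftrightarrow> (\<exists>k::int. \<theta> = \<theta>' + of_int k * pi)"
proof
  assume "mod_pi \<theta> = mod_pi \<theta>'"
  moreover have "\<theta> \<in> mod_pi \<theta>" unfolding mod_pi_def by (auto intro!: exI[of _ 0])
  ultimately show "\<exists>k::int. \<theta> = \<theta>' + of_int k * pi" unfolding mod_pi_def by auto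
next
  assume "\<exists>k::int. \<theta> = \<theta>' + of_int k * pi"
  then obtain k :: int where k: "\<theta> = \<theta>' + of_int k * pi" by blast
  have "\<theta> + of_int l * pi = \<theta>' + of_int (k + l) * pi" "\<theta>' + of_int l * pi = \<theta> + of_int (l - k) * pi"
    for l :: int by (simp_all add: k algebra_simps)
  then show "mod_pi \<theta> = mod_pi \<theta>'" unfolding mod_pi_def by blast
qed

lemma mod_pi_Arg:
  assumes "z = of_real r * exp (\<i> * of_real \<theta>)" "z \<noteq> 0"
  shows "mod_pi (Arg z) = mod_pi \<theta>"
proof -
  have r: "r \<noteq> 0" using assms by auto
  let ?A = "exp (\<i> * of_real (Arg z))"
  have "z = of_real (norm z) * ?A" using Arg_eq[of z] assms(2) by (simp add: mult_ac)
  moreover have "norm z = r * sgn r" using assms(1) by (simp add: norm_mult abs_sgn)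
  ultimately have "of_real r * exp (\<i> * of_real \<theta>) = of_real r * (of_real (sgn r) * ?A)"
    using assms(1) by (simp add: mult.assoc)
  then have "exp (\<i> * of_real \<theta>) = of_real (sgn r) * ?A" using r by simp
  then have "exp (\<i> * of_real \<theta>) ^ 2 = ?A ^ 2"
    using r by (cases "r > 0") auto
  then have "exp (2 * (\<i> * of_real (Arg z))) = exp (2 * (\<i> * of_real \<theta>))"
    by (simp add: exp_double)
  then obtain k :: int where "2 * (\<i> * of_real (Arg z)) = 2 * (\<i> * of_real \<theta>) + of_int (2 * k) * of_real pi * \<i>"
    by (auto simp: exp_eq)
  then have "Im (2 * (\<i> * of_real (Arg z))) = Im (2 * (\<i> * of_real \<theta>) + of_int (2 * k) * of_real pi * \<i>)"
    by (rule arg_cong)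
  then have "Arg z = \<theta> + of_int k * pi" by simp
  then show ?thesis unfolding mod_pi_eq_iff by blast
qed

section \<open>The immersion in local coordinates\<close>

lemma cvec_linear: "linear cvec"
  unfolding cvec_def
  by (intro linearI) (simp_all add: vec_eq_iff scaleR_conv_of_real[where 'a=complex])

lemma cvec_0_iff: "cvec x = 0 \<longleftrightarrow> x = 0"
  by (simp add: cvec_def vec_eq_iff)

lemma inj_cvec: "inj cvec"
  using cvec_linear cvec_0_iff linear_injective_0 by blast

lemma range_cvec: "range cvec = {a. \<forall>i. Im (a $ i) = 0}"
proof
  show "{a. \<forall>i. Im (a $ i) = 0} \<subseteq> range cvec"
  proof
    fix a :: "complex ^ 'n" assume "a \<in> {a. \<forall>i. Im (a $ i) = 0}"
    then have "a = cvec (\<chi> i. Re (a $ i))" by (simp add: cvec_def vec_eq_iff complex_eq_iff)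
    then show "a \<in> range cvec" by blast
  qed
qed (auto simp: cvec_def)

lemma rot_mult_cvec: "rot v * cvec x = \<i> *s cvec (\<chi> i. 2 * pi * v $ i * x $ i)"
  by (simp add: rot_def cvec_def vec_eq_iff)

lemma bounded_bilinear_mult_vec: "bounded_bilinear ((*) :: complex ^ 'n \<Rightarrow> complex ^ 'n \<Rightarrow> complex ^ 'n)"
proof -
  have "linear (\<lambda>a :: complex ^ 'n. t * a)" "linear (\<lambda>a :: complex ^ 'n. a * t)" for t
    using bounded_linear_mult_vec[of t] by (simp_all add: linear_conv_bounded_linear mult.commute[of _ t])
  then have "bilinear ((*) :: complex ^ 'n \<Rightarrow> complex ^ 'n \<Rightarrow> complex ^ 'n)"
    by (simp add: bilinear_def)
  then show ?thesis by (simp add: bilinear_conv_bounded_bilinear)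
qed

locale level_set = toric_kaehler X A act bp \<Sigma> \<omega> g \<mu>
  for X :: "'a topology" and A :: "('a, complex ^ 'm) chart set" and act bp \<Sigma>
    and \<omega> g :: "('a, 'm::finite) tensor2" and \<mu> +
  fixes \<sigma> :: "'a \<Rightarrow> 'a" and \<Delta> :: "(real ^ 'm) set" and d :: nat and lam :: "nat \<Rightarrow> int ^ 'm"
    and \<kappa> :: "nat \<Rightarrow> real" and n :: nat and \<zeta> :: "nat \<Rightarrow> int ^ 'm" and cs :: "nat \<Rightarrow> real"
    and V :: "(real ^ 'm) set" and S :: "'a set"
  assumes real_structure: "toric_real_structure X A act bp \<sigma>"
    and \<Delta>_eq: "\<Delta> = \<mu> ` topspace X"
    and polytope: "moment_polytope_data \<Sigma> \<Delta> d lam \<kappa>"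
    and n_le: "n \<le> CARD('m)"
    and zeta_inj: "inj_on (\<lambda>i. rvec (\<zeta> i)) {1..n}"
    and zeta_independent: "independent ((\<lambda>i. rvec (\<zeta> i)) ` {1..n})"
    and V_eq: "V = zeta_span n \<zeta>"
    and regular: "\<forall>y\<in>\<Delta>. (\<forall>i\<in>{1..n}. y \<bullet> rvec (\<zeta> i) = cs i) \<longrightarrow> zeta_regular n \<zeta> d lam \<kappa> y"
    and S_eq: "S = real_level_set X \<sigma> \<mu> n \<zeta> cs"
    and embedded: "embedded_submanifold CARD('m) (subtopology X (fixed_set X \<sigma>))
      (real_form_charts X A \<sigma>) (CARD('m) - n) S"
begin

lemma subspace_V: "subspace V"
  by (simp add: V_eq zeta_span_def)

lemma dim_V: "dim V = n"
  unfolding V_eq zeta_span_def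
  using dim_span_eq_card_independent[OF zeta_independent] card_image[OF zeta_inj] by simp

lemma S_fixed: "S \<subseteq> fixed_set X \<sigma>"
  by (auto simp: S_eq real_level_set_def)

lemma S_subset: "S \<subseteq> topspace X"
  using S_fixed by (auto simp: fixed_set_def)

lemma moment_const_on_S:
  assumes "p \<in> S" "q \<in> S" "w \<in> V"
  shows "\<mu> p \<bullet> w = \<mu> q \<bullet> w"
proof -
  have "w \<in> span ((\<lambda>i. rvec (\<zeta> i)) ` {1..n})" using assms(3) by (simp add: V_eq zeta_span_def)
  then show ?thesis
  proof (induction rule: span_induct_alt)
    case base
    then show ?case by simp
  next
    case (step c x y)
    then have "\<mu> p \<bullet> x = \<mu> q \<bullet> x" using assms(1,2) by (auto simp: S_eq real_level_set_def)
    with step show ?case by (simp add: inner_add_right)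
  qed
qed

end

text \<open>
  Regularity speaks of the normals active at a point, whereas a degenerate orbit of the torus only
  provides minimised components of the moment map. The following fact relates the two.
  If \<open>v\<close> were not in the span of the normals active at \<open>y\<close>, one could move \<open>y\<close> a little inside the
  polyhedron, orthogonally to these normals, so as to decrease the product with \<open>v\<close>.
\<close>

lemma minimiser_in_active_span:
  fixes l :: "'i \<Rightarrow> 'v::euclidean_space"
  assumes fin: "finite I" and y: "\<And>i. i \<in> I \<Longrightarrow> y \<bullet> l i \<ge> \<kappa> i"
    and min: "\<And>z. (\<And>i. i \<in> I \<Longrightarrow> z \<bullet> l i \<ge> \<kappa> i) \<Longrightarrow> y \<bullet> v \<le> z \<bullet> v"
  shows "v \<in> span {l i | i. i \<in> I \<and> y \<bullet> l i = \<kappa> i}"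
proof (rule ccontr)
  let ?T = "span {l i | i. i \<in> I \<and> y \<bullet> l i = \<kappa> i}"
  assume v: "v \<notin> ?T"
  obtain a b where ab: "a \<in> ?T" "\<And>w. w \<in> ?T \<Longrightarrow> orthogonal b w" "v = a + b"
    using orthogonal_subspace_decomp_exists by blast
  have b: "b \<noteq> 0" using ab v by auto
  define z where "z t = y - t *\<^sub>R b" for t
  have "\<forall>\<^sub>F t in at_right 0. z t \<bullet> l i \<ge> \<kappa> i" if i: "i \<in> I" for i
  proof (cases "y \<bullet> l i = \<kappa> i")
    case True
    then have "l i \<in> ?T" using i by (auto intro: span_base)
    then have "b \<bullet> l i = 0" using ab(2) by (simp add: orthogonal_def)
    with True show ?thesis by (simp add: z_def inner_diff_left)
  next
    case False
    have "((\<lambda>t. z t \<bullet> l i) \<longlongrightarrow> (y - 0 *\<^sub>R b) \<bullet> l i) (at_right 0)" unfolding z_def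
      by (intro tendsto_intros)
    then have "\<forall>\<^sub>F t in at_right 0. z t \<bullet> l i > \<kappa> i"
      using y[OF i] False by (intro order_tendstoD) auto
    then show ?thesis by eventually_elim simp
  qed
  then have "\<forall>\<^sub>F t in at_right 0. \<forall>i\<in>I. z t \<bullet> l i \<ge> \<kappa> i" by (simp add: eventually_ball_finite fin)
  moreover have "\<forall>\<^sub>F t in at_right 0. t > (0::real)" by (simp add: eventually_at_right_less)
  ultimately have "\<forall>\<^sub>F t in at_right 0. (\<forall>i\<in>I. z t \<bullet> l i \<ge> \<kappa> i) \<and> t > 0" by eventually_elim simp
  then obtain t where t: "\<forall>i\<in>I. z t \<bullet> l i \<ge> \<kappa> i" "t > 0"
    using eventually_happens'[OF trivial_limit_at_right_real] by blast
  have "b \<bullet> a = 0" using ab(1,2) by (simp add: orthogonal_def)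
  then have "b \<bullet> v > 0" using ab(3) b by (simp add: inner_add_right)
  moreover have "y \<bullet> v \<le> z t \<bullet> v" using min t(1) by blast
  ultimately show False
    using mult_pos_pos[OF t(2) \<open>b \<bullet> v > 0\<close>] by (simp add: z_def inner_diff_left)
qed

locale level_chart = level_set X A act bp \<Sigma> \<omega> g \<mu> \<sigma> \<Delta> d lam \<kappa> n \<zeta> cs V S +
  toric_volume_chart X A act bp \<Sigma> \<omega> g \<mu> e K U \<phi> \<gamma> \<Omega>
  for X :: "'a topology" and A :: "('a, complex ^ 'm) chart set" and act bp \<Sigma>
    and \<omega> g :: "('a, 'm::finite) tensor2" and \<mu> \<sigma> \<Delta> d lam \<kappa> n \<zeta> cs V S e K U \<phi> \<gamma> \<Omega>
begin

text \<open>
  Let a direction in \<open>V\<close> generate the zero vector at \<open>p\<close>. Then it is a combination of the \<open>e j\<close> whose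
  coordinate vanishes at \<open>p\<close>. The moment map components of these are minimal at \<open>p\<close>, so they lie in the
  span of the active normals, which meets \<open>V\<close> trivially.
\<close>

lemma regular_free:
  assumes p: "p \<in> S" "p \<in> U" and w: "w \<in> V" "rot (lattice_coord e w) * \<phi> p = 0"
  shows "w = 0"
proof -
  let ?T = "span {rvec (lam i) | i. i \<in> {1..d} \<and> \<mu> p \<bullet> rvec (lam i) = \<kappa> i}"
  have pX: "p \<in> topspace X" using p(2) U_subset by blast
  have cl: "closure \<Delta> = (\<Inter>i\<in>{1..d}. {y. y \<bullet> rvec (lam i) \<ge> \<kappa> i})"
    using polytope by (simp add: moment_polytope_data_def)
  have active: "rvec (e j) \<in> ?T" if j: "\<phi> p $ j = 0" for j
  proof (rule minimiser_in_active_span)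
    show "\<mu> p \<bullet> rvec (lam i) \<ge> \<kappa> i" if "i \<in> {1..d}" for i
      using that pX cl closure_subset[of \<Delta>] \<Delta>_eq by blast
    fix z assume "\<And>i. i \<in> {1..d} \<Longrightarrow> z \<bullet> rvec (lam i) \<ge> \<kappa> i"
    then have "z \<in> closure \<Delta>" using cl by blast
    moreover have "\<Delta> \<subseteq> {z. \<mu> p \<bullet> rvec (e j) \<le> z \<bullet> rvec (e j)}"
      using moment_min[of "\<phi> p" j] p(2) j by (auto simp: \<Delta>_eq pt_phi)
    then have "closure \<Delta> \<subseteq> {z. \<mu> p \<bullet> rvec (e j) \<le> z \<bullet> rvec (e j)}"
      by (rule closure_minimal) (simp add: inner_commute[of _ "rvec (e j)"] closed_halfspace_ge)
    ultimately show "\<mu> p \<bullet> rvec (e j) \<le> z \<bullet> rvec (e j)" by blast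
  qed simp
  have "lattice_coord e w $ j *\<^sub>R rvec (e j) \<in> ?T" for j
  proof (cases "\<phi> p $ j = 0")
    case True
    then show ?thesis by (intro span_scale active)
  next
    case False
    have "rot (lattice_coord e w) $ j * \<phi> p $ j = 0" using w(2) by (metis vector_mult_component zero_index)
    with False show ?thesis by (simp add: rot_def span_zero)
  qed
  then have "(\<Sum>j\<in>UNIV. lattice_coord e w $ j *\<^sub>R rvec (e j)) \<in> ?T" by (intro span_sum)
  then have "w \<in> ?T" by (simp add: lattice_comb_rvec[symmetric] lattice_comb_coord[OF basis])
  moreover have "zeta_regular n \<zeta> d lam \<kappa> (\<mu> p)"
    using regular p(1) pX by (auto simp: \<Delta>_eq S_eq real_level_set_def)
  ultimately show ?thesis using w(1) by (auto simp: zeta_regular_def V_eq)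
qed

text \<open>
  In an equivariant chart the real form is the set of real points, so the chart restricts to a
  submanifold chart of the real form.
\<close>

lemma real_form_chart: "(U \<inter> fixed_set X \<sigma>, \<phi>) \<in> real_form_charts X A \<sigma>"
proof -
  let ?R = "range (cvec :: real ^ 'm \<Rightarrow> complex ^ 'm)"
  have eq: "\<phi> ` (U \<inter> fixed_set X \<sigma>) = D \<inter> ?R"
    using fixed_set_iff[OF real_structure] by auto
  have "(U, \<phi>) \<in> smooth_charts (2 * CARD('m)) X A"
    using chart by (simp add: holomorphic_charts_def)
  moreover have "subspace ?R"
    by (rule linear_subspace_image[OF cvec_linear subspace_UNIV])
  moreover have "dim ?R = CARD('m)"
    using dim_image_eq[OF cvec_linear inj_on_subset[OF inj_cvec], of UNIV] by (simp add: dim_UNIV)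
  moreover have "openin (top_of_set ?R) (\<phi> ` (U \<inter> fixed_set X \<sigma>))"
    unfolding eq using openin_open_Int[OF open_D, of ?R] by (simp only: Int_commute)
  ultimately have "\<exists>c. (U \<inter> fixed_set X \<sigma>, \<phi>) = (fst c \<inter> fixed_set X \<sigma>, snd c) \<and>
      c \<in> smooth_charts (2 * CARD('m)) X A \<and>
      (\<exists>W. subspace W \<and> dim W = CARD('m) \<and>
        snd c ` (fst c \<inter> fixed_set X \<sigma>) = snd c ` fst c \<inter> W \<and>
        openin (top_of_set W) (snd c ` (fst c \<inter> fixed_set X \<sigma>)))"
    using eq by (intro exI[of _ "(U, \<phi>)"] exI[of _ ?R] conjI) simp_all
  then show ?thesis unfolding real_form_charts_def slice_charts_def by simp
qed

text \<open>
  A slice chart of the level set, read in the toric chart. It takes real values; its derivative is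
  injective because the coordinate change is smooth in both directions; and the derivative is
  orthogonal, with respect to the form, to the generators from \<open>V\<close>, whose moment map components are
  constant on the level set.
\<close>

lemma slice_in_toric_chart:
  assumes c0: "c0 \<in> smooth_charts CARD('m) (subtopology X (fixed_set X \<sigma>)) (real_form_charts X A \<sigma>)"
    and W: "subspace W" "openin (top_of_set W) (snd c0 ` (fst c0 \<inter> S))"
    and p: "p \<in> fst c0" "p \<in> S" "p \<in> U"
  obtains Q h h' where "open Q" "snd c0 p \<in> Q" "\<forall>k. Ck_on k h Q"
    "(h has_derivative h') (at (snd c0 p))"
    "\<And>q. q \<in> fst c0 \<inter> S \<Longrightarrow> snd c0 q \<in> Q \<Longrightarrow> q \<in> U \<and> \<phi> q = h (snd c0 q)"
    "\<And>a. a \<in> W \<Longrightarrow> \<exists>x. h' a = cvec x"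
    "\<And>a. a \<in> W \<Longrightarrow> h' a = 0 \<Longrightarrow> a = 0"
    "\<And>a w. a \<in> W \<Longrightarrow> w \<in> V \<Longrightarrow> \<omega>l (\<phi> p) (rot (lattice_coord e w) * \<phi> p) (h' a) = 0"
proof -
  let ?F = "fixed_set X \<sigma>"
  let ?cU = "(U \<inter> ?F, \<phi>)" and ?x = "snd c0 p" and ?I = "snd c0 ` (fst c0 \<inter> S)"
  have ch: "is_chart CARD('m) (subtopology X ?F) c0" by (rule smooth_charts_chart[OF c0])
  have comp: "smoothly_compatible c0 ?cU"
    using c0 real_form_chart by (simp add: smooth_charts_def)
  have pF: "p \<in> ?F" using p S_fixed by blast
  have "openin (subtopology X ?F) (U \<inter> ?F)" using U_open by (simp add: openin_subtopology_Int)
  from chart_image_openin[OF ch this] obtain T where T: "open T"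
    "snd c0 ` (fst c0 \<inter> (U \<inter> ?F)) = snd c0 ` fst c0 \<inter> T" by (auto simp: openin_open)
  have "smooth_on (snd c0 ` (fst c0 \<inter> (U \<inter> ?F))) (\<lambda>x. \<phi> (chart_pt c0 x))"
    using comp by (simp add: smoothly_compatible_def local_rep_id local_dom_id)
  moreover have "?x \<in> snd c0 ` (fst c0 \<inter> (U \<inter> ?F))" using p pF by blast
  ultimately obtain Q1 h where Q1: "open Q1" "?x \<in> Q1" "\<forall>k. Ck_on k h Q1"
    "\<forall>y \<in> snd c0 ` (fst c0 \<inter> (U \<inter> ?F)) \<inter> Q1. h y = \<phi> (chart_pt c0 y)"
    unfolding smooth_on_def by meson
  define Q where "Q = Q1 \<inter> T"
  have Q: "open Q" "?x \<in> Q" "\<forall>k. Ck_on k h Q"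
    using Q1 T p pF Ck_on_subset[of _ h Q1 Q] by (auto simp: Q_def)
  have h: "q \<in> U \<and> \<phi> q = h (snd c0 q)" if "q \<in> fst c0 \<inter> S" "snd c0 q \<in> Q" for q
  proof -
    have "snd c0 q \<in> snd c0 ` (fst c0 \<inter> (U \<inter> ?F))" unfolding T(2) using that by (auto simp: Q_def)
    then obtain q' where q': "q' \<in> fst c0" "q' \<in> U" "snd c0 q = snd c0 q'" by blast
    then have "q = q'" using that inj_onD[OF is_chart_inj_on[OF ch]] by blast
    moreover have "h (snd c0 q) = \<phi> (chart_pt c0 (snd c0 q))"
      using Q1(4) that \<open>snd c0 q \<in> snd c0 ` (fst c0 \<inter> (U \<inter> ?F))\<close> by (auto simp: Q_def)
    ultimately show ?thesis using q' chart_pt_snd[OF ch] that by auto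
  qed
  define h' where "h' = frechet_derivative h (at ?x)"
  have d: "(h has_derivative h') (at ?x)" unfolding h'_def by (rule smooth_has_derivative[OF Q(3,2)])
  have lin: "linear h'" by (rule has_derivative_linear[OF d])
  have xI: "?x \<in> ?I" using p by blast
  have hx: "h ?x = \<phi> p" using h p Q(2) by auto
  have real: "\<exists>x. h' a = cvec x" if a: "a \<in> W" for a
  proof -
    have "Im (h' a $ i) = 0" for i
    proof -
      have L: "bounded_linear (\<lambda>s :: complex ^ 'm. Im (s $ i))"
        by (rule bounded_linear_compose[OF bounded_linear_Im bounded_linear_vec_nth])
      have "((\<lambda>x. Im (h x $ i)) has_derivative (\<lambda>a. Im (h' a $ i))) (at ?x)"
        by (rule bounded_linear.has_derivative[OF L d])
      then have "((\<lambda>x. 0) has_derivative (\<lambda>a. Im (h' a $ i))) (at ?x within ?I)"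
      proof (rule has_derivative_transform_locally[OF _ Q(1,2) xI])
        fix y assume "y \<in> ?I \<inter> Q"
        then obtain q where q: "q \<in> fst c0 \<inter> S" "y = snd c0 q" "y \<in> Q" by blast
        then have "q \<in> U" "h y = \<phi> q" using h by auto
        moreover have "q \<in> ?F" using q S_fixed by blast
        ultimately show "0 = Im (h y $ i)" using fixed_set_iff[OF real_structure, of q] by (auto simp: cvec_def)
      qed
      from has_derivative_within_unique[OF W xI a this has_derivative_const] show ?thesis .
    qed
    then show ?thesis using range_cvec by blast
  qed
  have inj: "a = 0" if a: "a \<in> W" "h' a = 0" for a
  proof -
    have "smooth_on (\<phi> ` ((U \<inter> ?F) \<inter> fst c0)) (\<lambda>s. snd c0 (chart_pt ?cU s))"
      using comp by (simp add: smoothly_compatible_def local_rep_id local_dom_id)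
    moreover have "\<phi> p \<in> \<phi> ` ((U \<inter> ?F) \<inter> fst c0)" using p pF by blast
    \<comment> \<open>\<open>k\<close> is a smooth left inverse of \<open>h\<close> on the slice\<close>
    ultimately obtain Q2 k where Q2: "open Q2" "\<phi> p \<in> Q2" "\<forall>j. Ck_on j k Q2"
      "\<forall>s \<in> \<phi> ` ((U \<inter> ?F) \<inter> fst c0) \<inter> Q2. k s = snd c0 (chart_pt ?cU s)"
      unfolding smooth_on_def by meson
    let ?k' = "frechet_derivative k (at (\<phi> p))"
    have dk: "(k has_derivative ?k') (at (h ?x))"
      unfolding hx by (rule smooth_has_derivative[OF Q2(3,2)])
    have dkh: "((\<lambda>x. k (h x)) has_derivative (\<lambda>a. ?k' (h' a))) (at ?x)"
      by (rule has_derivative_compose[OF d dk])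
    have "continuous_on Q h" by (rule Ck_on_imp_continuous_on[OF spec[OF Q(3)]])
    then have o: "open (Q \<inter> h -` Q2)" using Q(1) Q2(1) by (rule continuous_open_preimage)
    have "((\<lambda>x. x) has_derivative (\<lambda>a. ?k' (h' a))) (at ?x within ?I)"
    proof (rule has_derivative_transform_locally[OF dkh o _ xI])
      show "?x \<in> Q \<inter> h -` Q2" using Q(2) Q2(2) hx by simp
      fix y assume "y \<in> ?I \<inter> (Q \<inter> h -` Q2)"
      then obtain q where q: "q \<in> fst c0 \<inter> S" "y = snd c0 q" "y \<in> Q" "h y \<in> Q2" by blast
      then have q': "q \<in> U" "h y = \<phi> q" "q \<in> ?F" using h S_fixed by auto
      have "chart_pt ?cU (\<phi> q) = q" using inj q' by (simp add: inv_into_f_f inj_on_subset)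
      then show "y = k (h y)" using Q2(4) q q' by auto
    qed
    from has_derivative_within_unique[OF W xI a(1) has_derivative_ident this] have "a = ?k' (h' a)" .
    then show ?thesis using a(2) linear_0[OF has_derivative_linear[OF dk]] by simp
  qed
  have cross: "\<omega>l (\<phi> p) (rot (lattice_coord e w) * \<phi> p) (h' a) = 0" if a: "a \<in> W" and w: "w \<in> V" for a w
  proof -
    have D: "\<phi> p \<in> D" using p by blast
    have "((\<lambda>s. \<mu> (pt s) \<bullet> w) has_derivative (\<lambda>b. - \<omega>l (\<phi> p) (rot (lattice_coord e w) * \<phi> p) b)) (at (h ?x))"
      unfolding hx by (rule moment_has_derivative[OF D])
    from has_derivative_compose[OF d this]
    have "((\<lambda>x. \<mu> p \<bullet> w) has_derivative (\<lambda>a. - \<omega>l (\<phi> p) (rot (lattice_coord e w) * \<phi> p) (h' a)))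
        (at ?x within ?I)"
    proof (rule has_derivative_transform_locally[OF _ Q(1,2) xI])
      fix y assume "y \<in> ?I \<inter> Q"
      then obtain q where q: "q \<in> fst c0 \<inter> S" "y = snd c0 q" "y \<in> Q" by blast
      then have "q \<in> U" "h y = \<phi> q" using h by auto
      then show "\<mu> p \<bullet> w = \<mu> (pt (h y)) \<bullet> w"
        using moment_const_on_S[OF p(2) _ w, of q] q by (simp add: pt_phi)
    qed
    from has_derivative_within_unique[OF W xI a this has_derivative_const] show ?thesis by simp
  qed
  show ?thesis by (rule that[OF Q d h real inj cross])
qed

end

lemma (in level_set) L_charts_cases:
  assumes "c \<in> L_charts X A \<sigma> n S V"
  obtains c0 W B where
    "c0 \<in> smooth_charts CARD('m) (subtopology X (fixed_set X \<sigma>)) (real_form_charts X A \<sigma>)"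
    "subspace W" "dim W = CARD('m) - n" "openin (top_of_set W) (snd c0 ` (fst c0 \<inter> S))"
    "openin (top_of_set V) B" "inj_on (torus_proj V) B"
    "c = ((fst c0 \<inter> S) \<times> torus_proj V ` B, map_prod (snd c0) (inv_into B (torus_proj V)))"
proof -
  obtain c1 c2 where c12: "c = (fst c1 \<times> fst c2, map_prod (snd c1) (snd c2))"
    "c1 \<in> slice_charts CARD('m) (subtopology X (fixed_set X \<sigma>)) (real_form_charts X A \<sigma>)
       (CARD('m) - n) S" "c2 \<in> quotient_torus_charts V"
    using assms unfolding L_charts_def product_charts_def by auto
  obtain c0 W where c0: "c1 = (fst c0 \<inter> S, snd c0)"
    "c0 \<in> smooth_charts CARD('m) (subtopology X (fixed_set X \<sigma>)) (real_form_charts X A \<sigma>)"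
    "subspace W" "dim W = CARD('m) - n" "openin (top_of_set W) (snd c0 ` (fst c0 \<inter> S))"
    using c12(2) unfolding slice_charts_def by blast
  obtain B where B: "c2 = (torus_proj V ` B, inv_into B (torus_proj V))"
    "openin (top_of_set V) B" "inj_on (torus_proj V) B"
    using c12(3) unfolding quotient_torus_charts_def by blast
  show ?thesis by (rule that[OF c0(2-5) B(2,3)]) (simp add: c12(1) c0(1) B(1))
qed

context level_chart
begin

text \<open>
  In the toric chart the immersion is \<open>(x, y) \<mapsto> exp (y) h x\<close>, where \<open>h\<close> is the inverse of the slice chart. The
  vectors \<open>h' a + rot w * \<phi> p\<close> below are its derivative, up to the unitary factor \<open>exp (y)\<close>.
\<close>

lemma immersion_local:
  assumes c: "c \<in> L_charts X A \<sigma> n S V" and P: "P \<in> fst c" "fst P \<in> U"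
  obtains W y h' where
    "subspace W" "dim W = CARD('m) - n" "openin (top_of_set (W \<times> V)) (snd c ` fst c)"
    "y \<in> V" "snd P = torus_proj V y" "fst P \<in> S" "linear h'"
    "F_map act P = pt (torus_exp (lattice_coord e y) * \<phi> (fst P))"
    "\<And>a. a \<in> W \<Longrightarrow> \<exists>x. h' a = cvec x"
    "\<And>a. a \<in> W \<Longrightarrow> h' a = 0 \<Longrightarrow> a = 0"
    "\<And>a w. a \<in> W \<Longrightarrow> w \<in> V \<Longrightarrow> \<omega>l (\<phi> (fst P)) (rot (lattice_coord e w) * \<phi> (fst P)) (h' a) = 0"
    "\<And>c'. c' \<in> A \<Longrightarrow> F_map act P \<in> fst c' \<Longrightarrow> \<exists>N \<Psi>. open N \<and> snd c P \<in> N \<and> (\<forall>k. Ck_on k \<Psi> N) \<and>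
       (\<forall>z\<in>snd c ` fst c \<inter> N. local_rep c c' (F_map act) z = \<Psi> z) \<and>
       (\<Psi> has_derivative (\<lambda>z. dtrans c' (torus_exp (lattice_coord e y) * \<phi> (fst P))
          (torus_exp (lattice_coord e y) *
            (h' (fst z) + rot (lattice_coord e (snd z)) * \<phi> (fst P))))) (at (snd c P))"
proof -
  obtain c0 W B where c0:
    "c0 \<in> smooth_charts CARD('m) (subtopology X (fixed_set X \<sigma>)) (real_form_charts X A \<sigma>)"
    and W: "subspace W" "dim W = CARD('m) - n" "openin (top_of_set W) (snd c0 ` (fst c0 \<inter> S))"
    and B: "openin (top_of_set V) B" "inj_on (torus_proj V) B"
    and ceq: "c = ((fst c0 \<inter> S) \<times> torus_proj V ` B, map_prod (snd c0) (inv_into B (torus_proj V)))"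
    using L_charts_cases[OF c] by blast
  obtain p y where py: "P = (p, torus_proj V y)" "p \<in> fst c0" "p \<in> S" "y \<in> B"
    using P(1) by (auto simp: ceq)
  have pU: "p \<in> U" using P(2) py by simp
  have yV: "y \<in> V" using py(4) openin_imp_subset[OF B(1)] by blast
  let ?s = "\<phi> p" and ?E = "torus_exp (lattice_coord e y)"
  have ch: "is_chart CARD('m) (subtopology X (fixed_set X \<sigma>)) c0" by (rule smooth_charts_chart[OF c0])
  have snd_c: "snd c (q, torus_proj V v) = (snd c0 q, v)" if "v \<in> B" for q v
    using that B(2) by (simp add: ceq)
  have image: "snd c ` fst c = snd c0 ` (fst c0 \<inter> S) \<times> B"
  proof
    show "snd c ` fst c \<subseteq> snd c0 ` (fst c0 \<inter> S) \<times> B" using B(2) by (auto simp: ceq)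
    show "snd c0 ` (fst c0 \<inter> S) \<times> B \<subseteq> snd c ` fst c"
    proof
      fix z assume "z \<in> snd c0 ` (fst c0 \<inter> S) \<times> B"
      then obtain q v where q: "q \<in> fst c0 \<inter> S" "v \<in> B" "z = (snd c0 q, v)" by auto
      then have "z = snd c (q, torus_proj V v)" by (simp add: snd_c)
      moreover have "(q, torus_proj V v) \<in> fst c" using q by (simp add: ceq)
      ultimately show "z \<in> snd c ` fst c" by blast
    qed
  qed
  have inj_c: "inj_on (snd c) (fst c)"
  proof -
    have "inj_on (inv_into B (torus_proj V)) (torus_proj V ` B)" by (rule inj_on_inv_into) simp
    moreover have "inj_on (snd c0) (fst c0 \<inter> S)"
      using is_chart_inj_on[OF ch] by (rule inj_on_subset) simp
    ultimately show ?thesis unfolding ceq fst_conv snd_conv by (rule map_prod_inj_on[rotated])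
  qed
  have c_pt: "chart_pt c (snd c0 q, v) = (q, torus_proj V v)" if "q \<in> fst c0 \<inter> S" "v \<in> B" for q v
    using inv_into_f_f[OF inj_c, of "(q, torus_proj V v)"] that by (simp add: snd_c) (simp add: ceq)
  have F: "F_map act (q, torus_proj V v) = pt (torus_exp (lattice_coord e v) * \<phi> q)"
    if "q \<in> U" for q v
    using act_torus_exp_pt[of "\<phi> q" v] that
    by (simp add: F_map_def torus_exp_some[OF subspace_V] pt_phi)
  obtain Q h h' where Q: "open Q" "snd c0 p \<in> Q" "\<forall>k. Ck_on k h Q"
    "(h has_derivative h') (at (snd c0 p))"
    and hq: "\<And>q. q \<in> fst c0 \<inter> S \<Longrightarrow> snd c0 q \<in> Q \<Longrightarrow> q \<in> U \<and> \<phi> q = h (snd c0 q)"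
    and h': "\<And>a. a \<in> W \<Longrightarrow> \<exists>x. h' a = cvec x" "\<And>a. a \<in> W \<Longrightarrow> h' a = 0 \<Longrightarrow> a = 0"
      "\<And>a w. a \<in> W \<Longrightarrow> w \<in> V \<Longrightarrow> \<omega>l ?s (rot (lattice_coord e w) * ?s) (h' a) = 0"
    using slice_in_toric_chart[OF c0 W(1,3) py(2,3) pU] by blast
  define G where "G z = torus_exp (lattice_coord e (snd z)) * h (fst z)" for z
  have hp: "h (snd c0 p) = ?s" using hq[of p] py Q(2) by simp
  have bl: "bounded_linear (\<lambda>z :: (complex ^ 'm) \<times> (real ^ 'm). lattice_coord e (snd z))"
  proof -
    have "bounded_linear (lattice_coord e :: real ^ 'm \<Rightarrow> real ^ 'm)"
      using linear_lattice_coord by (simp add: linear_conv_bounded_linear)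
    then show ?thesis by (rule bounded_linear_compose[OF _ bounded_linear_snd])
  qed
  have G_smooth: "\<forall>k. Ck_on k G (Q \<times> UNIV)"
  proof
    fix k
    have "Ck_on k (\<lambda>z :: (complex ^ 'm) \<times> (real ^ 'm). torus_exp (lattice_coord e (snd z))) (Q \<times> UNIV)"
      by (rule Ck_on_compose[OF Ck_on_torus_exp Ck_on_bounded_linear[OF bl]]) (rule subset_UNIV)
    moreover have "Ck_on k (\<lambda>z :: (complex ^ 'm) \<times> (real ^ 'm). h (fst z)) (Q \<times> UNIV)"
      by (rule Ck_on_compose[OF spec[OF Q(3)] Ck_on_bounded_linear[OF bounded_linear_fst]]) auto
    ultimately show "Ck_on k G (Q \<times> UNIV)"
      unfolding G_def by (rule Ck_on_bilinear[OF bounded_bilinear_mult_vec])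
  qed
  have G_deriv: "(G has_derivative (\<lambda>z. ?E * (h' (fst z) + rot (lattice_coord e (snd z)) * ?s)))
      (at (snd c0 p, y))"
  proof -
    have 1: "((\<lambda>z :: (complex ^ 'm) \<times> (real ^ 'm). torus_exp (lattice_coord e (snd z))) has_derivative
        (\<lambda>z. torus_exp (lattice_coord e (snd (snd c0 p, y))) * rot (lattice_coord e (snd z)))) (at (snd c0 p, y))"
      by (rule has_derivative_compose[OF bounded_linear_imp_has_derivative[OF bl] torus_exp_has_derivative])
    have 2: "(h has_derivative h') (at (fst (snd c0 p, y)))" using Q(4) by simp
    have 3: "((\<lambda>z :: (complex ^ 'm) \<times> (real ^ 'm). h (fst z)) has_derivative (\<lambda>z. h' (fst z))) (at (snd c0 p, y))"
      by (rule has_derivative_compose[OF bounded_linear_imp_has_derivative[OF bounded_linear_fst] 2])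
    from bounded_bilinear.FDERIV[OF bounded_bilinear_mult_vec 1 3] show ?thesis
      unfolding G_def by (simp add: hp algebra_simps)
  qed
  have G_in: "G (snd c0 p, y) = ?E * ?s" by (simp add: G_def hp)
  have Es: "?E * ?s \<in> D" using pU by (intro torus_exp_mult_in_D) blast
  have loc: "\<exists>N \<Psi>. open N \<and> snd c P \<in> N \<and> (\<forall>k. Ck_on k \<Psi> N) \<and>
       (\<forall>z\<in>snd c ` fst c \<inter> N. local_rep c c' (F_map act) z = \<Psi> z) \<and>
       (\<Psi> has_derivative (\<lambda>z. dtrans c' (?E * ?s)
          (?E * (h' (fst z) + rot (lattice_coord e (snd z)) * ?s)))) (at (snd c P))"
    if c': "c' \<in> A" "F_map act P \<in> fst c'" for c'
  proof -
    let ?T = "\<phi> ` (U \<inter> fst c')"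
    let ?N = "(Q \<times> UNIV) \<inter> G -` ?T" and ?\<Psi> = "\<lambda>z. snd c' (pt (G z))"
    have sc: "snd c P = (snd c0 p, y)" by (simp add: py(1) snd_c[OF py(4)])
    have ptE: "pt (?E * ?s) \<in> fst c'" using c'(2) by (simp add: py(1) F[OF pU])
    have "continuous_on (Q \<times> UNIV) G" by (rule Ck_on_imp_continuous_on[OF spec[OF G_smooth]])
    then have N: "open ?N"
      using Q(1) open_chart_overlap[OF A_open[OF c'(1)]]
      by (intro continuous_open_preimage open_Times) auto
    have inN: "snd c P \<in> ?N" using Q(2) overlap_mem[OF Es ptE] by (simp add: sc G_in)
    have smooth: "Ck_on k ?\<Psi> ?N" for k
    proof (rule Ck_on_compose[OF spec[OF trans_smooth[OF c'(1)]]])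
      show "Ck_on k G ?N" using spec[OF G_smooth] by (rule Ck_on_subset) blast
    qed blast
    have eq: "local_rep c c' (F_map act) z = ?\<Psi> z" if "z \<in> snd c ` fst c \<inter> ?N" for z
    proof -
      have "z \<in> snd c0 ` (fst c0 \<inter> S) \<times> B" using that unfolding image by blast
      then obtain q v where z: "z = (snd c0 q, v)" "q \<in> fst c0 \<inter> S" "v \<in> B" by auto
      have "snd c0 q \<in> Q" using that z by auto
      then have "q \<in> U" "\<phi> q = h (snd c0 q)" using hq z(2) by auto
      then show ?thesis using F[of q v] c_pt[OF z(2,3)] by (simp add: local_rep_def z(1) G_def)
    qed
    have d: "((\<lambda>x. snd c' (pt x)) has_derivative dtrans c' (?E * ?s)) (at (G (snd c P)))"
      unfolding sc G_in by (rule dtrans_has_derivative[OF c'(1) Es ptE])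
    have d\<Psi>: "(?\<Psi> has_derivative (\<lambda>z. dtrans c' (?E * ?s)
        (?E * (h' (fst z) + rot (lattice_coord e (snd z)) * ?s)))) (at (snd c P))"
      by (rule has_derivative_compose[OF G_deriv[folded sc] d])
    show ?thesis
      by (intro exI[of _ ?N] exI[of _ ?\<Psi>] conjI ballI allI) (fact N inN smooth eq d\<Psi>)+
  qed
  have op: "openin (top_of_set (W \<times> V)) (snd c ` fst c)"
    unfolding image by (rule openin_Times[OF W(3) B(1)])
  have fP: "fst P = p" "snd P = torus_proj V y" by (simp_all add: py(1))
  show ?thesis
  proof (rule that[of W y h'], unfold fP)
    show "linear h'" by (rule has_derivative_linear[OF Q(4)])
    show "F_map act P = pt (?E * ?s)" using F[OF pU] by (simp add: py(1))
  qed (fact W(1) W(2) op yV refl py(3) h' loc)+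
qed

text \<open>
  The three contributions to the form on two tangent vectors vanish for different reasons: the real
  directions and the orbit directions are isotropic, and the moment map components from \<open>V\<close> are
  constant on the level set. The two parts of a tangent vector are real and purely imaginary, so
  regularity gives injectivity. Equivariance of \<open>\<Omega>\<close> and the adapted basis of \<open>W \<times> V\<close> give the phase.
\<close>

lemma immersion_at:
  assumes c: "c \<in> L_charts X A \<sigma> n S V" and P: "P \<in> fst c" "fst P \<in> U"
    and c': "c' \<in> A" "F_map act P \<in> fst c'"
  shows "\<exists>N \<Psi>. open N \<and> snd c P \<in> N \<and> (\<forall>k. Ck_on k \<Psi> N) \<and>
      (\<forall>z\<in>snd c ` fst c \<inter> N. local_rep c c' (F_map act) z = \<Psi> z)"
    and "inj_on (pushforward c c' (F_map act) P) (model_space c)"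
    and "dim (model_space c) = CARD('m)"
    and "\<And>a b. a \<in> model_space c \<Longrightarrow> b \<in> model_space c \<Longrightarrow>
      \<omega> c' (F_map act P) (pushforward c c' (F_map act) P a) (pushforward c c' (F_map act) P b) = 0"
    and "\<And>(b :: 'm \<Rightarrow> (complex ^ 'm) \<times> (real ^ 'm)) v. inj b \<Longrightarrow> independent (range b) \<Longrightarrow> span (range b) = model_space c \<Longrightarrow>
      snd P = torus_proj V v \<Longrightarrow>
      mod_pi (Arg (\<Omega> c' (F_map act P) (\<lambda>j. pushforward c c' (F_map act) P (b j)))) =
      mod_pi (2 * pi * (rvec \<gamma> \<bullet> v) + real n * (pi / 2))"
proof -
  obtain W y h' where W: "subspace W" "dim W = CARD('m) - n"
      "openin (top_of_set (W \<times> V)) (snd c ` fst c)"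
    and y: "y \<in> V" "snd P = torus_proj V y" and pS: "fst P \<in> S" and lin: "linear h'"
    and F: "F_map act P = pt (torus_exp (lattice_coord e y) * \<phi> (fst P))"
    and h': "\<And>a. a \<in> W \<Longrightarrow> \<exists>x. h' a = cvec x" "\<And>a. a \<in> W \<Longrightarrow> h' a = 0 \<Longrightarrow> a = 0"
      "\<And>a w. a \<in> W \<Longrightarrow> w \<in> V \<Longrightarrow> \<omega>l (\<phi> (fst P)) (rot (lattice_coord e w) * \<phi> (fst P)) (h' a) = 0"
    and loc: "\<And>c'. c' \<in> A \<Longrightarrow> F_map act P \<in> fst c' \<Longrightarrow> \<exists>N \<Psi>. open N \<and> snd c P \<in> N \<and>
       (\<forall>k. Ck_on k \<Psi> N) \<and> (\<forall>z\<in>snd c ` fst c \<inter> N. local_rep c c' (F_map act) z = \<Psi> z) \<and>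
       (\<Psi> has_derivative (\<lambda>z. dtrans c' (torus_exp (lattice_coord e y) * \<phi> (fst P))
          (torus_exp (lattice_coord e y) *
            (h' (fst z) + rot (lattice_coord e (snd z)) * \<phi> (fst P))))) (at (snd c P))"
    using immersion_local[OF c P] by blast
  let ?s = "\<phi> (fst P)" and ?E = "torus_exp (lattice_coord e y)"
  define L where "L z = h' (fst z) + rot (lattice_coord e (snd z)) * ?s" for z
  obtain N \<Psi> where \<Psi>: "open N" "snd c P \<in> N" "\<forall>k. Ck_on k \<Psi> N"
    "\<forall>z\<in>snd c ` fst c \<inter> N. local_rep c c' (F_map act) z = \<Psi> z"
    "(\<Psi> has_derivative (\<lambda>z. dtrans c' (?E * ?s) (?E * L z))) (at (snd c P))"
    using loc[OF c'] unfolding L_def by blast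
  show "\<exists>N \<Psi>. open N \<and> snd c P \<in> N \<and> (\<forall>k. Ck_on k \<Psi> N) \<and>
      (\<forall>z\<in>snd c ` fst c \<inter> N. local_rep c c' (F_map act) z = \<Psi> z)" using \<Psi>(1-4) by blast
  have WV: "subspace (W \<times> V)" by (rule subspace_Times[OF W(1) subspace_V])
  have ms: "model_space c = W \<times> V"
    unfolding model_space_def using span_relatively_open[OF WV W(3)] P(1) by blast
  have s: "?s \<in> D" and sE: "?E * ?s \<in> D" using P(2) torus_exp_mult_in_D by blast+
  have ptE: "pt (?E * ?s) \<in> fst c'" using c'(2) F by simp
  have pf: "pushforward c c' (F_map act) P z = dtrans c' (?E * ?s) (?E * L z)" if "z \<in> W \<times> V" for z
  proof -
    have "(local_rep c c' (F_map act) has_derivative (\<lambda>z. dtrans c' (?E * ?s) (?E * L z)))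
        (at (snd c P) within snd c ` fst c)"
      by (rule has_derivative_transform_locally[OF \<Psi>(5,1,2)]) (use P(1) \<Psi>(4) in auto)
    from frechet_derivative_within[OF WV W(3) _ that this] show ?thesis
      unfolding pushforward_def using P(1) by blast
  qed
  obtain x where x: "?s = cvec x"
    using fixed_set_iff[OF real_structure P(2)] pS S_fixed by blast
  have linL: "linear L"
  proof -
    have lw: "linear (\<lambda>w. rot (lattice_coord e w) * ?s)"
      by (intro linearI) (simp_all add: lattice_coord_add lattice_coord_scaleR rot_add rot_scaleR
          distrib_right bounded_bilinear.scaleR_left[OF bounded_bilinear_mult_vec])
    show ?thesis unfolding L_def
      by (intro linearI) (simp_all add: linear_add[OF lin] linear_cmul[OF lin] linear_add[OF lw]
          linear_cmul[OF lw] scaleR_right_distrib)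
  qed
  have L_zero: "z = 0" if z: "z \<in> W \<times> V" "L z = 0" for z
  proof -
    obtain a w where aw: "z = (a, w)" "a \<in> W" "w \<in> V" using z(1) by auto
    obtain u where u: "h' a = cvec u" using h'(1)[OF aw(2)] by blast
    have eq: "cvec u + \<i> *s cvec (\<chi> i. 2 * pi * lattice_coord e w $ i * x $ i) = 0"
      using z(2) by (simp add: L_def aw(1) u x rot_mult_cvec)
    have "u $ i = 0 \<and> 2 * pi * lattice_coord e w $ i * x $ i = 0" for i
    proof -
      have "of_real (u $ i) + \<i> * of_real (2 * pi * lattice_coord e w $ i * x $ i) = (0 :: complex)"
        using arg_cong[OF eq, of "\<lambda>v. v $ i"] by (simp add: cvec_def)
      then show ?thesis by (simp add: complex_eq_iff)
    qed
    then have "u = 0" "rot (lattice_coord e w) * ?s = 0"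
      by (auto simp: vec_eq_iff rot_def x cvec_def)
    then have "a = 0" "w = 0"
      using h'(2)[OF aw(2)] u cvec_0_iff regular_free[OF pS P(2) aw(3)] by auto
    then show ?thesis by (simp add: aw(1) zero_prod_def)
  qed
  have L_isotropic: "\<omega>l ?s (L z) (L z') = 0" if zz: "z \<in> W \<times> V" "z' \<in> W \<times> V" for z z'
  proof -
    obtain a w a' w' where aw: "z = (a, w)" "a \<in> W" "w \<in> V" "z' = (a', w')" "a' \<in> W" "w' \<in> V"
      using zz by auto
    obtain u u' where u: "h' a = cvec u" "h' a' = cvec u'" using h'(1) aw by metis
    have "\<omega>l ?s (h' a) (h' a') = 0" unfolding u x by (rule real_isotropic) (use s x in simp)
    moreover have "\<omega>l ?s (h' a) (rot (lattice_coord e w') * ?s) = 0"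
      using omega_antisym[OF s, of "h' a"] h'(3)[OF aw(2,6)] by simp
    ultimately show ?thesis
      using h'(3)[OF aw(5,3)] orbit_isotropic[OF s]
      by (simp add: L_def aw(1,4) bilinear_radd[OF bilinear_omega[OF s]] bilinear_ladd[OF bilinear_omega[OF s]])
  qed
  have E: "?E $ i \<noteq> 0" for i using torus_exp_in_complex_torus[of "lattice_coord e y"]
    by (simp add: complex_torus_def)
  show "inj_on (pushforward c c' (F_map act) P) (model_space c)"
  proof (rule inj_onI)
    fix z z' assume z: "z \<in> model_space c" "z' \<in> model_space c"
      and eq: "pushforward c c' (F_map act) P z = pushforward c c' (F_map act) P z'"
    have "dtrans c' (?E * ?s) (?E * L (z - z')) = 0"
      using eq z unfolding ms by (simp add: pf linear_diff[OF linL] right_diff_distrib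
          linear_diff[OF dtrans_linear[OF c'(1) sE ptE]])
    then have "?E * L (z - z') = 0" using dtrans_eq_0_iff[OF c'(1) sE ptE] by blast
    then have "L (z - z') = 0" using E by (auto simp: vec_eq_iff)
    moreover have "z - z' \<in> W \<times> V" using z unfolding ms by (rule subspace_diff[OF WV])
    ultimately show "z = z'" using L_zero by fastforce
  qed
  have dims: "dim W + dim V = CARD('m)" using W(2) dim_V n_le by simp
  show "dim (model_space c) = CARD('m)"
    unfolding ms using dim_Times[OF W(1) subspace_V] dims by simp
  show "\<omega> c' (F_map act P) (pushforward c c' (F_map act) P a) (pushforward c c' (F_map act) P b) = 0"
    if "a \<in> model_space c" "b \<in> model_space c" for a b
  proof -
    have ab: "a \<in> W \<times> V" "b \<in> W \<times> V" using that ms by auto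
    have "\<omega> c' (F_map act P) (pushforward c c' (F_map act) P a) (pushforward c c' (F_map act) P b) =
        \<omega>l (?E * ?s) (?E * L a) (?E * L b)"
      by (simp only: pf[OF ab(1)] pf[OF ab(2)] F tensor_loc_eq[OF tensor_fields(1) c'(1) sE ptE])
    also have "\<dots> = \<omega>l ?s (L a) (L b)" by (rule omega_torus_invariant[OF s])
    finally show ?thesis by (simp only: L_isotropic[OF ab])
  qed
  fix b :: "'m \<Rightarrow> (complex ^ 'm) \<times> (real ^ 'm)" and v
  assume b: "inj b" "independent (range b)" "span (range b) = model_space c"
    and v: "snd P = torus_proj V v"
  have bW: "b j \<in> W \<times> V" for j using b(3) ms span_base[of "b j" "range b"] by auto
  let ?d = "det (\<chi> i j. L (b j) $ i)" and ?\<Omega> = "\<Omega> c' (F_map act P) (\<lambda>j. pushforward c c' (F_map act) P (b j))"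
  have "?d \<noteq> 0"
  proof
    assume "?d = 0"
    then obtain p q :: "'m \<Rightarrow> real" where pq: "\<exists>j. p j \<noteq> 0 \<or> q j \<noteq> 0"
      "(\<Sum>j\<in>UNIV. p j *\<^sub>R L (b j)) = - Jstd (\<Sum>j\<in>UNIV. q j *\<^sub>R L (b j))"
      using det_eq_0_combination[of "\<lambda>j. L (b j)"] by blast
    have comb: "(\<Sum>j\<in>UNIV. r j *\<^sub>R L (b j)) = L (\<Sum>j\<in>UNIV. r j *\<^sub>R b j)" for r
      by (simp add: linear_sum[OF linL] linear_cmul[OF linL])
    have mem: "(\<Sum>j\<in>UNIV. r j *\<^sub>R b j) \<in> W \<times> V" for r
      by (intro subspace_sum[OF WV] subspace_scale[OF WV] bW)
    let ?p = "\<Sum>j\<in>UNIV. p j *\<^sub>R b j" and ?q = "\<Sum>j\<in>UNIV. q j *\<^sub>R b j"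
    have J: "L ?p = - Jstd (L ?q)" using pq(2) by (simp only: comb)
    have "\<omega>l ?s (L ?q) (Jstd (L ?q)) = 0"
      using L_isotropic[OF mem[of q] mem[of p]] unfolding J
      by (simp add: bilinear_rneg[OF bilinear_omega[OF s]])
    then have "L ?q = 0" using omega_pos[OF s, of "L ?q"] by fastforce
    moreover from this have "L ?p = 0" unfolding J by (simp add: Jstd_def vec_eq_iff)
    ultimately have "?p = 0" "?q = 0" using L_zero mem by blast+
    moreover have "r j = 0" if "(\<Sum>j\<in>UNIV. r j *\<^sub>R b j) = 0" for r :: "'m \<Rightarrow> real" and j
    proof -
      have "(\<Sum>z\<in>range b. r (inv_into UNIV b z) *\<^sub>R z) = 0"
        using that by (simp add: sum.reindex[OF b(1)] b(1))
      from independentD[OF b(2) _ subset_refl this, of "b j"] show ?thesis using b(1) by simp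
    qed
    ultimately show False using pq(1) by blast
  qed
  obtain r where r: "?d = \<i> ^ n * of_real r"
  proof -
    have "\<exists>r::real. ?d = \<i> ^ dim V * of_real r"
    proof (rule det_adapted_phase[OF linL W(1) subspace_V dims])
      show "\<exists>x. L (a, 0) = cvec x" if "a \<in> W" for a
      proof -
        have "rot (lattice_coord e (0 :: real ^ 'm)) = 0"
          by (simp add: linear_0[OF linear_lattice_coord] linear_0[OF linear_rot])
        then show ?thesis using h'(1)[OF that] by (simp add: L_def)
      qed
      show "\<exists>x. L (0, w) = \<i> *s cvec x" for w
        using linear_0[OF lin] by (auto simp: L_def x rot_mult_cvec)
    qed (rule bW)
    then show ?thesis using that dim_V by blast
  qed
  have "?\<Omega> = vol_coeff (?E * ?s) * det (\<chi> i j. (?E * L (b j)) $ i)"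
    using volume_density[OF c'(1) sE ptE] by (simp add: pf[OF bW] F)
  also have "\<dots> = (vol_coeff (?E * ?s) * (\<Prod>i\<in>UNIV. ?E $ i)) * ?d" by (simp only: det_scale_rows mult.assoc)
  also have "vol_coeff (?E * ?s) * (\<Prod>i\<in>UNIV. ?E $ i) =
      exp (2 * of_real pi * \<i> * of_real (rvec \<gamma> \<bullet> y)) * vol_coeff ?s"
    using vol_coeff_equivariant[OF s, of "lattice_coord e y"] by (simp only: lattice_comb_coord[OF basis])
  finally have \<Omega>: "?\<Omega> = exp (2 * of_real pi * \<i> * of_real (rvec \<gamma> \<bullet> y)) * vol_coeff ?s * ?d" .
  then have nz: "?\<Omega> \<noteq> 0" using vol_coeff_nonzero[OF s] \<open>?d \<noteq> 0\<close> by simp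
  have vr: "vol_coeff ?s = of_real (Re (vol_coeff ?s))"
    using vol_coeff_real[of x] s x by (simp add: complex_eq_iff)
  have "\<i> ^ n = exp (\<i> * of_real (real n * (pi / 2)))"
  proof -
    have "exp (\<i> * of_real (real n * (pi / 2))) = exp (of_nat n * (\<i> * of_real (pi / 2)))"
      by (simp add: mult_ac)
    also have "\<dots> = exp (\<i> * of_real (pi / 2)) ^ n" by (rule exp_of_nat_mult)
    also have "exp (\<i> * of_real (pi / 2)) = \<i>"
      using cis_conv_exp[of "pi / 2"] by (simp add: cis.ctr complex_eq_iff)
    finally show ?thesis by simp
  qed
  moreover have "exp (2 * of_real pi * \<i> * of_real (rvec \<gamma> \<bullet> y)) = exp (\<i> * of_real (2 * pi * (rvec \<gamma> \<bullet> y)))"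
    by (simp add: mult_ac)
  ultimately have "?\<Omega> = of_real (Re (vol_coeff ?s) * r) *
      (exp (\<i> * of_real (2 * pi * (rvec \<gamma> \<bullet> y))) * exp (\<i> * of_real (real n * (pi / 2))))"
    by (simp only: \<Omega> r of_real_mult) (subst vr, simp add: mult_ac)
  also have "exp (\<i> * of_real (2 * pi * (rvec \<gamma> \<bullet> y))) * exp (\<i> * of_real (real n * (pi / 2))) =
      exp (\<i> * complex_of_real (2 * pi * (rvec \<gamma> \<bullet> y) + real n * (pi / 2)))"
    by (simp only: exp_add[symmetric] of_real_add ring_distribs)
  finally have "mod_pi (Arg ?\<Omega>) = mod_pi (2 * pi * (rvec \<gamma> \<bullet> y) + real n * (pi / 2))"
    using nz by (rule mod_pi_Arg)
  also have "\<dots> = mod_pi (2 * pi * (rvec \<gamma> \<bullet> v) + real n * (pi / 2))"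
  proof -
    obtain z where "y - v = rvec z" using torus_proj_eqD[OF subspace_V, of y v] y(2) v by auto
    then have "rvec \<gamma> \<bullet> y = rvec \<gamma> \<bullet> v + rvec \<gamma> \<bullet> rvec z" by (metis diff_add_cancel add.commute inner_add_right)
    also have "rvec \<gamma> \<bullet> rvec z = of_int (\<Sum>j\<in>UNIV. \<gamma> $ j * z $ j)" by (simp add: inner_vec_def rvec_def)
    finally have "2 * pi * (rvec \<gamma> \<bullet> y) + real n * (pi / 2) =
        (2 * pi * (rvec \<gamma> \<bullet> v) + real n * (pi / 2)) + of_int (2 * (\<Sum>j\<in>UNIV. \<gamma> $ j * z $ j)) * pi"
      by (simp add: algebra_simps)
    then show ?thesis unfolding mod_pi_eq_iff by blast
  qed
  finally show "mod_pi (Arg ?\<Omega>) = mod_pi (2 * pi * (rvec \<gamma> \<bullet> v) + real n * (pi / 2))" .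
qed

end

section \<open>The Lagrangian angle\<close>

context level_set
begin

lemma level_chart_exists:
  assumes "toric_volume_form X A act bp \<gamma> \<Omega>" "p \<in> topspace X"
  shows "\<exists>e K U \<phi>. level_chart X A act bp \<Sigma> \<omega> g \<mu> \<sigma> \<Delta> d lam \<kappa> n \<zeta> cs V S e K U \<phi> \<gamma> \<Omega> \<and> p \<in> U"
proof -
  obtain e K U \<phi> where tc: "toric_chart X A act bp \<Sigma> \<omega> g \<mu> e K U \<phi>" "p \<in> U"
    using toric_chart_exists[OF assms(2)] by blast
  have "level_chart X A act bp \<Sigma> \<omega> g \<mu> \<sigma> \<Delta> d lam \<kappa> n \<zeta> cs V S e K U \<phi> \<gamma> \<Omega>"
    by (intro level_chart.intro level_set_axioms toric_volume_chart.intro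
        toric_volume_chart_axioms.intro tc assms(1))
  with tc(2) show ?thesis by blast
qed

lemma topspace_L: "topspace (L_top X S V) = S \<times> torus_proj V ` V"
  using S_subset by (auto simp: L_top_def topspace_quotient_torus)

lemma L_chart_at:
  assumes "P \<in> topspace (L_top X S V)"
  shows "\<exists>c\<in>L_charts X A \<sigma> n S V. P \<in> fst c"
proof -
  obtain p v where P: "P = (p, torus_proj V v)" "p \<in> S" "v \<in> V" using assms topspace_L by auto
  obtain c1 where "c1 \<in> slice_charts CARD('m) (subtopology X (fixed_set X \<sigma>))
      (real_form_charts X A \<sigma>) (CARD('m) - n) S" "p \<in> fst c1"
    using embedded P(2) unfolding embedded_submanifold_def by blast
  moreover obtain c2 where "c2 \<in> quotient_torus_charts V" "torus_proj V v \<in> fst c2"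
    using quotient_chart_cover[OF subspace_V P(3)] by blast
  ultimately show ?thesis unfolding L_charts_def product_charts_def P(1)
    by (intro bexI[of _ "(fst c1 \<times> fst c2, map_prod (snd c1) (snd c2))"]) force+
qed

lemma L_chart_subset:
  assumes "c \<in> L_charts X A \<sigma> n S V" "P \<in> fst c"
  shows "fst P \<in> S" "snd P \<in> torus_proj V ` V"
proof -
  obtain c0 W B where "openin (top_of_set V) B"
    "c = ((fst c0 \<inter> S) \<times> torus_proj V ` B, map_prod (snd c0) (inv_into B (torus_proj V)))"
    by (rule L_charts_cases[OF assms(1)]) (rule that; assumption)
  moreover from this(1) have "B \<subseteq> V" by (rule openin_imp_subset)
  ultimately show "fst P \<in> S" "snd P \<in> torus_proj V ` V" using assms(2) by auto
qed

text \<open>The exponential map is constant on cosets, so it descends to the quotient torus.\<close>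

lemma F_continuous: "continuous_map (L_top X S V) X (F_map act)"
proof -
  let ?t = "\<lambda>C. torus_exp (SOME v. v \<in> C)"
  have "continuous_on V torus_exp"
    using Ck_on_torus_exp[of 0 V] by simp
  then have "continuous_map (top_of_set V) (top_of_set complex_torus) torus_exp"
    using torus_exp_in_complex_torus by auto
  then have "continuous_map (quotient_torus_top V) (top_of_set complex_torus) ?t"
    by (intro continuous_map_quotient_torus) (simp add: torus_exp_some[OF subspace_V])
  then have "continuous_map (L_top X S V) (top_of_set complex_torus) (?t \<circ> snd)"
    unfolding L_top_def by (rule continuous_map_compose[OF continuous_map_snd])
  moreover have "continuous_map (L_top X S V) X fst"
    unfolding L_top_def using continuous_map_fst continuous_map_into_fulltopology by blast
  ultimately have "continuous_map (L_top X S V) (prod_topology (top_of_set complex_torus) X)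
      (\<lambda>P. ((?t \<circ> snd) P, fst P))"
    by (simp only: continuous_map_paired)
  from continuous_map_compose[OF this act_continuous] show ?thesis
    by (simp add: F_map_def o_def case_prod_unfold)
qed

lemma F_in: "P \<in> topspace (L_top X S V) \<Longrightarrow> F_map act P \<in> topspace X"
  using F_continuous by (auto simp: continuous_map)

lemma lagrangian_immersion_F:
  assumes "toric_volume_form X A act bp \<gamma> \<Omega>"
  shows "lagrangian_immersion (L_top X S V) (L_charts X A \<sigma> n S V) X A \<omega> (F_map act)"
proof -
  let ?B = "L_charts X A \<sigma> n S V" and ?F = "F_map act"
  have at: "(\<exists>N \<Psi>. open N \<and> snd c P \<in> N \<and> (\<forall>k. Ck_on k \<Psi> N) \<and>
      (\<forall>z\<in>snd c ` fst c \<inter> N. local_rep c c' ?F z = \<Psi> z)) \<and>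
    inj_on (pushforward c c' ?F P) (model_space c) \<and> dim (model_space c) = CARD('m) \<and>
    (\<forall>a\<in>model_space c. \<forall>b\<in>model_space c.
      \<omega> c' (?F P) (pushforward c c' ?F P a) (pushforward c c' ?F P b) = 0)"
    if c: "c \<in> ?B" "c' \<in> A" "P \<in> fst c" "?F P \<in> fst c'" for c c' P
  proof -
    have "fst P \<in> topspace X" using L_chart_subset[OF c(1,3)] S_subset by blast
    then obtain e K U \<phi> where lc: "level_chart X A act bp \<Sigma> \<omega> g \<mu> \<sigma> \<Delta> d lam \<kappa> n \<zeta> cs V S e K U \<phi> \<gamma> \<Omega>"
      "fst P \<in> U" using level_chart_exists[OF assms] by blast
    show ?thesis
      using level_chart.immersion_at(1-4)[OF lc(1) c(1,3) lc(2) c(2,4)] by blast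
  qed
  have "smooth_map (L_top X S V) ?B X A ?F"
    unfolding smooth_map_def
  proof (intro conjI ballI F_continuous)
    fix c c' assume c: "c \<in> ?B" "c' \<in> A"
    have sub: "local_dom c c' ?F \<subseteq> snd c ` fst c" by (auto simp: local_dom_def)
    show "smooth_on (local_dom c c' ?F) (local_rep c c' ?F)"
      unfolding smooth_on_def
    proof
      fix x assume "x \<in> local_dom c c' ?F"
      then obtain P where P: "P \<in> fst c" "?F P \<in> fst c'" "x = snd c P" by (auto simp: local_dom_def)
      obtain N \<Psi> where "open N" "snd c P \<in> N" "\<forall>k. Ck_on k \<Psi> N"
        "\<forall>z\<in>snd c ` fst c \<inter> N. local_rep c c' ?F z = \<Psi> z"
        using at[OF c P(1,2)] by blast
      with sub P(3) show "\<exists>U g. open U \<and> x \<in> U \<and> (\<forall>k. Ck_on k g U) \<and>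
          (\<forall>y\<in>local_dom c c' ?F \<inter> U. g y = local_rep c c' ?F y)"
        by (intro exI[of _ N] exI[of _ \<Psi>]) auto
    qed
  qed
  moreover have "dim (model_space c) = CARD('m)" if "c \<in> ?B" "P \<in> fst c" for c P
  proof -
    have "P \<in> topspace (L_top X S V)"
      using L_chart_subset[OF that] topspace_L by (metis mem_Times_iff)
    then obtain c' where "c' \<in> A" "?F P \<in> fst c'" using A_cover F_in by blast
    then show ?thesis using at that by blast
  qed
  ultimately show ?thesis
    unfolding lagrangian_immersion_def smooth_immersion_def using at by blast
qed

text \<open>
  All choices of charts and bases give the same class, so only the existence of such a choice has to
  be added.
\<close>

lemma lagrangian_angle_F:
  assumes "toric_volume_form X A act bp \<gamma> \<Omega>" and p: "p \<in> S" and v: "v \<in> V"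
  shows "lagrangian_angle (L_charts X A \<sigma> n S V) A \<Omega> (F_map act) (p, torus_proj V v) =
    mod_pi (2 * pi * (rvec \<gamma> \<bullet> v) + real n * (pi / 2))" (is "?angle = ?m")
proof -
  let ?B = "L_charts X A \<sigma> n S V" and ?F = "F_map act" and ?P = "(p, torus_proj V v)"
  obtain e K U \<phi> where lc: "level_chart X A act bp \<Sigma> \<omega> g \<mu> \<sigma> \<Delta> d lam \<kappa> n \<zeta> cs V S e K U \<phi> \<gamma> \<Omega>" "p \<in> U"
    using level_chart_exists[OF assms(1)] p S_subset by blast
  have val: "mod_pi (Arg (\<Omega> c' (?F ?P) (\<lambda>j. pushforward c c' ?F ?P (b j)))) = ?m"
    if "c \<in> ?B" "?P \<in> fst c" "c' \<in> A" "?F ?P \<in> fst c'" "inj b" "independent (range b)"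
      "span (range b) = model_space c" for c c' b
    using level_chart.immersion_at(5)[OF lc(1) that(1,2) _ that(3-7)] lc(2) by simp
  have P: "?P \<in> topspace (L_top X S V)" using p v topspace_L by auto
  obtain c where c: "c \<in> ?B" "?P \<in> fst c" using L_chart_at[OF P] by blast
  obtain c' where c': "c' \<in> A" "?F ?P \<in> fst c'" using A_cover F_in[OF P] by blast
  have dim: "dim (model_space c) = CARD('m)"
    using level_chart.immersion_at(3)[OF lc(1) c _ c'] lc(2) by simp
  obtain b :: "'m \<Rightarrow> (complex ^ 'm) \<times> (real ^ 'm)" where
    b: "inj b" "independent (range b)" "span (range b) = model_space c"
  proof -
    obtain M where M: "M \<subseteq> model_space c" "independent M" "model_space c \<subseteq> span M"
      "card M = dim (model_space c)" using basis_exists by blast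
    have "finite M" using M(2) by (rule independent_imp_finite)
    then obtain b :: "'m \<Rightarrow> (complex ^ 'm) \<times> (real ^ 'm)" where "bij_betw b UNIV M"
      using finite_same_card_bij[of "UNIV :: 'm set" M] M(4) dim by auto
    then have "inj b" "range b = M" by (auto simp: bij_betw_def)
    moreover have "span M = model_space c"
      using M(1,3) span_minimal[OF M(1)] by (auto simp: model_space_def)
    ultimately show ?thesis using that M(2) by blast
  qed
  have "?angle = \<Union>{?m}"
    unfolding lagrangian_angle_def
  proof (rule arg_cong[of _ _ Union], intro equalityI subsetI)
    fix x assume "x \<in> {mod_pi (Arg (\<Omega> c' (?F ?P) (\<lambda>j. pushforward c c' ?F ?P (e j)))) | c c' e.
        c \<in> ?B \<and> ?P \<in> fst c \<and> c' \<in> A \<and> ?F ?P \<in> fst c' \<and>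
        inj e \<and> independent (range e) \<and> span (range e) = model_space c}"
    then show "x \<in> {?m}" using val by blast
  next
    fix x assume "x \<in> {?m}"
    then have "x = mod_pi (Arg (\<Omega> c' (?F ?P) (\<lambda>j. pushforward c c' ?F ?P (b j))))"
      using val[OF c c' b] by simp
    with c c' b show "x \<in> {mod_pi (Arg (\<Omega> c' (?F ?P) (\<lambda>j. pushforward c c' ?F ?P (e j)))) | c c' e.
        c \<in> ?B \<and> ?P \<in> fst c \<and> c' \<in> A \<and> ?F ?P \<in> fst c' \<and>
        inj e \<and> independent (range e) \<and> span (range e) = model_space c}" by blast
  qed
  then show ?thesis by simp
qed

end

theorem corollary1p1:
  fixes X :: "'a topology"
    and A :: "('a, complex ^ 'm) chart set"
    and act :: "complex ^ 'm \<Rightarrow> 'a \<Rightarrow> 'a"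
    and bp :: 'a
    and \<Sigma> :: "(real ^ 'm) set set"
    and \<omega> g :: "('a, 'm::finite) tensor2"
    and \<mu> :: "'a \<Rightarrow> real ^ 'm"
    and \<sigma> :: "'a \<Rightarrow> 'a"
    and \<Delta> :: "(real ^ 'm) set"
    and d :: nat and lam :: "nat \<Rightarrow> int ^ 'm" and \<kappa> :: "nat \<Rightarrow> real"
    and \<gamma> :: "int ^ 'm" and \<Omega> :: "('a, 'm) mform"
    and n :: nat and \<zeta> :: "nat \<Rightarrow> int ^ 'm" and c :: "nat \<Rightarrow> real"
    and V :: "(real ^ 'm) set" and S :: "'a set"
  assumes "toric_kaehler_manifold X A act bp \<Sigma> \<omega> g \<mu>"
    and "\<Delta> = \<mu> ` topspace X"
    and "moment_polytope_data \<Sigma> \<Delta> d lam \<kappa>"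
    and "toric_real_structure X A act bp \<sigma>"
    and "\<forall>i\<in>{1..d}. rvec \<gamma> \<bullet> rvec (lam i) = 1"
    and "toric_volume_form X A act bp \<gamma> \<Omega>"
    and "n \<le> CARD('m)"
    and "inj_on (\<lambda>i. rvec (\<zeta> i)) {1..n}" and "independent ((\<lambda>i. rvec (\<zeta> i)) ` {1..n})"
    and "V = zeta_span n \<zeta>"
    and "\<exists>y\<in>interior \<Delta>. \<forall>i\<in>{1..n}. y \<bullet> rvec (\<zeta> i) = c i"
    and "\<forall>y\<in>\<Delta>. (\<forall>i\<in>{1..n}. y \<bullet> rvec (\<zeta> i) = c i) \<longrightarrow> zeta_regular n \<zeta> d lam \<kappa> y"
    and "S = real_level_set X \<sigma> \<mu> n \<zeta> c"
    and "embedded_submanifold CARD('m) (subtopology X (fixed_set X \<sigma>)) (real_form_charts X A \<sigma>)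
           (CARD('m) - n) S"
    and "\<exists>H :: (complex ^ 'm) set. subtorus n H \<and>
           topological_group_iso (quotient_torus V) (quotient_torus_top V)
             (torus_group\<lparr>carrier := H\<rparr>) (top_of_set H)"
  shows "special_lagrangian (L_top X S V) (L_charts X A \<sigma> n S V) X A \<omega> \<Omega> (F_map act) \<longleftrightarrow>
           (\<forall>i\<in>{1..n}. rvec \<gamma> \<bullet> rvec (\<zeta> i) = 0)"
proof -
  interpret level_set X A act bp \<Sigma> \<omega> g \<mu> \<sigma> \<Delta> d lam \<kappa> n \<zeta> c V S
    by unfold_locales (fact assms)+
  let ?m = "\<lambda>v. mod_pi (2 * pi * (rvec \<gamma> \<bullet> v) + real n * (pi / 2))"
  have "S \<noteq> {}"
  proof -
    obtain y where y: "y \<in> \<Delta>" "\<forall>i\<in>{1..n}. y \<bullet> rvec (\<zeta> i) = c i"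
      using assms(11) interior_subset by blast
    then obtain q where q: "q \<in> topspace X" "y = \<mu> q" using assms(2) by blast
    obtain p where "p \<in> fixed_set X \<sigma>" "\<mu> p = \<mu> q" using moment_value_real[OF assms(4) q(1)] by blast
    then have "p \<in> S" using y q by (simp add: S_eq real_level_set_def)
    then show ?thesis by blast
  qed
  then obtain p where p: "p \<in> S" by blast
  have angle: "(\<forall>P\<in>topspace (L_top X S V).
      lagrangian_angle (L_charts X A \<sigma> n S V) A \<Omega> (F_map act) P = mod_pi \<theta>) \<longleftrightarrow>
      (\<forall>v\<in>V. ?m v = mod_pi \<theta>)" for \<theta>
    using p by (auto simp: topspace_L lagrangian_angle_F[OF assms(6)])
  have sl: "special_lagrangian (L_top X S V) (L_charts X A \<sigma> n S V) X A \<omega> \<Omega> (F_map act) \<longleftrightarrow>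
      (\<exists>\<theta>. \<forall>v\<in>V. ?m v = mod_pi \<theta>)"
    unfolding special_lagrangian_def angle using lagrangian_immersion_F[OF assms(6)] by blast
  show ?thesis unfolding sl
  proof
    assume "\<exists>\<theta>. \<forall>v\<in>V. ?m v = mod_pi \<theta>"
    then obtain \<theta> where \<theta>: "\<forall>v\<in>V. ?m v = mod_pi \<theta>" by blast
    show "\<forall>i\<in>{1..n}. rvec \<gamma> \<bullet> rvec (\<zeta> i) = 0"
    proof (rule ccontr)
      assume "\<not> ?thesis"
      then obtain i where i: "i \<in> {1..n}" "rvec \<gamma> \<bullet> rvec (\<zeta> i) \<noteq> 0" by blast
      \<comment> \<open>moving along this multiple of \<open>\<zeta> i\<close> changes the angle by a quarter of \<open>2 \<pi>\<close>\<close>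
      let ?v = "(1 / (4 * (rvec \<gamma> \<bullet> rvec (\<zeta> i)))) *\<^sub>R rvec (\<zeta> i)"
      have "?v \<in> V" using i(1) unfolding V_eq zeta_span_def by (intro span_scale span_base) blast
      moreover have "0 \<in> V" by (rule subspace_0[OF subspace_V])
      ultimately have "?m ?v = ?m 0" using \<theta> by metis
      then obtain k :: int where "2 * pi * (rvec \<gamma> \<bullet> ?v) = of_int k * pi"
        unfolding mod_pi_eq_iff by auto
      moreover have "rvec \<gamma> \<bullet> ?v = 1 / 4" using i(2) by simp
      ultimately have "of_int (2 * k) = (1 :: real)" by simp
      then have "2 * k = 1" using of_int_eq_1_iff by blast
      then show False by presburger
    qed
  next
    assume orth: "\<forall>i\<in>{1..n}. rvec \<gamma> \<bullet> rvec (\<zeta> i) = 0"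
    have "rvec \<gamma> \<bullet> v = 0" if "v \<in> V" for v
    proof -
      have "orthogonal (rvec \<gamma>) v"
        using that orth unfolding V_eq zeta_span_def
        by (intro orthogonal_to_span[of v]) (auto simp: orthogonal_def)
      then show ?thesis by (simp add: orthogonal_def)
    qed
    then have "\<forall>v\<in>V. ?m v = mod_pi (real n * (pi / 2))" by simp
    then show "\<exists>\<theta>. \<forall>v\<in>V. ?m v = mod_pi \<theta>" by blast
  qed
qed

end
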